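(* Let $0<|q|<1$ and let $n=1,2,3,\dots$. Then $$\vartheta_3(0,-q)^{4n^2}=1+\sum_{p=1}^{n}(-1)^p2^{2n^2+n}\prod_{r=1}^{2n-1}(r!)^{-1}\sum_{\substack{y_1,\dots,y_p\ge1\\ m_1>m_2>\cdots>m_p\ge1}}(-1)^{y_1+\cdots+y_p}(-1)^{m_1+\cdots+m_p}q^{m_1y_1+\cdots+m_py_p}$$ $$\cdot\prod_{1\le r<s\le p}\left(m_r^2-m_s^2\right)^2\cdot(m_1m_2\cdots m_p)\sum_{\substack{\emptyset\subset S,T\subseteq I_n\\ \|S\|=\|T\|=p}}(-1)^{\Sigma(S)+\Sigma(T)}\det\left(D_{n-p,S^c,T^c}\right)$$ $$\cdot(m_1m_2\cdots m_p)^{2\ell_1+2j_1-4}\,s_\lambda(m_1^2,\dots,m_p^2)\,s_\nu(m_1^2,\dots,m_p^2),$$ where the $y_i$ and $m_i$ are integers; $S=\{\ell_1<\cdots<\ell_p\}$, $S^c=I_n\setminus S=\{\ell_{p+1}<\cdots<\ell_n\}$, $T=\{j_1<\cdots<j_p\}$, $T^c=I_n\setminus T=\{j_{p+1}<\cdots<j_n\}$; $D_{n-p,S^c,T^c}$ is the $(n-p)\times(n-p)$ matrix $$D_{n-p,S^c,T^c}:=\left[c_{(\ell_{p+r}+j_{p+s}-1)}\right]_{1\le r,s\le n-p},\qquad c_i:=(-1)^{i-1}\frac{2^{2i}-1}{4i}|B_{2i}|\quad(i=1,2,3,\dots);$$ and $s_\lambda,s_\nu$ are the Schur functions for the partitions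 $\lambda=(\lambda_1,\dots,\lambda_p)$ and $\nu=(\nu_1,\dots,\nu_p)$ given by $$\lambda_i:=\ell_{p-i+1}-\ell_1+i-p,\qquad \nu_i:=j_{p-i+1}-j_1+i-p,\qquad i=1,2,\dots,p.$$
   Context: $\vartheta_3(0,q):=\sum_{j=-\infty}^{\infty}q^{j^2}$, so $\vartheta_3(0,-q)=\sum_{j=-\infty}^{\infty}(-1)^{j}q^{j^2}$. $I_n:=\{1,\dots,n\}$, $\|S\|$ is the cardinality of $S$, $\Sigma(S):=\ell_1+\cdots+\ell_p$ and $\Sigma(T):=j_1+\cdots+j_p$. The determinant of the $0\times0$ matrix is $1$. For a partition $\lambda=(\lambda_1\ge\cdots\ge\lambda_p\ge0)$, the Schur function is $s_\lambda(x_1,\dots,x_p):=\dfrac{\det(x_i^{\lambda_j+p-j})_{1\le i,j\le p}}{\det(x_i^{p-j})_{1\le i,j\le p}}$. The Bernoulli numbers $B_n$ are defined by $\frac{t}{e^t-1}=\sum_{n=0}^{\infty}B_n\frac{t^n}{n!}$. *)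

theory Defs
  imports
    "HOL-Analysis.Infinite_Sum"
    "HOL-Computational_Algebra.Formal_Power_Series"
    "Jordan_Normal_Form.Determinant"
begin

text \<open>The theta constant $\vartheta_3(0,q)$, the sum of $q^{j^2}$ over all integers $j$.\<close>

definition theta3_0 :: "complex \<Rightarrow> complex" where
  "theta3_0 q = (\<Sum>\<^sub>\<infinity>j\<in>(UNIV :: int set). q ^ nat (j\<^sup>2))"

text \<open>The quotient is one of formal power series; it is exact because both series have
  subdegree 1. The convention is $B_1 = -1/2$.\<close>

definition bernoulli_number :: "nat \<Rightarrow> real" where
  "bernoulli_number n = fact n * fps_nth (fps_X / (fps_exp 1 - 1)) n"

lemma bernoulli_number_egf:
  "Abs_fps (\<lambda>n. bernoulli_number n / fact n) * (fps_exp 1 - 1) = fps_X"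
proof -
  have eq: "Abs_fps (\<lambda>n. bernoulli_number n / fact n) = fps_X / (fps_exp 1 - 1)"
    by (rule fps_ext) (simp add: bernoulli_number_def)
  have nth1: "fps_nth (fps_exp (1::real) - 1) (Suc 0) = 1"
    by simp
  then have nz: "fps_exp (1::real) - 1 \<noteq> 0"
    by (metis fps_zero_nth zero_neq_one)
  have "subdegree (fps_exp (1::real) - 1) \<le> 1"
    using nth1 by (intro subdegree_leI) simp
  then have "(fps_exp (1::real) - 1) dvd fps_X"
    using nz by (simp add: fps_dvd_iff)
  then show ?thesis
    unfolding eq by simp
qed

definition c_coeff :: "nat \<Rightarrow> real" where
  "c_coeff i = (-1) ^ (i - 1) * ((2 ^ (2 * i) - 1) / (4 * real i)) * \<bar>bernoulli_number (2 * i)\<bar>"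

text \<open>The parts of a partition and the variables are indexed from 1, matrices from 0; hence the
  shifts by 1.\<close>

definition schur :: "nat \<Rightarrow> (nat \<Rightarrow> nat) \<Rightarrow> (nat \<Rightarrow> 'a :: field) \<Rightarrow> 'a" where
  "schur p lam x =
     det (mat p p (\<lambda>(i, j). x (i + 1) ^ (lam (j + 1) + p - (j + 1)))) /
     det (mat p p (\<lambda>(i, j). x (i + 1) ^ (p - (j + 1))))"

text \<open>The \<open>r\<close>-th smallest element of a finite set, counted from 1. Thus $\ell_r$ is
  \<open>nth_elem S r\<close> and $\ell_{p+r}$ is \<open>nth_elem ({1..n} - S) r\<close>.\<close>

definition nth_elem :: "nat set \<Rightarrow> nat \<Rightarrow> nat" where
  "nth_elem S r = sorted_list_of_set S ! (r - 1)"

definition D_matrix :: "nat \<Rightarrow> nat set \<Rightarrow> nat set \<Rightarrow> real mat" where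
  "D_matrix k U V =
     mat k k (\<lambda>(r, s). c_coeff (nth_elem U (r + 1) + nth_elem V (s + 1) - 1))"

text \<open>For \<open>card S = p\<close> and $1 \le i \le p$ the natural number subtractions do not truncate,
  since $\ell_{p-i+1} - \ell_1 \ge p - i$.\<close>

definition subset_partition :: "nat \<Rightarrow> nat set \<Rightarrow> nat \<Rightarrow> nat" where
  "subset_partition p S i = nth_elem S (p - i + 1) - nth_elem S 1 + i - p"

definition summation_range :: "nat \<Rightarrow> ((nat \<Rightarrow> nat) \<times> (nat \<Rightarrow> nat)) set" where
  "summation_range p =
     {(y, m). y \<in> {1..p} \<rightarrow>\<^sub>E {1..} \<and> m \<in> {1..p} \<rightarrow>\<^sub>E {1..} \<and>
              (\<forall>r s. 1 \<le> r \<and> r < s \<and> s \<le> p \<longrightarrow> m r > m s)}"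

text \<open>In the exponent $2\ell_1 + 2j_1 - 4$ the subtraction does not truncate, as
  $\ell_1, j_1 \ge 1$.\<close>

definition subset_sum :: "nat \<Rightarrow> nat \<Rightarrow> (nat \<Rightarrow> nat) \<Rightarrow> complex" where
  "subset_sum n p m =
     (\<Sum>(S, T) \<in> {(S, T). {} \<subset> S \<and> S \<subseteq> {1..n} \<and> {} \<subset> T \<and> T \<subseteq> {1..n} \<and>
                           card S = p \<and> card T = p}.
        (-1) ^ (\<Sum>S + \<Sum>T)
        * of_real (det (D_matrix (n - p) ({1..n} - S) ({1..n} - T)))
        * (\<Prod>r=1..p. of_nat (m r)) ^ (2 * nth_elem S 1 + 2 * nth_elem T 1 - 4)
        * schur p (subset_partition p S) (\<lambda>i. of_nat (m i) ^ 2)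
        * schur p (subset_partition p T) (\<lambda>i. of_nat (m i) ^ 2))"

definition series_term :: "complex \<Rightarrow> nat \<Rightarrow> nat \<Rightarrow> (nat \<Rightarrow> nat) \<Rightarrow> (nat \<Rightarrow> nat) \<Rightarrow> complex" where
  "series_term q n p y m =
     (-1) ^ (\<Sum>r=1..p. y r) * (-1) ^ (\<Sum>r=1..p. m r) * q ^ (\<Sum>r=1..p. m r * y r)
     * (\<Prod>(r, s) \<in> {(r, s). 1 \<le> r \<and> r < s \<and> s \<le> p}. (of_nat (m r) ^ 2 - of_nat (m s) ^ 2) ^ 2)
     * (\<Prod>r=1..p. of_nat (m r))
     * subset_sum n p m"

end

theory Submission
  imports Defs
begin

text \<open>
  Put $x = e^t$ and $\varphi = \vartheta_3(0,-q)$. The bilateral series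
  $F = \sum_n (-1)^n x^n / (1 + q^n)$, regularised at $|x| = 1$, is an odd function of $t$ whose
  Taylor coefficients are, up to the factor $-2$, the numbers $c_i$ plus Lambert series.
  Multiplying $F$ by a theta series turns its coefficients into a two-term recursion, so that $F$ is
  a quotient of two theta series. Product identities for theta series, all obtained by splitting
  a double sum according to the parity of $i + j$, then give
  $(F')^2 = \delta + \alpha F^2 + F^4$ and $F'(0) = - \varphi^4 / 4$. Hence
  $F^{(2j)}$ is an odd polynomial in $F$ of degree $2j + 1$ with leading coefficient $(2j)!$, and the
  Hankel determinant of the numbers $F^{(2i+2j+1)}(0)$ is triangular up to a change of basis: it is
  $\prod_{r<2n} r!$ times $(- \varphi^4 / 4)^{n^2}$. The theorem is the expansion of this
  determinant as the determinant of a sum of two matrices; minors of the Lambert matrix are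
  infinite Cauchy--Binet sums of products of two alternants, that is, of Schur functions. The
  contribution of $p = 0$ is evaluated by letting $q$ tend to $0$.
\<close>

section \<open>Exponential sums as formal power series\<close>

text \<open>The theta identities are identities of formal power series in t, where cancelling a
  nonzero factor replaces arguments about zeros and poles. The obstacle is that the coefficients of
  F do not decay; so (1 + x) F, whose coefficients do, is multiplied by the theta series, and 1 + x
  is cancelled afterwards. Up to a constant, F is theta_1/theta_2, that is, Jacobi's function sc.
  Its normalisation rests on Jacobi's theta_1' = theta_2 theta_3 theta_4 and on nonvanishing theta
  constants; both come from following q, q^2, q^4, ... to 0 along duplication formulas. The
  coefficient of F^4 is 1 because the quartic, written in F^2/C^2 with C the constant in F = C
  theta_1/theta_2, is palindromic: its leading coefficient is read off from F'(0). The top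
  coefficient (2j)! of F^(2j) depends on this 1 alone, so the mere existence of delta and alpha
  suffices. The exponent n^2 is 1 + 3 + ... + (2n-1), one odd power of F'(0) per row.\<close>

definition moments :: "('i \<Rightarrow> complex) \<Rightarrow> ('i \<Rightarrow> complex) \<Rightarrow> bool" where
  "moments b w \<longleftrightarrow> (\<forall>k. (\<lambda>j. b j * w j ^ k) summable_on UNIV)"

text \<open>The Taylor series in $t$ of $\sum_j b_j e^{w_j t}$; only the convergence of all moments is
  needed, not that of the Taylor series.\<close>

definition exp_sum :: "('i \<Rightarrow> complex) \<Rightarrow> ('i \<Rightarrow> complex) \<Rightarrow> complex fps" where
  "exp_sum b w = Abs_fps (\<lambda>k. (\<Sum>\<^sub>\<infinity>j. b j * w j ^ k) / fact k)"

text \<open>Over the complex numbers unordered summability is absolute, so Fubini's theorem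
  applies.\<close>

lemma has_sum_product:
  fixes f :: "'a \<Rightarrow> complex" and g :: "'b \<Rightarrow> complex"
  assumes "f summable_on A" "g summable_on B"
  shows "((\<lambda>(x, y). f x * g y) has_sum (infsum f A * infsum g B)) (A \<times> B)"
proof -
  have "(\<lambda>(x, y). f x * g y) abs_summable_on A \<times> B"
    using assms unfolding summable_on_iff_abs_summable_on_complex abs_summable_on_Sigma_iff
    by (auto simp: norm_mult infsum_cmult_right' abs_mult infsum_nonneg
             intro!: summable_on_cmult_right summable_on_cmult_left)
  hence s: "(\<lambda>(x, y). f x * g y) summable_on A \<times> B"
    by (rule abs_summable_summable)
  have "infsum (\<lambda>(x, y). f x * g y) (A \<times> B) = (\<Sum>\<^sub>\<infinity>x\<in>A. \<Sum>\<^sub>\<infinity>y\<in>B. f x * g y)"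
    using infsum_Sigma'_banach[of "\<lambda>x y. f x * g y" A "\<lambda>_. B"] s by simp
  also have "\<dots> = infsum f A * infsum g B"
    by (simp add: infsum_cmult_right' infsum_cmult_left')
  finally show ?thesis using s by (metis has_sum_infsum)
qed

lemma has_sum_sum_finite:
  fixes f :: "'a \<Rightarrow> 'b \<Rightarrow> complex"
  assumes "\<And>k. k \<in> K \<Longrightarrow> (f k has_sum s k) A"
  shows "((\<lambda>x. \<Sum>k\<in>K. f k x) has_sum (\<Sum>k\<in>K. s k)) A"
  using assms by (induction K rule: infinite_finite_induct) (auto intro!: has_sum_add)

lemma exp_sum_cong: "(\<And>j. b j = b' j) \<Longrightarrow> (\<And>j. w j = w' j) \<Longrightarrow> exp_sum b w = exp_sum b' w'"
  by (metis ext)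

text \<open>Binomial expansion of the mixed frequency: every term factors, so one
  \<open>has_sum\<close> yields both the mixed moments and, after division by n!, the Cauchy product
  of the two series.\<close>

lemma moments_tensor_aux:
  assumes "moments b w" "moments c v"
  shows "((\<lambda>(i, j). (b i * c j) * (w i + v j) ^ n) has_sum
     (\<Sum>k\<le>n. of_nat (n choose k) * ((\<Sum>\<^sub>\<infinity>j. b j * w j ^ k) * (\<Sum>\<^sub>\<infinity>j. c j * v j ^ (n - k))))) UNIV"
proof -
  have "((\<lambda>x. \<Sum>k\<le>n. of_nat (n choose k) * (case x of (i, j) \<Rightarrow> (b i * w i ^ k) * (c j * v j ^ (n - k)))) has_sum
     (\<Sum>k\<le>n. of_nat (n choose k) * ((\<Sum>\<^sub>\<infinity>j. b j * w j ^ k) * (\<Sum>\<^sub>\<infinity>j. c j * v j ^ (n - k))))) (UNIV \<times> UNIV)"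
    using assms by (intro has_sum_sum_finite has_sum_cmult_right has_sum_product) (auto simp: moments_def)
  moreover have "(\<Sum>k\<le>n. of_nat (n choose k) * (case x of (i, j) \<Rightarrow> (b i * w i ^ k) * (c j * v j ^ (n - k))))
     = (case x of (i, j) \<Rightarrow> (b i * c j) * (w i + v j) ^ n)" for x
    by (cases x) (simp add: binomial_ring sum_distrib_left mult_ac)
  ultimately show ?thesis by simp
qed

lemma moments_tensor:
  assumes "moments b w" "moments c v"
  shows "moments (\<lambda>(i, j). b i * c j) (\<lambda>(i, j). w i + v j)"
  using has_sum_imp_summable[OF moments_tensor_aux[OF assms]]
  unfolding moments_def by (simp add: case_prod_unfold)

lemma exp_sum_mult:
  assumes "moments b w" "moments c v"
  shows "exp_sum b w * exp_sum c v = exp_sum (\<lambda>(i, j). b i * c j) (\<lambda>(i, j). w i + v j)"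
proof (rule fps_ext)
  fix n
  have "fps_nth (exp_sum (\<lambda>(i, j). b i * c j) (\<lambda>(i, j). w i + v j)) n =
     (\<Sum>k\<le>n. of_nat (n choose k) * ((\<Sum>\<^sub>\<infinity>j. b j * w j ^ k) * (\<Sum>\<^sub>\<infinity>j. c j * v j ^ (n - k)))) / fact n"
    using infsumI[OF moments_tensor_aux[OF assms]] by (simp add: exp_sum_def case_prod_unfold)
  also have "\<dots> = (\<Sum>k\<le>n. ((\<Sum>\<^sub>\<infinity>j. b j * w j ^ k) / fact k) * ((\<Sum>\<^sub>\<infinity>j. c j * v j ^ (n - k)) / fact (n - k)))"
    unfolding sum_divide_distrib
    by (intro sum.cong) (auto simp: binomial_fact field_simps)
  also have "\<dots> = fps_nth (exp_sum b w * exp_sum c v) n"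
    by (simp add: fps_mult_nth exp_sum_def atLeast0AtMost)
  finally show "fps_nth (exp_sum b w * exp_sum c v) n = fps_nth (exp_sum (\<lambda>(i, j). b i * c j) (\<lambda>(i, j). w i + v j)) n" ..
qed

lemma exp_sum_reindex:
  assumes "bij f"
  shows "exp_sum (\<lambda>i. b (f i)) (\<lambda>i. w (f i)) = exp_sum b w"
  unfolding exp_sum_def using infsum_reindex_bij_betw[OF assms, of "\<lambda>j. b j * w j ^ k" for k] by simp

lemma moments_reindex:
  assumes "bij f"
  shows "moments (\<lambda>i. b (f i)) (\<lambda>i. w (f i)) \<longleftrightarrow> moments b w"
  unfolding moments_def using summable_on_reindex_bij_betw[OF assms, of "\<lambda>j. b j * w j ^ k" for k] by simp

lemma moments_mult_weight: "moments b w \<Longrightarrow> moments (\<lambda>j. b j * w j) w"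
  unfolding moments_def by (metis (no_types, lifting) ext mult.assoc power_Suc)

lemma fps_deriv_exp_sum: "fps_deriv (exp_sum b w) = exp_sum (\<lambda>j. b j * w j) w"
  by (rule fps_ext) (simp add: exp_sum_def mult_ac del: of_nat_Suc)

lemma exp_sum_cmult: "exp_sum (\<lambda>j. c * b j) w = fps_const c * exp_sum b w"
  by (rule fps_ext) (simp add: exp_sum_def mult.assoc infsum_cmult_right')

lemma moments_uminus: "moments b w \<Longrightarrow> moments (\<lambda>j. - b j) w"
  unfolding moments_def by (simp add: summable_on_uminus)

lemma exp_sum_uminus: "exp_sum (\<lambda>j. - b j) w = - exp_sum b w"
  by (rule fps_ext) (simp add: exp_sum_def infsum_uminus)

lemma moments_add: "moments b w \<Longrightarrow> moments c w \<Longrightarrow> moments (\<lambda>j. b j + c j) w"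
  unfolding moments_def by (simp add: distrib_right summable_on_add)

lemma exp_sum_add: "moments b w \<Longrightarrow> moments c w \<Longrightarrow> exp_sum (\<lambda>j. b j + c j) w = exp_sum b w + exp_sum c w"
  unfolding moments_def
  by (intro fps_ext) (simp add: exp_sum_def distrib_right infsum_add add_divide_distrib)

lemma exp_sum_shift:
  assumes "moments b w"
  shows "exp_sum b (\<lambda>j. w j + c) = fps_exp c * exp_sum b w"
proof -
  \<comment> \<open>A single exponential is an \<open>exp_sum\<close> over the one-point type, so
    shifting all frequencies is an instance of \<open>exp_sum_mult\<close>.\<close>
  have a: "moments (\<lambda>_::unit. 1) (\<lambda>_. c)" by (simp add: moments_def)
  have e: "exp_sum (\<lambda>_::unit. 1) (\<lambda>_. c) = fps_exp c"
    by (rule fps_ext) (simp add: exp_sum_def)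
  have "exp_sum b w * exp_sum (\<lambda>_::unit. 1) (\<lambda>_. c) = exp_sum (\<lambda>(i, j::unit). b i * 1) (\<lambda>(i, j). w i + c)"
    by (rule exp_sum_mult[OF assms a])
  also have "\<dots> = exp_sum (\<lambda>i. (\<lambda>(i, j::unit). b i * 1) ((\<lambda>i. (i, ())) i)) (\<lambda>i. (\<lambda>(i, j). w i + c) ((\<lambda>i. (i, ())) i))"
    by (rule exp_sum_reindex[symmetric]) (auto intro!: bijI injI)
  finally show ?thesis by (simp add: e mult.commute)
qed

text \<open>An index that is absent from the frequency belongs to a factor with frequency 0, of
  which only the zeroth moment survives (0^0 = 1): a constant series.\<close>

lemma exp_sum_separate:
  assumes "moments b w" "c summable_on UNIV"
  shows "exp_sum (\<lambda>(i, j). b i * c j) (\<lambda>(i, j). w i) = exp_sum b w * fps_const (infsum c UNIV)"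
proof -
  have a: "moments c (\<lambda>_. 0)"
  proof (unfold moments_def, intro allI)
    fix k show "(\<lambda>j. c j * 0 ^ k) summable_on UNIV" using assms(2) by (cases k) auto
  qed
  have e: "exp_sum c (\<lambda>_. 0) = fps_const (infsum c UNIV)"
  proof (rule fps_ext)
    fix k show "fps_nth (exp_sum c (\<lambda>_. 0)) k = fps_nth (fps_const (infsum c UNIV)) k"
      by (cases k) (auto simp: exp_sum_def)
  qed
  show ?thesis using exp_sum_mult[OF assms(1) a] e by simp
qed

text \<open>The coordinates m (half the sum) and r (half the difference) diagonalise the quadratic
  exponent of a product of two theta series. The even class is centred at m + 1 so that
  \<open>triang\<close> and the half-integral frequencies separate without further shifts.\<close>

lemma exp_sum_pairs_parity:
  fixes b w :: "int \<times> int \<Rightarrow> complex"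
  assumes "moments b w"
  shows "exp_sum b w = exp_sum (\<lambda>(m, r). b (m + 1 + r, m + 1 - r)) (\<lambda>(m, r). w (m + 1 + r, m + 1 - r))
     + exp_sum (\<lambda>(m, r). b (m + r + 1, m - r)) (\<lambda>(m, r). w (m + r + 1, m - r))"
proof (rule fps_ext)
  fix k
  define f where "f = (\<lambda>x. b x * w x ^ k)"
  have s: "f summable_on UNIV" using assms by (simp add: moments_def f_def)
  define E where "E = {(i, j :: int). even (i + j :: int)}"
  have 0: "bij_betw (\<lambda>(m, r). (m + 1 + r, m + 1 - r)) UNIV E"
    by (rule bij_betw_byWitness[where f' = "\<lambda>(i, j). ((i + j) div 2 - 1, (i - j) div 2)"])
       (auto simp: E_def, presburger+)
  have 1: "bij_betw (\<lambda>(m, r). (m + r + 1, m - r)) UNIV (- E)"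
    by (rule bij_betw_byWitness[where f' = "\<lambda>(i, j). ((i + j - 1) div 2, (i - j - 1) div 2)"])
       (auto simp: E_def, presburger+)
  have "infsum f UNIV = infsum f (E \<union> - E)" by simp
  also have "\<dots> = infsum f E + infsum f (- E)"
    by (rule infsum_Un_disjoint) (auto intro: summable_on_subset[OF s])
  also have "infsum f E = infsum (\<lambda>x. f ((\<lambda>(m, r). (m + 1 + r, m + 1 - r)) x)) UNIV"
    by (rule infsum_reindex_bij_betw[OF 0, symmetric])
  also have "infsum f (-E) = infsum (\<lambda>x. f ((\<lambda>(m, r). (m + r + 1, m - r)) x)) UNIV"
    by (rule infsum_reindex_bij_betw[OF 1, symmetric])
  finally show "fps_nth (exp_sum b w) k = fps_nth (exp_sum (\<lambda>(m, r). b (m + 1 + r, m + 1 - r)) (\<lambda>(m, r). w (m + 1 + r, m + 1 - r))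
     + exp_sum (\<lambda>(m, r). b (m + r + 1, m - r)) (\<lambda>(m, r). w (m + r + 1, m - r))) k"
    by (simp add: exp_sum_def f_def case_prod_unfold add_divide_distrib)
qed

section \<open>Exponentially decaying coefficients: a class with all moments, stable under the
  operations used below\<close>

definition decays :: "(int \<Rightarrow> complex) \<Rightarrow> bool" where
  "decays b \<longleftrightarrow> (\<exists>K \<rho>. 0 < \<rho> \<and> \<rho> < 1 \<and> (\<forall>j. norm (b j) \<le> K * \<rho> ^ nat \<bar>j\<bar>))"

lemma summable_on_power_abs_int:
  fixes \<rho> :: real
  assumes "0 < \<rho>" "\<rho> < 1"
  shows "(\<lambda>j::int. \<rho> ^ nat \<bar>j\<bar>) summable_on UNIV"
proof -
  have s: "(\<lambda>n. \<rho> ^ n) summable_on (UNIV :: nat set)"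
    using assms by (intro norm_summable_imp_summable_on) (auto simp: summable_geometric)
  have "(\<lambda>j::int. \<rho> ^ nat \<bar>j\<bar>) summable_on int ` UNIV"
    by (subst summable_on_reindex) (auto simp: o_def s)
  moreover have "(\<lambda>j::int. \<rho> ^ nat \<bar>j\<bar>) summable_on (\<lambda>n. - int n) ` UNIV"
    by (subst summable_on_reindex) (auto simp: o_def s inj_def)
  ultimately have "(\<lambda>j::int. \<rho> ^ nat \<bar>j\<bar>) summable_on (int ` UNIV \<union> (\<lambda>n. - int n) ` UNIV)"
    by (rule summable_on_union)
  moreover have "int ` UNIV \<union> (\<lambda>n. - int n) ` UNIV = UNIV"
  proof -
    have "j \<in> int ` UNIV \<union> (\<lambda>n. - int n) ` UNIV" for j
      by (cases "j \<ge> 0") (auto simp: image_iff intro: exI[of _ "nat j"] exI[of _ "nat (- j)"])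
    thus ?thesis by blast
  qed
  ultimately show ?thesis by simp
qed

lemma decays_summable:
  assumes "decays b"
  shows "b summable_on UNIV"
proof -
  obtain K \<rho> where K: "0 < \<rho>" "\<rho> < 1" "\<And>j. norm (b j) \<le> K * \<rho> ^ nat \<bar>j\<bar>"
    using assms by (auto simp: decays_def)
  have "(\<lambda>j. K * \<rho> ^ nat \<bar>j\<bar>) summable_on (UNIV :: int set)"
    by (intro summable_on_cmult_right summable_on_power_abs_int K)
  hence "b abs_summable_on UNIV"
    by (rule abs_summable_on_comparison_test') (use K in auto)
  thus ?thesis by (rule abs_summable_summable)
qed

text \<open>A linear factor is absorbed by enlarging the ratio from \<rho> to some \<sigma> < 1,
  since n (\<rho>/\<sigma>)^n is bounded.\<close>

lemma decays_mult_linear: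
  assumes "decays b"
  shows "decays (\<lambda>j. b j * (c * of_int j + d))"
proof -
  obtain K \<rho> where K: "0 < \<rho>" "\<rho> < 1" "\<And>j. norm (b j) \<le> K * \<rho> ^ nat \<bar>j\<bar>"
    using assms by (auto simp: decays_def)
  obtain \<sigma> where \<sigma>: "\<rho> < \<sigma>" "\<sigma> < 1" using K dense by blast
  have "(\<lambda>n. of_nat n * (\<rho> / \<sigma>) ^ n) \<longlonglongrightarrow> 0"
    using K \<sigma> by (intro powser_times_n_limit_0) auto
  hence "Bseq (\<lambda>n. of_nat n * (\<rho> / \<sigma>) ^ n)" by (rule convergent_imp_Bseq[OF convergentI])
  then obtain M where M: "M > 0" "\<And>n. norm (of_nat n * (\<rho> / \<sigma>) ^ n) \<le> M"
    by (auto elim: BseqE)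
  have M': "of_nat n * \<rho> ^ n \<le> M * \<sigma> ^ n" for n :: nat
    using M(2)[of n] K(1) \<sigma> by (simp add: power_divide field_simps)
  have "K \<ge> 0" using K(3)[of 0] norm_ge_zero[of "b 0"] by (simp del: norm_ge_zero)
  have "norm (b j * (c * of_int j + d)) \<le> (K * (norm c * M + norm d)) * \<sigma> ^ nat \<bar>j\<bar>" for j
  proof -
    define n where "n = nat \<bar>j\<bar>"
    have j: "norm (of_int j :: complex) = of_nat n" by (simp add: n_def)
    have "norm (c * of_int j + d) \<le> norm c * of_nat n + norm d"
      using norm_triangle_ineq[of "c * of_int j" d] by (simp only: norm_mult j)
    moreover have "norm (b j) \<le> K * \<rho> ^ n" using K(3) by (simp add: n_def)
    ultimately    have "norm (b j * (c * of_int j + d)) \<le> (K * \<rho> ^ n) * (norm c * of_nat n + norm d)"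
      unfolding norm_mult using \<open>K \<ge> 0\<close> K by (intro mult_mono) auto
    also have "\<dots> = K * (norm c * (of_nat n * \<rho> ^ n) + norm d * \<rho> ^ n)"
      by (simp add: algebra_simps)
    also have "\<dots> \<le> K * (norm c * (M * \<sigma> ^ n) + norm d * \<sigma> ^ n)"
      using \<open>K \<ge> 0\<close> M' K \<sigma> by (intro mult_left_mono add_mono power_mono) auto
    also have "\<dots> = (K * (norm c * M + norm d)) * \<sigma> ^ n" by (simp add: algebra_simps)
    finally show ?thesis unfolding n_def .
  qed
  thus ?thesis unfolding decays_def using \<sigma> K(1)
    by (intro exI[of _ "K * (norm c * M + norm d)"] exI[of _ \<sigma>]) auto
qed

lemma decays_imp_moments:
  assumes "decays b"
  shows "moments b (\<lambda>j. c * of_int j + d)"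
proof -
  have "decays (\<lambda>j. b j * (c * of_int j + d) ^ k)" for k
  proof (induction k)
    case 0 thus ?case using assms by simp
  next
    case (Suc k)
    show ?case using decays_mult_linear[OF Suc, of c d] by (simp add: mult_ac)
  qed
  thus ?thesis unfolding moments_def by (auto intro: decays_summable)
qed

lemma decays_mult_bounded:
  assumes "decays b" "\<And>j. norm (s j) \<le> C"
  shows "decays (\<lambda>j. s j * b j)"
proof -
  obtain K \<rho> where K: "0 < \<rho>" "\<rho> < 1" "\<And>j. norm (b j) \<le> K * \<rho> ^ nat \<bar>j\<bar>"
    using assms by (auto simp: decays_def)
  have "C \<ge> 0" using assms(2)[of 0] norm_ge_zero[of "s 0"] by linarith
  have "norm (s j * b j) \<le> (C * K) * \<rho> ^ nat \<bar>j\<bar>" for j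
  proof -
    have "norm (s j * b j) \<le> C * (K * \<rho> ^ nat \<bar>j\<bar>)"
      unfolding norm_mult using assms(2) K \<open>C \<ge> 0\<close> by (intro mult_mono) auto
    thus ?thesis by (simp add: mult_ac)
  qed
  thus ?thesis using K unfolding decays_def by blast
qed

lemma decays_cmult: "decays b \<Longrightarrow> decays (\<lambda>j. c * b j)"
  by (rule decays_mult_bounded[where C = "norm c"]) auto

lemma decays_uminus: "decays b \<Longrightarrow> decays (\<lambda>j. - b j)"
  using decays_cmult[of b "-1"] by simp

lemma decays_add:
  assumes "decays b" "decays c"
  shows "decays (\<lambda>j. b j + c j)"
proof -
  obtain K \<rho> where K: "0 < \<rho>" "\<rho> < 1" "\<And>j. norm (b j) \<le> K * \<rho> ^ nat \<bar>j\<bar>"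
    using assms by (auto simp: decays_def)
  obtain L \<sigma> where L: "0 < \<sigma>" "\<sigma> < 1" "\<And>j. norm (c j) \<le> L * \<sigma> ^ nat \<bar>j\<bar>"
    using assms by (auto simp: decays_def)
  have "norm (b j + c j) \<le> (\<bar>K\<bar> + \<bar>L\<bar>) * (max \<rho> \<sigma>) ^ nat \<bar>j\<bar>" for j
  proof -
    have "norm (b j + c j) \<le> \<bar>K\<bar> * \<rho> ^ nat \<bar>j\<bar> + \<bar>L\<bar> * \<sigma> ^ nat \<bar>j\<bar>"
      using norm_triangle_ineq[of "b j" "c j"] K(3)[of j] L(3)[of j] K(1) L(1)
        mult_right_mono[OF abs_ge_self[of K], of "\<rho> ^ nat \<bar>j\<bar>"]
        mult_right_mono[OF abs_ge_self[of L], of "\<sigma> ^ nat \<bar>j\<bar>"]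
      by (smt (verit) zero_le_power)
    also have "\<dots> \<le> \<bar>K\<bar> * (max \<rho> \<sigma>) ^ nat \<bar>j\<bar> + \<bar>L\<bar> * (max \<rho> \<sigma>) ^ nat \<bar>j\<bar>"
      using K L by (intro add_mono mult_left_mono power_mono) auto
    finally show ?thesis by (simp add: algebra_simps)
  qed
  thus ?thesis using K L unfolding decays_def
    by (intro exI[of _ "\<bar>K\<bar> + \<bar>L\<bar>"] exI[of _ "max \<rho> \<sigma>"]) auto
qed

lemma decays_shift:
  assumes "decays b"
  shows "decays (\<lambda>j. b (j + c))"
proof -
  obtain K \<rho> where K: "0 < \<rho>" "\<rho> < 1" "\<And>j. norm (b j) \<le> K * \<rho> ^ nat \<bar>j\<bar>"
    using assms by (auto simp: decays_def)
  have "K \<ge> 0" using K(3)[of 0] norm_ge_zero[of "b 0"] by (simp del: norm_ge_zero)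
  have "norm (b (j + c)) \<le> (K / \<rho> ^ nat \<bar>c\<bar>) * \<rho> ^ nat \<bar>j\<bar>" for j
  proof -
    have "norm (b (j + c)) * \<rho> ^ nat \<bar>c\<bar> \<le> (K * \<rho> ^ nat \<bar>j + c\<bar>) * \<rho> ^ nat \<bar>c\<bar>"
      using K by (intro mult_right_mono) auto
    also have "\<dots> = K * \<rho> ^ (nat \<bar>j + c\<bar> + nat \<bar>c\<bar>)" by (simp add: power_add)
    also have "\<dots> \<le> K * \<rho> ^ nat \<bar>j\<bar>"
      using K \<open>K \<ge> 0\<close> by (intro mult_left_mono power_decreasing) auto
    finally show ?thesis using K by (simp add: field_simps)
  qed
  thus ?thesis using K unfolding decays_def by blast
qed

text \<open>A linear lower bound on the exponent is all that decay requires; the offset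
  \<open>c\<close> admits exponents such as j(j-1)/2 that fall slightly below |j|.\<close>

lemma decays_powi:
  fixes q :: complex
  assumes "0 < norm q" "norm q < 1" "\<And>j. e j \<ge> \<bar>j\<bar> - c"
  shows "decays (\<lambda>j. q powi e j)"
proof -
  have "norm (q powi e j) \<le> norm q powi (- c) * norm q ^ nat \<bar>j\<bar>" for j
  proof -
    have "norm (q powi e j) = norm q powi e j" by (simp add: norm_power_int)
    also have "\<dots> \<le> norm q powi (\<bar>j\<bar> - c)"
      using assms by (intro power_int_decreasing) auto
    also have "\<dots> = norm q powi (- c) * norm q powi int (nat \<bar>j\<bar>)"
      using assms by (subst power_int_add[symmetric]) auto
    also have "norm q powi int (nat \<bar>j\<bar>) = norm q ^ nat \<bar>j\<bar>" by (rule power_int_of_nat)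
    finally show ?thesis .
  qed
  thus ?thesis using assms unfolding decays_def by blast
qed

definition alt_sign :: "int \<Rightarrow> complex" where "alt_sign j = (if even j then 1 else -1)"

lemma norm_alt_sign [simp]: "norm (alt_sign j) = 1" by (simp add: alt_sign_def)

lemma alt_sign_squared [simp]: "alt_sign j * alt_sign j = 1" "alt_sign j * (alt_sign j * x) = x" by (simp_all add: alt_sign_def)

definition triang :: "int \<Rightarrow> int" where "triang j = j * (j - 1) div 2"

lemma triang_double: "2 * triang j = j * (j - 1)"
proof -
  have "even (j * (j - 1))" by auto
  thus ?thesis by (simp add: triang_def)
qed

lemma abs_le_square_int: "\<bar>j\<bar> \<le> j * (j::int)"
proof (cases "j = 0")
  case False
  hence "1 * \<bar>j\<bar> \<le> \<bar>j\<bar> * \<bar>j\<bar>" by (intro mult_right_mono) auto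
  thus ?thesis by (simp add: abs_mult[symmetric])
qed auto

lemma pronic_nonneg: "0 \<le> j * (j + 1 :: int)"
  by (cases "j \<ge> 0") (auto intro: mult_nonpos_nonpos)

lemma triang_ge: "triang j \<ge> \<bar>j\<bar> - 1"
proof -
  have "0 \<le> (j - 1) * (j - 2)" using pronic_nonneg[of "j - 2"] by (simp add: algebra_simps)
  moreover have "0 \<le> (j + 1) * (j + 2)" using pronic_nonneg[of "j + 1"] by (simp add: algebra_simps)
  ultimately have "2 * triang j \<ge> 2 * (\<bar>j\<bar> - 1)"
    unfolding triang_double by (cases "j \<ge> 0") (auto simp: algebra_simps)
  thus ?thesis by simp
qed

lemma decays_square: "0 < norm q \<Longrightarrow> norm q < 1 \<Longrightarrow> decays (\<lambda>k. q powi (k * k))"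
  by (rule decays_powi[where c = 0]) (auto intro: abs_le_square_int)

lemma decays_pronic: "0 < norm q \<Longrightarrow> norm q < 1 \<Longrightarrow> decays (\<lambda>k. q powi (k * k + k))"
proof (rule decays_powi[where c = 1])
  fix j :: int
  have "0 \<le> (j + 1) * (j + 1)" by simp
  moreover have "0 \<le> j * j" by simp
  ultimately show "\<bar>j\<bar> - 1 \<le> j * j + j" by (cases "j \<ge> 0") (auto simp: algebra_simps)
qed

lemma decays_triang: "0 < norm q \<Longrightarrow> norm q < 1 \<Longrightarrow> decays (\<lambda>k. q powi triang k)"
  by (rule decays_powi[where c = 1]) (auto intro: triang_ge)

lemmas decays_alt_sign = decays_mult_bounded[where s = alt_sign and C = 1, simplified]

lemma power_int_add_eq:
  fixes q :: complex
  assumes "q \<noteq> 0" "a + b = c + d"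
  shows "q powi a * q powi b = q powi c * q powi d"
  using assms by (metis power_int_add)

text \<open>A quantitative dominated convergence: the whole majorant shrinks with
  \<open>c n\<close>. Theta and Lambert sums satisfy it because every exponent of q that matters is
  at least 1, see \<open>power_le_scaled\<close>.\<close>

lemma infsum_tendsto_zero_scaled:
  fixes f :: "nat \<Rightarrow> 'a \<Rightarrow> complex" and g :: "'a \<Rightarrow> complex"
  assumes g: "g summable_on K"
    and le: "\<And>n x. x \<in> K \<Longrightarrow> norm (f n x) \<le> c n * norm (g x)" and c: "c \<longlonglongrightarrow> 0"
  shows "f n summable_on K" and "(\<lambda>n. infsum (f n) K) \<longlonglongrightarrow> 0"
proof -
  define M where "M = (\<Sum>\<^sub>\<infinity>x\<in>K. norm (g x))"
  have sC: "(\<lambda>x. c n * norm (g x)) summable_on K" for n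
    using g unfolding summable_on_iff_abs_summable_on_complex by (rule summable_on_cmult_right)
  have sf: "(\<lambda>x. norm (f n x)) summable_on K" for n
    by (rule summable_on_comparison_test[OF sC]) (use le in auto)
  thus "f n summable_on K" by (rule abs_summable_summable)
  have *: "norm (infsum (f n) K) \<le> c n * M" for n
  proof -
    have "norm (infsum (f n) K) \<le> (\<Sum>\<^sub>\<infinity>x\<in>K. norm (f n x))"
      by (rule norm_infsum_bound[OF sf])
    also have "\<dots> \<le> (\<Sum>\<^sub>\<infinity>x\<in>K. c n * norm (g x))"
      by (rule infsum_mono[OF sf sC]) (use le in auto)
    also have "\<dots> = c n * M" unfolding M_def by (rule infsum_cmult_right')
    finally show ?thesis .
  qed
  have "(\<lambda>n. c n * M) \<longlonglongrightarrow> 0" using tendsto_mult_left_zero[OF c] .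
  thus "(\<lambda>n. infsum (f n) K) \<longlonglongrightarrow> 0"
  proof (rule tendsto_0_le[where K = 1], intro always_eventually allI)
    fix n
    show "norm (infsum (f n) K) \<le> norm (c n * M) * 1"
      using order.trans[OF *[of n] abs_ge_self] by (simp only: real_norm_def mult_1_right)
  qed
qed

lemma power_le_scaled:
  fixes q Q :: complex
  assumes "q \<noteq> 0" "norm Q \<le> norm q" "l \<ge> 1"
  shows "norm (Q ^ l) \<le> norm Q / norm q * norm (q ^ l)"
proof -
  obtain k where l: "l = Suc k" using assms(3) by (cases l) auto
  have "norm Q * norm Q ^ k \<le> norm Q * norm q ^ k"
    using assms by (intro mult_left_mono power_mono) auto
  also have "\<dots> = norm Q / norm q * norm q ^ Suc k" using assms by simp
  finally show ?thesis unfolding l by (simp add: norm_power norm_mult)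
qed

text \<open>Only the indices of exponent 0 survive at q = 0; elsewhere a factor norm (Q n) / norm q
  comes out of every term.\<close>

lemma tendsto_theta_sum:
  fixes q :: complex and e :: "int \<Rightarrow> int"
  assumes q: "0 < norm q"
    and s: "(\<lambda>j. c j * q powi e j) summable_on UNIV"
    and J: "finite J" "\<And>j. j \<in> J \<Longrightarrow> e j = 0" "\<And>j. j \<notin> J \<Longrightarrow> e j \<ge> 1"
    and Q: "\<And>n. norm (Q n) \<le> norm q" "Q \<longlonglongrightarrow> 0"
  shows "(\<lambda>n. \<Sum>\<^sub>\<infinity>j. c j * Q n powi e j) \<longlonglongrightarrow> sum c J"
proof -
  have le: "norm (c j * Q n powi e j) \<le> norm (Q n) / norm q * norm (c j * q powi e j)" if "j \<in> -J" for j n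
  proof -
    have "nat (e j) \<ge> 1" "e j = int (nat (e j))" using J(3)[of j] that by auto
    hence "norm (Q n powi e j) \<le> norm (Q n) / norm q * norm (q powi e j)"
      using power_le_scaled[of q "Q n" "nat (e j)"] q Q(1) by (metis power_int_of_nat zero_less_norm_iff)
    from mult_left_mono[OF this, of "norm (c j)"] show ?thesis by (simp add: norm_mult mult_ac)
  qed
  have c0: "(\<lambda>n. norm (Q n) / norm q) \<longlonglongrightarrow> 0"
    by (rule tendsto_divide_zero[OF tendsto_norm_zero[OF Q(2)]])
  have sJ: "(\<lambda>j. c j * q powi e j) summable_on -J"
    using s by (rule summable_on_subset_banach) auto
  note lim = infsum_tendsto_zero_scaled[where f = "\<lambda>n j. c j * Q n powi e j", OF sJ le c0]
  have "(\<Sum>\<^sub>\<infinity>j. c j * Q n powi e j) = sum c J + (\<Sum>\<^sub>\<infinity>j\<in>-J. c j * Q n powi e j)" for n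
  proof -
    have "(\<Sum>\<^sub>\<infinity>j\<in>J \<union> -J. c j * Q n powi e j) = (\<Sum>\<^sub>\<infinity>j\<in>J. c j * Q n powi e j) + (\<Sum>\<^sub>\<infinity>j\<in>-J. c j * Q n powi e j)"
      using lim(1) J(1) by (intro infsum_Un_disjoint) auto
    thus ?thesis using J by simp
  qed
  thus ?thesis using tendsto_add[OF tendsto_const lim(2), of "sum c J"] by simp
qed

section \<open>Theta series\<close>

lemma exp_sum_pairs_separate:
  fixes b w :: "int \<times> int \<Rightarrow> complex"
  assumes "moments b w"
    and "\<And>m r. b (m + 1 + r, m + 1 - r) = u0 m * v0 r"
    and "\<And>m r. w (m + 1 + r, m + 1 - r) = w0 m"
    and "\<And>m r. b (m + r + 1, m - r) = u1 m * v1 r"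
    and "\<And>m r. w (m + r + 1, m - r) = w1 m"
    and "moments u0 w0" "v0 summable_on UNIV" "moments u1 w1" "v1 summable_on UNIV"
  shows "exp_sum b w = exp_sum u0 w0 * fps_const (infsum v0 UNIV) + exp_sum u1 w1 * fps_const (infsum v1 UNIV)"
  using exp_sum_pairs_parity[OF assms(1)] exp_sum_separate[OF assms(6,7)] exp_sum_separate[OF assms(8,9)]
  by (simp only: assms(2-5))

lemma exp_sum_mult_separate:
  fixes b w :: "int \<Rightarrow> complex"
  assumes "moments b w" "moments c v"
    and "\<And>m r. b (m + 1 + r) * c (m + 1 - r) = u0 m * v0 r"
    and "\<And>m r. w (m + 1 + r) + v (m + 1 - r) = w0 m"
    and "\<And>m r. b (m + r + 1) * c (m - r) = u1 m * v1 r"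
    and "\<And>m r. w (m + r + 1) + v (m - r) = w1 m"
    and "moments u0 w0" "v0 summable_on UNIV" "moments u1 w1" "v1 summable_on UNIV"
  shows "exp_sum b w * exp_sum c v = exp_sum u0 w0 * fps_const (infsum v0 UNIV) + exp_sum u1 w1 * fps_const (infsum v1 UNIV)"
  unfolding exp_sum_mult[OF assms(1,2)]
  by (rule exp_sum_pairs_separate) (use assms moments_tensor[OF assms(1,2)] in auto)

text \<open>In $x = e^t$, these are $x^{-1/2} \sum_j (\mp 1)^j q^{j(j-1)/2} x^j$. The half-integral
  exponents make the first odd and the second even in $t$.\<close>

definition th_odd :: "complex \<Rightarrow> complex fps" where
  "th_odd q = exp_sum (\<lambda>j. alt_sign j * q powi triang j) (\<lambda>j. of_int j - 1/2)"

definition th_even :: "complex \<Rightarrow> complex fps" where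
  "th_even q = exp_sum (\<lambda>j. q powi triang j) (\<lambda>j. of_int j - 1/2)"

text \<open>With e^t = e^{iz}, the signs 1 and \<open>alt_sign\<close> give theta_3 and theta_4 at
  nome q. The companion \<open>th_pron\<close> with sign 1 is theta_2 without its factor q^(1/4),
  which keeps fractional powers of q out.\<close>

definition th_sq :: "(int \<Rightarrow> complex) \<Rightarrow> complex \<Rightarrow> complex fps" where
  "th_sq s q = exp_sum (\<lambda>k. s k * q powi (k * k)) (\<lambda>k. 2 * of_int k)"

definition th_pron :: "(int \<Rightarrow> complex) \<Rightarrow> complex \<Rightarrow> complex fps" where
  "th_pron s q = exp_sum (\<lambda>k. s k * q powi (k * k + k)) (\<lambda>k. 2 * of_int k + 1)"

definition sum_sq :: "(int \<Rightarrow> complex) \<Rightarrow> complex \<Rightarrow> complex" where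
  "sum_sq s q = (\<Sum>\<^sub>\<infinity>k. s k * q powi (k * k))"

definition sum_pron :: "(int \<Rightarrow> complex) \<Rightarrow> complex \<Rightarrow> complex" where
  "sum_pron s q = (\<Sum>\<^sub>\<infinity>k. s k * q powi (k * k + k))"

text \<open>Jacobi's theta_1'(0) at nome q, again without the factor q^(1/4). It arises as the
  constant in the Wronskian.\<close>

definition kappa :: "complex \<Rightarrow> complex" where
  "kappa q = (\<Sum>\<^sub>\<infinity>r. (alt_sign r * q powi (r * r + r)) * (2 * of_int r + 1))"

lemma infsum_int_reflect: "(\<Sum>\<^sub>\<infinity>k. f (c - k)) = infsum f (UNIV :: int set)"
  by (rule infsum_reindex_bij_betw[where g = "\<lambda>k. c - k"])
     (rule bij_betw_byWitness[where f' = "\<lambda>k. c - k"]; auto)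

lemma infsum_int_shift: "(\<Sum>\<^sub>\<infinity>k. f (k + c)) = infsum f (UNIV :: int set)"
  by (rule infsum_reindex_bij_betw[where g = "\<lambda>k. k + c"])
     (rule bij_betw_byWitness[where f' = "\<lambda>k. k - c"]; auto)

text \<open>Reflection turns the sum into its negative; for a divergent family the default value 0
  of \<open>infsum\<close> agrees.\<close>

lemma infsum_int_antisymmetric:
  fixes f :: "int \<Rightarrow> complex"
  assumes "\<And>k. f (c - k) = - f k"
  shows "infsum f UNIV = 0"
proof -
  have "infsum f UNIV = (\<Sum>\<^sub>\<infinity>k. f (c - k))" by (rule infsum_int_reflect[symmetric])
  also have "\<dots> = - infsum f UNIV" by (simp add: assms infsum_uminus)
  finally show ?thesis by simp
qed

lemma sum_pron_alt_sign [simp]: "sum_pron alt_sign q = 0"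
  unfolding sum_pron_def by (rule infsum_int_antisymmetric[where c = "-1"]) (auto simp: alt_sign_def algebra_simps)

lemma triang_reflect: "triang (1 - j) = triang j"
  by (simp add: triang_def algebra_simps)

lemma triang_add_even: "triang (m + 1 + r) + triang (m + 1 - r) = (m * m + m) + r * r"
  and triang_add_odd: "triang (m + r + 1) + triang (m - r) = m * m + (r * r + r)"
  using triang_double[of "m + 1 + r"] triang_double[of "m + 1 - r"] triang_double[of "m + r + 1"] triang_double[of "m - r"]
  by (simp_all add: algebra_simps)

context
  fixes q :: complex
  assumes q: "0 < norm q" "norm q < 1"
begin

lemma q_nonzero: "q \<noteq> 0" using q by auto

lemmas decays_q = decays_square[OF q] decays_pronic[OF q] decays_triang[OF q]
  decays_alt_sign[OF decays_square[OF q]] decays_alt_sign[OF decays_pronic[OF q]] decays_alt_sign[OF decays_triang[OF q]]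

lemma moments_half: "decays b \<Longrightarrow> moments b (\<lambda>j. of_int j - 1/2)"
  using decays_imp_moments[of b 1 "-1/2"] by simp

lemma moments_double: "decays b \<Longrightarrow> moments b (\<lambda>j. 2 * of_int j)"
  using decays_imp_moments[of b 2 0] by simp

lemma moments_double1: "decays b \<Longrightarrow> moments b (\<lambda>j. 2 * of_int j + 1)"
  using decays_imp_moments[of b 2 1] by simp

lemmas triang_powi = power_int_add_eq[OF q_nonzero triang_add_even] power_int_add_eq[OF q_nonzero triang_add_odd]

lemma th_even_square:
  "th_even q * th_even q = th_pron (\<lambda>_. 1) q * fps_const (sum_sq (\<lambda>_. 1) q)
     + th_sq (\<lambda>_. 1) q * fps_const (sum_pron (\<lambda>_. 1) q)"
  unfolding th_even_def th_pron_def th_sq_def sum_sq_def sum_pron_def mult_1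
  by (rule exp_sum_mult_separate)
     (auto simp: triang_powi intro!: moments_half moments_double moments_double1 decays_summable decays_q)

text \<open>The sign of the term (i, j) is (-1)^(i + j), hence constant on each parity class:
  compared with \<open>th_even_square\<close> only the odd class changes sign.\<close>

lemma th_odd_square:
  "th_odd q * th_odd q = th_pron (\<lambda>_. 1) q * fps_const (sum_sq (\<lambda>_. 1) q)
     - th_sq (\<lambda>_. 1) q * fps_const (sum_pron (\<lambda>_. 1) q)"
proof -
  have swap: "a * x * (b * y) = (a * b) * (x * y)" for a b x y :: complex
    by (simp only: mult_ac)
  have "th_odd q * th_odd q = exp_sum (\<lambda>m. q powi (m * m + m)) (\<lambda>m. 2 * of_int m + 1) * fps_const (\<Sum>\<^sub>\<infinity>r. q powi (r * r))
     + exp_sum (\<lambda>m. - (q powi (m * m))) (\<lambda>m. 2 * of_int m) * fps_const (\<Sum>\<^sub>\<infinity>r. q powi (r * r + r))"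
    unfolding th_odd_def
  proof (rule exp_sum_mult_separate, goal_cases)
    case (3 m r)
    have "alt_sign (m + 1 + r) * alt_sign (m + 1 - r) = 1" by (auto simp: alt_sign_def)
    thus ?case by (subst swap) (simp only: triang_powi mult_1_left)
  next
    case (5 m r)
    have "alt_sign (m + r + 1) * alt_sign (m - r) = - 1" by (auto simp: alt_sign_def)
    thus ?case by (subst swap) (simp only: triang_powi mult_minus1 mult_minus_left mult_1_left)
  qed (auto intro!: moments_half moments_double moments_double1 decays_summable decays_q decays_uminus)
  thus ?thesis unfolding exp_sum_uminus th_pron_def th_sq_def sum_sq_def sum_pron_def by simp
qed

text \<open>Differentiation puts the weight w i - w j on the pair (i, j). It depends on r alone, so
  the double sum still separates; the even class vanishes by oddness in r, and a single theta series
  remains.\<close>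

lemma th_wronskian:
  "fps_deriv (th_odd q) * th_even q - th_odd q * fps_deriv (th_even q) =
     - (fps_const (kappa q) * th_sq alt_sign q)"
proof -
  define w where "w = (\<lambda>j::int. complex_of_int j - 1/2)"
  have o: "moments (\<lambda>j. alt_sign j * q powi triang j) w" and e: "moments (\<lambda>j. q powi triang j) w"
    unfolding w_def by (auto intro!: moments_half decays_q)
  have aux: "s * x * a * y + s * x * - (y * b) = s * (x * y) * (a - b)" for s x y a b :: complex
    by (simp add: algebra_simps)
  have aux2: "- (a * b) * (x * y) * z = a * x * - (b * y * z)" for a b x y z :: complex
    by (simp add: algebra_simps)
  have sgs: "alt_sign (m + 1 + r) = - (alt_sign m * alt_sign r)" "alt_sign (m + r + 1) = - (alt_sign m * alt_sign r)" for m r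
    by (auto simp: alt_sign_def)
  \<comment> \<open>The combined coefficient carries w i - w j, which is 2 r on the even class and 2
    r + 1 on the odd class.\<close>
  define B where "B = (\<lambda>x. (case x of (i, j) \<Rightarrow> (alt_sign i * q powi triang i * w i) * q powi triang j) +
      (case x of (i, j) \<Rightarrow> (alt_sign i * q powi triang i) * (- (q powi triang j * w j))))"
  have "fps_deriv (th_odd q) * th_even q - th_odd q * fps_deriv (th_even q) =
    exp_sum (\<lambda>(i, j). (alt_sign i * q powi triang i * w i) * q powi triang j) (\<lambda>(i, j). w i + w j)
     + exp_sum (\<lambda>(i, j). (alt_sign i * q powi triang i) * (- (q powi triang j * w j))) (\<lambda>(i, j). w i + w j)"
    unfolding th_odd_def th_even_def fps_deriv_exp_sum w_def[symmetric]
      exp_sum_mult[OF moments_mult_weight[OF o] e, symmetric] exp_sum_mult[OF o moments_uminus[OF moments_mult_weight[OF e]], symmetric]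
      exp_sum_uminus by simp
  also have "\<dots> = exp_sum B (\<lambda>(i, j). w i + w j)"
    unfolding B_def
    by (rule exp_sum_add[symmetric]; rule moments_tensor; intro moments_mult_weight moments_uminus o e)
  \<comment> \<open>The summand \<open>+ 0\<close> keeps the shape required by
    \<open>decays_mult_linear\<close> in the summability goals.\<close>
  also have "\<dots> = exp_sum (\<lambda>m. alt_sign m * q powi (m * m + m)) (\<lambda>m. 2 * of_int m + 1)
        * fps_const (\<Sum>\<^sub>\<infinity>r. - (alt_sign r * q powi (r * r) * (2 * of_int r + 0)))
     + exp_sum (\<lambda>m. alt_sign m * q powi (m * m)) (\<lambda>m. 2 * of_int m)
        * fps_const (\<Sum>\<^sub>\<infinity>r. - ((alt_sign r * q powi (r * r + r)) * (2 * of_int r + 1)))"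
  proof (rule exp_sum_pairs_separate, goal_cases)
    case 1
    show ?case unfolding B_def
      by (rule moments_add; rule moments_tensor; intro moments_mult_weight moments_uminus o e)
  next
    case (2 m r)
    have wr: "w (m + 1 + r) - w (m + 1 - r) = 2 * of_int r" by (simp add: w_def)
    have "alt_sign (m + 1 + r) * (q powi triang (m + 1 + r) * q powi triang (m + 1 - r)) * (2 * of_int r)
        = alt_sign m * q powi (m * m + m) * - (alt_sign r * q powi (r * r) * (2 * of_int r + 0))"
      unfolding triang_powi sgs(1) aux2 add_0_right ..
    thus ?case unfolding B_def prod.case aux wr .
  next
    case (4 m r)
    have wr: "w (m + r + 1) - w (m - r) = 2 * of_int r + 1" by (simp add: w_def)
    have "alt_sign (m + r + 1) * (q powi triang (m + r + 1) * q powi triang (m - r)) * (2 * of_int r + 1)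
        = alt_sign m * q powi (m * m) * - ((alt_sign r * q powi (r * r + r)) * (2 * of_int r + 1))"
      unfolding triang_powi sgs(2) aux2 ..
    thus ?case unfolding B_def prod.case aux wr .
  next
    case 6 show ?case by (rule moments_double1, rule decays_q)
  next
    case 7 show ?case by (rule decays_summable, rule decays_uminus, rule decays_mult_linear, rule decays_q)
  next
    case 8 show ?case by (rule moments_double, rule decays_q)
  next
    case 9 show ?case by (rule decays_summable, rule decays_uminus, rule decays_mult_linear, rule decays_q)
  qed (simp_all add: w_def)
  also have "(\<Sum>\<^sub>\<infinity>r. - (alt_sign r * q powi (r * r) * (2 * of_int r + 0))) = 0"
    by (rule infsum_int_antisymmetric[where c = 0]) (auto simp: alt_sign_def)
  finally show ?thesis
    unfolding th_sq_def kappa_def infsum_uminus by (simp add: mult.commute flip: fps_const_neg)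
qed

end

text \<open>The same splitting with the even pairs centred at m instead of m + 1, which suits the
  exponents k^2 and k^2 + k.\<close>

lemma exp_sum_mult_separate':
  fixes b w :: "int \<Rightarrow> complex"
  assumes "moments b w" "moments c v"
    and "\<And>m r. b (m + r) * c (m - r) = u0 m * v0 r"
    and "\<And>m r. w (m + r) + v (m - r) = w0 m"
    and "\<And>m r. b (m + r + 1) * c (m - r) = u1 m * v1 r"
    and "\<And>m r. w (m + r + 1) + v (m - r) = w1 m"
    and "moments u0 w0" "v0 summable_on UNIV" "moments u1 w1" "v1 summable_on UNIV"
  shows "exp_sum b w * exp_sum c v = exp_sum u0 w0 * fps_const (infsum v0 UNIV) + exp_sum u1 w1 * fps_const (infsum v1 UNIV)"
proof -
  have bij: "bij (\<lambda>m::int. m + 1)"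
    by (rule bij_betw_byWitness[where f' = "\<lambda>m. m - 1"]) auto
  have "exp_sum b w * exp_sum c v = exp_sum (\<lambda>m. u0 (m + 1)) (\<lambda>m. w0 (m + 1)) * fps_const (infsum v0 UNIV)
      + exp_sum u1 w1 * fps_const (infsum v1 UNIV)"
    by (rule exp_sum_mult_separate) (use assms in \<open>auto simp: moments_reindex[OF bij]\<close>)
  thus ?thesis by (simp add: exp_sum_reindex[OF bij])
qed

section \<open>Theta constants, and duplication formulas between the nomes q and q^2\<close>

definition th_odd_slope :: "complex \<Rightarrow> complex" where
  "th_odd_slope q = (\<Sum>\<^sub>\<infinity>j. alt_sign j * q powi triang j * (of_int j - 1/2))"

definition th_even_value :: "complex \<Rightarrow> complex" where
  "th_even_value q = (\<Sum>\<^sub>\<infinity>j. q powi triang j)"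

lemma th_nth0 [simp]:
  "fps_nth (th_sq s q) 0 = sum_sq s q" "fps_nth (th_pron s q) 0 = sum_pron s q" "fps_nth (th_even q) 0 = th_even_value q" "fps_nth (th_odd q) (Suc 0) = th_odd_slope q"
  by (simp_all add: th_sq_def th_pron_def th_even_def th_odd_def exp_sum_def sum_sq_def sum_pron_def th_odd_slope_def th_even_value_def)

lemma th_odd_nth0 [simp]: "fps_nth (th_odd q) 0 = 0"
proof -
  have "(\<Sum>\<^sub>\<infinity>j. alt_sign j * q powi triang j) = 0"
    by (rule infsum_int_antisymmetric[where c = 1]) (auto simp: triang_reflect alt_sign_def)
  thus ?thesis by (simp add: th_odd_def exp_sum_def)
qed

text \<open>\<open>th_dbl_sq\<close> and \<open>th_dbl_pron\<close> are theta_3 and theta_2 at nome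
  q^2 and doubled argument, the latter without q^(1/2). The explicit factor q in the formulas for
  \<open>th_sq\<close> below restores two such square roots.\<close>

definition th_dbl_sq :: "complex \<Rightarrow> complex fps" where "th_dbl_sq q = exp_sum (\<lambda>m. q powi (2 * (m * m))) (\<lambda>m. 4 * of_int m)"
definition th_dbl_pron :: "complex \<Rightarrow> complex fps" where "th_dbl_pron q = exp_sum (\<lambda>m. q powi (2 * (m * m + m))) (\<lambda>m. 4 * of_int m + 2)"

lemma th_dbl_sq_nth0: "fps_nth (th_dbl_sq q) 0 = (\<Sum>\<^sub>\<infinity>m. q powi (2 * (m * m)))"
  and th_dbl_pron_nth0: "fps_nth (th_dbl_pron q) 0 = (\<Sum>\<^sub>\<infinity>m. q powi (2 * (m * m + m)))"
  by (simp_all add: th_dbl_sq_def th_dbl_pron_def exp_sum_def)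

lemma triang_zero_one [simp]: "triang 0 = 0" "triang 1 = 0"
  by (simp_all add: triang_def)

lemma powi_double: "(q\<^sup>2) powi k = (q :: complex) powi (2 * k)"
  by (simp add: power_int_mult)

lemma triang_Suc_double: "2 * triang (k + 1) = k * k + k"
  by (simp add: triang_double algebra_simps)

lemma sum_pron_one: "sum_pron (\<lambda>_. 1) q = th_even_value (q\<^sup>2)"
  unfolding th_even_value_def sum_pron_def powi_double
  by (subst infsum_int_shift[of _ 1, symmetric]) (simp add: triang_Suc_double)

lemma kappa_eq: "kappa q = - 2 * th_odd_slope (q\<^sup>2)"
proof -
  have "th_odd_slope (q\<^sup>2) = (\<Sum>\<^sub>\<infinity>r. alt_sign (r + 1) * q powi (r * r + r) * (of_int (r + 1) - 1/2))"
    unfolding th_odd_slope_def powi_double by (subst infsum_int_shift[of _ 1, symmetric]) (simp add: triang_Suc_double)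
  also have "\<dots> = (\<Sum>\<^sub>\<infinity>r. (-1/2) * ((alt_sign r * q powi (r * r + r)) * (2 * of_int r + 1)))"
    by (intro infsum_cong) (auto simp: alt_sign_def field_simps)
  also have "\<dots> = (-1/2) * kappa q" unfolding infsum_cmult_right' kappa_def ..
  finally show ?thesis by simp
qed

context
  fixes q :: complex
  assumes q: "0 < norm q" "norm q < 1"
begin

lemma norm_q2: "0 < norm (q\<^sup>2)" "norm (q\<^sup>2) < 1"
  using q by (auto simp: norm_power power_less_one_iff)

lemma decays_double:
  "decays (\<lambda>m. q powi (2 * (m * m)))" "decays (\<lambda>m. q powi (2 * (m * m + m)))"
  using decays_square[OF norm_q2] decays_pronic[OF norm_q2] by (simp_all add: powi_double)

lemma moments_quad: "decays b \<Longrightarrow> moments b (\<lambda>j. 4 * of_int j)" "decays b \<Longrightarrow> moments b (\<lambda>j. 4 * of_int j + 2)"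
  using decays_imp_moments[of b 4 0] decays_imp_moments[of b 4 2] by simp_all

lemma powi_pair_even: "q powi ((m + r) * (m + r)) * q powi ((m - r) * (m - r)) = q powi (2 * (m * m)) * q powi (2 * (r * r))"
  and powi_pair_odd: "q powi ((m + r + 1) * (m + r + 1)) * q powi ((m - r) * (m - r)) = q * q powi (2 * (m * m + m)) * q powi (2 * (r * r + r))"
  and powi_pron_even: "q powi ((m + r) * (m + r) + (m + r)) * q powi ((m - r) * (m - r) + (m - r)) = q powi (2 * (m * m + m)) * q powi (2 * (r * r))"
  and powi_pron_odd: "q powi ((m + r + 1) * (m + r + 1) + (m + r + 1)) * q powi ((m - r) * (m - r) + (m - r)) = q powi (2 * ((m + 1) * (m + 1))) * q powi (2 * (r * r + r))"
proof -
  have q0: "q \<noteq> 0" using q by auto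
  show "q powi ((m + r) * (m + r)) * q powi ((m - r) * (m - r)) = q powi (2 * (m * m)) * q powi (2 * (r * r))"
    by (rule power_int_add_eq[OF q0]) (simp add: algebra_simps)
  have "q powi ((m + r + 1) * (m + r + 1)) * q powi ((m - r) * (m - r)) = q powi (1 + 2 * (m * m + m)) * q powi (2 * (r * r + r))"
    by (rule power_int_add_eq[OF q0]) (simp add: algebra_simps)
  thus "q powi ((m + r + 1) * (m + r + 1)) * q powi ((m - r) * (m - r)) = q * q powi (2 * (m * m + m)) * q powi (2 * (r * r + r))"
    using q0 by (simp add: power_int_add)
  show "q powi ((m + r) * (m + r) + (m + r)) * q powi ((m - r) * (m - r) + (m - r)) = q powi (2 * (m * m + m)) * q powi (2 * (r * r))"
    by (rule power_int_add_eq[OF q0]) (simp add: algebra_simps)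
  show "q powi ((m + r + 1) * (m + r + 1) + (m + r + 1)) * q powi ((m - r) * (m - r) + (m - r)) = q powi (2 * ((m + 1) * (m + 1))) * q powi (2 * (r * r + r))"
    by (rule power_int_add_eq[OF q0]) (simp add: algebra_simps)
qed

lemmas moments_q = moments_double[OF q] moments_double1[OF q] moments_quad
lemmas decays_q' = decays_q[OF q] decays_double

lemma th_sq_one_square:
  "th_sq (\<lambda>_. 1) q * th_sq (\<lambda>_. 1) q = th_dbl_sq q * fps_const (fps_nth (th_dbl_sq q) 0) + fps_const q * (th_dbl_pron q * fps_const (fps_nth (th_dbl_pron q) 0))"
proof -
  have "th_sq (\<lambda>_. 1) q * th_sq (\<lambda>_. 1) q = exp_sum (\<lambda>m. q powi (2 * (m * m))) (\<lambda>m. 4 * of_int m) * fps_const (\<Sum>\<^sub>\<infinity>m. q powi (2 * (m * m)))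
    + exp_sum (\<lambda>m. q * q powi (2 * (m * m + m))) (\<lambda>m. 4 * of_int m + 2) * fps_const (\<Sum>\<^sub>\<infinity>m. q powi (2 * (m * m + m)))"
    unfolding th_sq_def mult_1
  proof (rule exp_sum_mult_separate', goal_cases)
    case 3 show ?case by (rule powi_pair_even)
  next
    case 5 show ?case by (rule powi_pair_odd)
  qed ((intro moments_q decays_summable decays_q' decays_cmult | simp)+)
  thus ?thesis unfolding th_dbl_sq_nth0 th_dbl_pron_nth0 exp_sum_cmult th_dbl_sq_def[symmetric] th_dbl_pron_def[symmetric] by (simp only: mult.assoc)
qed

lemma th_sq_alt_sign_square:
  "th_sq alt_sign q * th_sq alt_sign q = th_dbl_sq q * fps_const (fps_nth (th_dbl_sq q) 0) - fps_const q * (th_dbl_pron q * fps_const (fps_nth (th_dbl_pron q) 0))"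
proof -
  have "th_sq alt_sign q * th_sq alt_sign q = exp_sum (\<lambda>m. q powi (2 * (m * m))) (\<lambda>m. 4 * of_int m) * fps_const (\<Sum>\<^sub>\<infinity>m. q powi (2 * (m * m)))
    + exp_sum (\<lambda>m. (- q) * q powi (2 * (m * m + m))) (\<lambda>m. 4 * of_int m + 2) * fps_const (\<Sum>\<^sub>\<infinity>m. q powi (2 * (m * m + m)))"
    unfolding th_sq_def
  proof (rule exp_sum_mult_separate', goal_cases)
    case (3 m r)
    have "alt_sign (m + r) * q powi ((m + r) * (m + r)) * (alt_sign (m - r) * q powi ((m - r) * (m - r)))
      = (alt_sign (m + r) * alt_sign (m - r)) * (q powi ((m + r) * (m + r)) * q powi ((m - r) * (m - r)))" by simp
    also have "\<dots> = q powi (2 * (m * m)) * q powi (2 * (r * r))"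
      unfolding powi_pair_even by (auto simp: alt_sign_def)
    finally show ?case .
  next
    case (5 m r)
    have "alt_sign (m + r + 1) * q powi ((m + r + 1) * (m + r + 1)) * (alt_sign (m - r) * q powi ((m - r) * (m - r)))
      = (alt_sign (m + r + 1) * alt_sign (m - r)) * (q powi ((m + r + 1) * (m + r + 1)) * q powi ((m - r) * (m - r)))" by simp
    also have "\<dots> = (- q) * q powi (2 * (m * m + m)) * q powi (2 * (r * r + r))"
      unfolding powi_pair_odd by (auto simp: alt_sign_def)
    finally show ?case .
  qed ((intro moments_q decays_summable decays_q' decays_cmult | simp)+)
  thus ?thesis unfolding th_dbl_sq_nth0 th_dbl_pron_nth0 exp_sum_cmult th_dbl_sq_def[symmetric] th_dbl_pron_def[symmetric]
    by (simp add: mult.assoc flip: fps_const_neg)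
qed

lemma th_pron_one_square:
  "th_pron (\<lambda>_. 1) q * th_pron (\<lambda>_. 1) q = th_dbl_pron q * fps_const (fps_nth (th_dbl_sq q) 0) + th_dbl_sq q * fps_const (fps_nth (th_dbl_pron q) 0)"
proof -
  have bij: "bij (\<lambda>m::int. m + 1)"
    by (rule bij_betw_byWitness[where f' = "\<lambda>m. m - 1"]) auto
  have "th_pron (\<lambda>_. 1) q * th_pron (\<lambda>_. 1) q = exp_sum (\<lambda>m. q powi (2 * (m * m + m))) (\<lambda>m. 4 * of_int m + 2) * fps_const (\<Sum>\<^sub>\<infinity>m. q powi (2 * (m * m)))
    + exp_sum (\<lambda>m. q powi (2 * ((m + 1) * (m + 1)))) (\<lambda>m. 4 * of_int (m + 1)) * fps_const (\<Sum>\<^sub>\<infinity>m. q powi (2 * (m * m + m)))"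
    unfolding th_pron_def mult_1
  proof (rule exp_sum_mult_separate', goal_cases)
    case 3 show ?case by (rule powi_pron_even)
  next
    case 5 show ?case by (rule powi_pron_odd)
  next
    case 9
    show ?case
      by (subst moments_reindex[OF bij, of "\<lambda>m. q powi (2 * (m * m))" "\<lambda>m. 4 * of_int m"])
         (intro moments_q decays_q')
  qed ((intro moments_q decays_summable decays_q' decays_cmult | simp)+)
  also have "exp_sum (\<lambda>m. q powi (2 * ((m + 1) * (m + 1)))) (\<lambda>m. 4 * of_int (m + 1)) = th_dbl_sq q"
    unfolding th_dbl_sq_def by (rule exp_sum_reindex[OF bij])
  finally show ?thesis unfolding th_dbl_sq_nth0 th_dbl_pron_nth0 th_dbl_pron_def[symmetric] .
qed

text \<open>Jacobi's relation theta_4(0)^2 theta_4(z)^2 = theta_3(0)^2 theta_3(z)^2 - theta_2(0)^2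
  theta_2(z)^2. All six squares are combinations of the two series of nome q^2 and their values at
  0, after which it is a polynomial identity.\<close>

lemma th_sq_alt_sign_quadratic:
  "fps_const (sum_sq alt_sign q ^ 2) * th_sq alt_sign q ^ 2 =
     fps_const (sum_sq (\<lambda>_. 1) q ^ 2) * th_sq (\<lambda>_. 1) q ^ 2
     - fps_const (q * sum_pron (\<lambda>_. 1) q ^ 2) * th_pron (\<lambda>_. 1) q ^ 2"
proof -
  define a b where "a = fps_nth (th_dbl_sq q) 0" and "b = fps_nth (th_dbl_pron q) 0"
  have 1: "sum_sq alt_sign q ^ 2 = a * a - q * (b * b)"
    using arg_cong[OF th_sq_alt_sign_square, of "\<lambda>f. fps_nth (f) 0"] by (simp add: power2_eq_square a_def b_def)
  have 2: "sum_sq (\<lambda>_. 1) q ^ 2 = a * a + q * (b * b)"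
    using arg_cong[OF th_sq_one_square, of "\<lambda>f. fps_nth (f) 0"] by (simp add: power2_eq_square a_def b_def)
  have 3: "sum_pron (\<lambda>_. 1) q ^ 2 = b * a + a * b"
    using arg_cong[OF th_pron_one_square, of "\<lambda>f. fps_nth (f) 0"] by (simp add: power2_eq_square a_def b_def)
  show ?thesis
    unfolding 1 2 3
    unfolding power2_eq_square th_sq_alt_sign_square th_sq_one_square th_pron_one_square a_def[symmetric] b_def[symmetric]
    by (simp add: algebra_simps fps_numeral_fps_const flip: fps_const_mult fps_const_add fps_const_sub)
qed

text \<open>The Landen-type formula theta_3 theta_4 = theta_4(q^2)^2, read off at t = 0. The odd
  class drops out because its r-sum is antisymmetric under r -> -1 - r.\<close>

lemma sum_sq_one_mult_alt_sign: "sum_sq (\<lambda>_. 1) q * sum_sq alt_sign q = sum_sq alt_sign (q\<^sup>2) ^ 2"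
proof -
  have "th_sq (\<lambda>_. 1) q * th_sq alt_sign q = exp_sum (\<lambda>m. alt_sign m * q powi (2 * (m * m))) (\<lambda>m. 4 * of_int m) * fps_const (\<Sum>\<^sub>\<infinity>m. alt_sign m * q powi (2 * (m * m)))
    + exp_sum (\<lambda>m. q * (alt_sign m * q powi (2 * (m * m + m)))) (\<lambda>m. 4 * of_int m + 2) * fps_const (\<Sum>\<^sub>\<infinity>m. alt_sign m * q powi (2 * (m * m + m)))"
    unfolding th_sq_def mult_1
  proof (rule exp_sum_mult_separate', goal_cases)
    case (3 m r)
    have "q powi ((m + r) * (m + r)) * (alt_sign (m - r) * q powi ((m - r) * (m - r)))
      = alt_sign (m - r) * (q powi ((m + r) * (m + r)) * q powi ((m - r) * (m - r)))" by simp
    also have "\<dots> = alt_sign m * q powi (2 * (m * m)) * (alt_sign r * q powi (2 * (r * r)))"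
      unfolding powi_pair_even by (auto simp: alt_sign_def)
    finally show ?case .
  next
    case (5 m r)
    have "q powi ((m + r + 1) * (m + r + 1)) * (alt_sign (m - r) * q powi ((m - r) * (m - r)))
      = alt_sign (m - r) * (q powi ((m + r + 1) * (m + r + 1)) * q powi ((m - r) * (m - r)))" by simp
    also have "\<dots> = q * (alt_sign m * q powi (2 * (m * m + m))) * (alt_sign r * q powi (2 * (r * r + r)))"
      unfolding powi_pair_odd by (auto simp: alt_sign_def)
    finally show ?case .
  qed ((intro moments_q decays_summable decays_q' decays_cmult decays_alt_sign | simp)+)
  also have "(\<Sum>\<^sub>\<infinity>m. alt_sign m * q powi (2 * (m * m + m))) = 0"
    using sum_pron_alt_sign[of "q\<^sup>2"] unfolding sum_pron_def powi_double .
  finally have "fps_nth (th_sq (\<lambda>_. 1) q * th_sq alt_sign q) 0 = (\<Sum>\<^sub>\<infinity>m. alt_sign m * q powi (2 * (m * m))) ^ 2"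
    by (simp add: exp_sum_def power2_eq_square)
  thus ?thesis by (simp add: sum_sq_def powi_double)
qed

lemma th_even_value_square: "th_even_value q ^ 2 = 2 * sum_sq (\<lambda>_. 1) q * th_even_value (q\<^sup>2)"
  using arg_cong[OF th_even_square[OF q], of "\<lambda>f. fps_nth (f) 0"] by (simp add: power2_eq_square sum_pron_one)

text \<open>At t = 0 the Wronskian reduces to slope times value, and \<open>kappa\<close> is itself
  a slope at q^2. The result is a recursion along q -> q^2.\<close>

lemma th_odd_slope_mult_th_even_value: "th_odd_slope q * th_even_value q = 2 * th_odd_slope (q\<^sup>2) * sum_sq alt_sign q"
  using arg_cong[OF th_wronskian[OF q], of "\<lambda>f. fps_nth (f) 0"] by (simp add: kappa_eq)

end

section \<open>Iterating q -> q^2: nonvanishing theta constants and Jacobi's derivative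
  formula\<close>

lemma
  fixes q :: complex
  assumes q: "0 < norm q" "norm q < 1"
  shows iterated_squares_norm: "0 < norm (q ^ 2 ^ n)" "norm (q ^ 2 ^ n) < 1" "norm (q ^ 2 ^ n) \<le> norm q"
    and iterated_squares_tendsto: "(\<lambda>n. q ^ 2 ^ n) \<longlonglongrightarrow> 0"
proof -
  show "0 < norm (q ^ 2 ^ n)" using q by (simp add: norm_power)
  show "norm (q ^ 2 ^ n) < 1" using q by (simp add: norm_power power_less_one_iff)
  show "norm (q ^ 2 ^ n) \<le> norm q"
    using power_decreasing[of 1 "2 ^ n" "norm q"] q by (simp add: norm_power)
  have "strict_mono (\<lambda>n. 2 ^ n :: nat)" by (intro strict_monoI) simp
  hence "filterlim (\<lambda>n. 2 ^ n :: nat) sequentially sequentially" by (rule filterlim_subseq)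
  from filterlim_compose[OF LIMSEQ_power_zero[OF q(2)] this]
  show "(\<lambda>n. q ^ 2 ^ n) \<longlonglongrightarrow> 0" .
qed

text \<open>The exponent k^2 vanishes only at k = 0, while \<open>triang\<close> vanishes exactly at
  0 and 1. The limits are therefore 1, then 1 + 1, then -1/2 - 1/2.\<close>

lemma theta_iterated_squares_tendsto:
  fixes q :: complex
  assumes q: "0 < norm q" "norm q < 1"
  shows "(\<lambda>n. sum_sq alt_sign (q ^ 2 ^ n)) \<longlonglongrightarrow> 1"
    and "(\<lambda>n. th_even_value (q ^ 2 ^ n)) \<longlonglongrightarrow> 2"
    and "(\<lambda>n. th_odd_slope (q ^ 2 ^ n)) \<longlonglongrightarrow> - 1"
proof -
  note it = iterated_squares_norm(3)[OF q] iterated_squares_tendsto[OF q]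
  have "(\<lambda>n. \<Sum>\<^sub>\<infinity>k. alt_sign k * (q ^ 2 ^ n) powi (k * k)) \<longlonglongrightarrow> sum alt_sign {0}"
  proof (rule tendsto_theta_sum[OF q(1) _ _ _ _ it])
    fix j :: int assume "j \<notin> {0}"
    thus "1 \<le> j * j" using abs_le_square_int[of j] by auto
  qed (auto intro: decays_summable decays_q[OF q])
  thus "(\<lambda>n. sum_sq alt_sign (q ^ 2 ^ n)) \<longlonglongrightarrow> 1" by (simp add: sum_sq_def alt_sign_def)
  have tri1: "1 \<le> triang j" if "j \<notin> {0, 1}" for j
  proof (cases "\<bar>j\<bar> \<ge> 2")
    case True thus ?thesis using triang_ge[of j] by linarith
  next
    case False
    hence "j = -1" using that by auto
    thus ?thesis by (simp add: triang_def)
  qed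
  have "(\<lambda>n. \<Sum>\<^sub>\<infinity>k. 1 * (q ^ 2 ^ n) powi triang k) \<longlonglongrightarrow> sum (\<lambda>_. 1) {0, 1::int}"
    by (rule tendsto_theta_sum[OF q(1) _ _ _ tri1 it]) (auto intro: decays_summable decays_q[OF q])
  thus "(\<lambda>n. th_even_value (q ^ 2 ^ n)) \<longlonglongrightarrow> 2" by (simp add: th_even_value_def)
  have "decays (\<lambda>j. alt_sign j * q powi triang j * (1 * of_int j + (- 1/2)))"
    by (intro decays_mult_linear decays_q[OF q])
  hence "(\<lambda>j. alt_sign j * (of_int j - 1/2) * q powi triang j) summable_on UNIV"
    by (intro decays_summable) (simp add: mult_ac)
  hence "(\<lambda>n. \<Sum>\<^sub>\<infinity>k. alt_sign k * (of_int k - 1/2) * (q ^ 2 ^ n) powi triang k) \<longlonglongrightarrow> sum (\<lambda>k. alt_sign k * (of_int k - 1/2)) {0, 1}"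
    by (rule tendsto_theta_sum[OF q(1) _ _ _ tri1 it]) auto
  thus "(\<lambda>n. th_odd_slope (q ^ 2 ^ n)) \<longlonglongrightarrow> - 1" by (simp add: th_odd_slope_def alt_sign_def mult_ac)
qed

text \<open>By \<open>sum_sq_one_mult_alt_sign\<close> a zero at q forces one at q^2, hence at all
  iterated squares, against the limit 1.\<close>

lemma sum_sq_alt_sign_nonzero:
  fixes q :: complex
  assumes q: "0 < norm q" "norm q < 1"
  shows "sum_sq alt_sign q \<noteq> 0"
proof
  assume 0: "sum_sq alt_sign q = 0"
  have "sum_sq alt_sign (q ^ 2 ^ n) = 0" for n
  proof (induction n)
    case (Suc n)
    show ?case using sum_sq_one_mult_alt_sign[OF iterated_squares_norm(1,2)[OF q, of n]] Suc
      by (simp add: power_mult[symmetric] mult.commute)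
  qed (use 0 in simp)
  with theta_iterated_squares_tendsto(1)[OF q] show False by (simp add: LIMSEQ_const_iff)
qed

lemma sum_sq_one_nonzero:
  fixes q :: complex
  assumes q: "0 < norm q" "norm q < 1"
  shows "sum_sq (\<lambda>_. 1) q \<noteq> 0"
  using sum_sq_one_mult_alt_sign[OF q] sum_sq_alt_sign_nonzero[OF norm_q2[OF q]] by auto

lemma th_even_value_nonzero:
  fixes q :: complex
  assumes q: "0 < norm q" "norm q < 1"
  shows "th_even_value q \<noteq> 0"
proof
  assume 0: "th_even_value q = 0"
  have "th_even_value (q ^ 2 ^ n) = 0" for n
  proof (induction n)
    case (Suc n)
    show ?case using th_even_value_square[OF iterated_squares_norm(1,2)[OF q, of n]] Suc
        sum_sq_one_nonzero[OF iterated_squares_norm(1,2)[OF q, of n]]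
      by (simp add: power_mult[symmetric] mult.commute)
  qed (use 0 in simp)
  with theta_iterated_squares_tendsto(2)[OF q] show False by (simp add: LIMSEQ_const_iff)
qed

text \<open>The quotient of the two sides is invariant under $q \mapsto q^2$, hence equal to its limit
  at $q = 0$.\<close>

lemma th_odd_slope_eq:
  fixes q :: complex
  assumes q: "0 < norm q" "norm q < 1"
  shows "th_odd_slope q = - (1/2) * th_even_value q * sum_sq alt_sign q ^ 2"
proof -
  \<comment> \<open>Constancy of \<open>R\<close> is theta_1' = theta_2 theta_3 theta_4 at nome
    q^(1/2), with theta_3 theta_4 contracted to theta_4(q)^2.\<close>
  define R where "R = (\<lambda>q. th_odd_slope q / (th_even_value q * sum_sq alt_sign q ^ 2))"
  have step: "R q = R (q\<^sup>2)" if q: "0 < norm q" "norm q < 1" for q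
  proof -
    note nz = sum_sq_alt_sign_nonzero[OF q] sum_sq_one_nonzero[OF q] th_even_value_nonzero[OF q] th_even_value_nonzero[OF norm_q2[OF q]]
    have "R q = (th_odd_slope q * th_even_value q) / (th_even_value q ^ 2 * sum_sq alt_sign q ^ 2)"
      using nz by (simp add: R_def field_simps power2_eq_square)
    also have "\<dots> = th_odd_slope (q\<^sup>2) / (th_even_value (q\<^sup>2) * (sum_sq (\<lambda>_. 1) q * sum_sq alt_sign q))"
      unfolding th_odd_slope_mult_th_even_value[OF q] th_even_value_square[OF q] using nz by (simp add: field_simps power2_eq_square)
    also have "\<dots> = R (q\<^sup>2)" unfolding sum_sq_one_mult_alt_sign[OF q] by (simp add: R_def)
    finally show ?thesis .
  qed
  have "R (q ^ 2 ^ n) = R q" for n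
  proof (induction n)
    case (Suc n)
    show ?case using step[OF iterated_squares_norm(1,2)[OF q, of n]] Suc
      by (simp add: power_mult[symmetric] mult.commute)
  qed simp
  moreover have "(\<lambda>n. R (q ^ 2 ^ n)) \<longlonglongrightarrow> -1 / (2 * 1 ^ 2)"
    unfolding R_def by (intro tendsto_intros theta_iterated_squares_tendsto[OF q]) auto
  ultimately have "R q = - 1 / 2" by (simp add: LIMSEQ_const_iff)
  thus ?thesis using sum_sq_alt_sign_nonzero[OF q] th_even_value_nonzero[OF q] by (simp add: R_def field_simps)
qed

section \<open>The Lambert series as a quotient of theta series\<close>

lemma decays_finite_support:
  assumes "finite {j. b j \<noteq> 0}"
  shows "decays b"
proof -
  define K where "K = (\<Sum>j | b j \<noteq> 0. norm (b j) * 2 ^ nat \<bar>j\<bar>)"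
  have "norm (b j) \<le> K * (1/2) ^ nat \<bar>j\<bar>" for j
  proof (cases "b j = 0")
    case True
    have "K \<ge> 0" unfolding K_def by (intro sum_nonneg) auto
    thus ?thesis using True by simp
  next
    case False
    hence "norm (b j) * 2 ^ nat \<bar>j\<bar> \<le> K"
      unfolding K_def using assms by (intro member_le_sum[where f = "\<lambda>j. norm (b j) * 2 ^ nat \<bar>j\<bar>"]) auto
    thus ?thesis by (simp add: power_divide field_simps)
  qed
  thus ?thesis unfolding decays_def by (intro exI[of _ K] exI[of _ "1/2"]) auto
qed

lemma decays_reflect: "decays b \<Longrightarrow> decays (\<lambda>j. b (c - j))"
proof -
  assume "decays b"
  hence "decays (\<lambda>j. b (j + c))" by (rule decays_shift)
  then obtain K \<rho> where K: "0 < \<rho>" "\<rho> < 1" "\<And>j. norm (b (j + c)) \<le> K * \<rho> ^ nat \<bar>j\<bar>"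
    by (auto simp: decays_def)
  have "norm (b (c - j)) \<le> K * \<rho> ^ nat \<bar>j\<bar>" for j using K(3)[of "-j"] by simp
  thus ?thesis unfolding decays_def using K by blast
qed

lemma moments_int: "decays b \<Longrightarrow> moments b of_int"
  using decays_imp_moments[of b 1 0] by simp

lemma exp_sum_point:
  fixes w :: "int \<Rightarrow> complex"
  shows "exp_sum (\<lambda>j. if j = c then d else 0) w = fps_const d * fps_exp (w c)"
proof (rule fps_ext)
  fix k
  have "(\<Sum>\<^sub>\<infinity>j. (if j = c then d else 0) * w j ^ k) = (\<Sum>\<^sub>\<infinity>j\<in>{c}. d * w j ^ k)"
    by (rule infsum_cong_neutral) auto
  thus "fps_nth (exp_sum (\<lambda>j. if j = c then d else 0) w) k = fps_nth (fps_const d * fps_exp (w c)) k"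
    by (simp add: exp_sum_def)
qed

lemma exp_sum_int_shift: "exp_sum (\<lambda>j. b (j - 1)) of_int = exp_sum b (\<lambda>j. of_int j + 1)"
  using exp_sum_reindex[of "\<lambda>j::int. j - 1" b "\<lambda>j. of_int j + 1"]
  by (simp add: bij_betw_byWitness[where f' = "\<lambda>j. j + 1"])

lemma exp_sum_convolution:
  fixes a b :: "int \<Rightarrow> complex"
  assumes "moments a of_int" "moments b of_int"
  shows "exp_sum a of_int * exp_sum b of_int = exp_sum (\<lambda>N. \<Sum>\<^sub>\<infinity>n. a n * b (N - n)) of_int"
proof -
  define f where "f = (\<lambda>(N, n). (n, N - n) :: int \<times> int)"
  have bij: "bij f"
    unfolding f_def by (rule bij_betw_byWitness[where f' = "\<lambda>(i, j). (i + j, i)"]) auto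
  have ad: "moments (\<lambda>(N, n). a n * b (N - n)) (\<lambda>(N, n). of_int N)"
    using moments_tensor[OF assms] moments_reindex[OF bij, of "\<lambda>(i, j). a i * b j" "\<lambda>(i, j). of_int i + of_int j"]
    by (simp add: f_def case_prod_unfold)
  have "exp_sum a of_int * exp_sum b of_int = exp_sum (\<lambda>x. (\<lambda>(i, j). a i * b j) (f x)) (\<lambda>x. (\<lambda>(i, j). of_int i + of_int j) (f x))"
    unfolding exp_sum_reindex[OF bij] by (rule exp_sum_mult[OF assms])
  also have "\<dots> = exp_sum (\<lambda>(N, n). a n * b (N - n)) (\<lambda>(N, n). of_int N)"
    by (rule exp_sum_cong) (auto simp: f_def)
  also have "\<dots> = exp_sum (\<lambda>N. \<Sum>\<^sub>\<infinity>n. a n * b (N - n)) of_int"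
  proof (rule fps_ext)
    fix k
    have s: "(\<lambda>(N, n). a n * b (N - n) * of_int N ^ k) summable_on UNIV \<times> UNIV"
      using ad by (simp add: moments_def case_prod_unfold)
    have "(\<Sum>\<^sub>\<infinity>(N, n). a n * b (N - n) * of_int N ^ k) = (\<Sum>\<^sub>\<infinity>N. \<Sum>\<^sub>\<infinity>n. a n * b (N - n) * of_int N ^ k)"
      using infsum_Sigma'_banach[OF s] by simp
    also have "\<dots> = (\<Sum>\<^sub>\<infinity>N. (\<Sum>\<^sub>\<infinity>n. a n * b (N - n)) * of_int N ^ k)"
      by (simp add: infsum_cmult_left')
    finally show "fps_nth (exp_sum (\<lambda>(N, n). a n * b (N - n)) (\<lambda>(N, n). of_int N)) k =
        fps_nth (exp_sum (\<lambda>N. \<Sum>\<^sub>\<infinity>n. a n * b (N - n)) of_int) k"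
      by (simp add: exp_sum_def case_prod_unfold)
  qed
  finally show ?thesis .
qed

text \<open>The coefficients $(-1)^n / (1 + q^n)$ with the part that does not decay as
  $n \to \infty$ removed; that part sums to \<open>half_tanh\<close>, half of $(1 - x) / (1 + x)$.\<close>

definition lambert_coeff :: "complex \<Rightarrow> int \<Rightarrow> complex" where
  "lambert_coeff q n = alt_sign n * (if n > 0 then - (q powi n / (1 + q powi n))
     else if n < 0 then q powi (- n) / (1 + q powi (- n)) else 0)"

definition half_tanh :: "complex fps" where
  "half_tanh = fps_const (1/2) * (1 - fps_exp 1) * inverse (1 + fps_exp 1)"

definition lambert_fps :: "complex \<Rightarrow> complex fps" where
  "lambert_fps q = half_tanh + exp_sum (lambert_coeff q) of_int"

lemma half_tanh_mult: "(1 + fps_exp 1) * half_tanh = fps_const (1/2) - fps_const (1/2) * fps_exp 1"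
proof -
  have "(1 + fps_exp 1) * half_tanh = fps_const (1/2) * (1 - fps_exp 1) * (inverse (1 + fps_exp 1) * (1 + fps_exp 1))"
    by (simp add: half_tanh_def mult_ac)
  also have "inverse (1 + fps_exp 1) * (1 + fps_exp (1::complex)) = 1"
    by (rule inverse_mult_eq_1) simp
  finally show ?thesis by (simp add: algebra_simps)
qed

context
  fixes q :: complex
  assumes q: "0 < norm q" "norm q < 1"
begin

text \<open>Uniform in n: for n > 0 the modulus of q^n is at most |q|, and for n < 0 it is at least
  1/|q|, which is at least 2 - |q| because (1 - |q|)^2 is nonnegative.\<close>

lemma norm_one_plus_powi_ge: "norm (1 + q powi n) \<ge> 1 - norm q"
proof -
  have triang_ineq: "norm (1 + q powi n) \<ge> \<bar>1 - norm q powi n\<bar>"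
    using norm_triangle_ineq3[of 1 "- (q powi n)"] by (simp add: norm_power_int)
  consider "n = 0" | "n > 0" | "n < 0" by linarith
  thus ?thesis
  proof cases
    case 1 thus ?thesis using q norm_ge_zero[of q] by (simp del: norm_ge_zero)
  next
    case 2
    have "norm q powi n \<le> norm q powi 1" using q 2 by (intro power_int_decreasing) auto
    thus ?thesis using triang_ineq by simp
  next
    case 3
    have "norm q powi (-1) \<le> norm q powi n" using q 3 by (intro power_int_decreasing) auto
    moreover have "norm q powi (-1) \<ge> 2 - norm q"
    proof -
      have "(2 - norm q) * norm q \<le> 1" using zero_le_square[of "1 - norm q"] by (simp add: algebra_simps)
      thus ?thesis using q by (simp add: power_int_minus field_simps)
    qed
    ultimately show ?thesis using triang_ineq by simp
  qed
qed

lemma one_plus_powi_nonzero: "1 + q powi n \<noteq> 0"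
  using norm_one_plus_powi_ge[of n] q by auto

lemma decays_lambert_coeff: "decays (lambert_coeff q)"
proof -
  have "norm (lambert_coeff q n) \<le> inverse (1 - norm q) * norm q ^ nat \<bar>n\<bar>" for n
  proof -
    have *: "norm (q powi m / (1 + q powi m)) \<le> inverse (1 - norm q) * norm q ^ nat \<bar>m\<bar>" if "m > 0" for m
    proof -
      have "norm (q powi m) = norm q ^ nat \<bar>m\<bar>"
        using that by (simp add: norm_power power_int_def)
      moreover have "inverse (norm (1 + q powi m)) \<le> inverse (1 - norm q)"
        using norm_one_plus_powi_ge[of m] q by (intro le_imp_inverse_le) auto
      from mult_left_mono[OF this, of "norm q ^ nat \<bar>m\<bar>"]
      have "norm q ^ nat \<bar>m\<bar> * inverse (norm (1 + q powi m)) \<le> norm q ^ nat \<bar>m\<bar> * inverse (1 - norm q)"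
        by simp
      ultimately show ?thesis
        unfolding divide_inverse norm_mult norm_inverse by (simp only: mult.commute)
    qed
    show ?thesis
      using *[of n] *[of "-n"] q by (auto simp: lambert_coeff_def norm_mult)
  qed
  thus ?thesis unfolding decays_def using q by blast
qed

definition lambert_weight :: "int \<Rightarrow> complex" where "lambert_weight n = inverse (1 + q powi n)"

text \<open>The part removed by the regularisation is a step function with the midpoint value 1/2 at
  n = 0; with alternating signs it formally sums to 1/2 - x/(1 + x), which is
  \<open>half_tanh\<close>.\<close>

lemma alt_sign_lambert_weight: "alt_sign n * lambert_weight n = lambert_coeff q n + alt_sign n * (if n > 0 then 1 else if n = 0 then 1/2 else 0)"
proof -
  have q0: "q \<noteq> 0" using q by auto
  have pos: "lambert_weight n = 1 - q powi n / (1 + q powi n)"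
    using one_plus_powi_nonzero[of n] by (simp add: lambert_weight_def field_simps)
  have neg: "lambert_weight n = q powi (- n) / (1 + q powi (- n))"
    using one_plus_powi_nonzero[of n] one_plus_powi_nonzero[of "-n"] q0
    by (simp add: lambert_weight_def field_simps power_int_minus)
  consider "n = 0" | "n > 0" | "n < 0" by linarith
  thus ?thesis
  proof cases
    case 1 thus ?thesis by (simp add: lambert_coeff_def lambert_weight_def)
  next
    case 2 thus ?thesis unfolding pos by (simp add: lambert_coeff_def right_diff_distrib)
  next
    case 3 thus ?thesis unfolding neg by (simp add: lambert_coeff_def)
  qed
qed

text \<open>The coefficients of $(1 + x) F$; they decay in both directions.\<close>

definition lambert_jump :: "int \<Rightarrow> complex" where "lambert_jump n = alt_sign n * (lambert_weight n - lambert_weight (n - 1))"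

lemma alt_sign_pred: "alt_sign (n - 1) = - alt_sign n" by (auto simp: alt_sign_def)

text \<open>Multiplication by 1 + x reduces the alternating step function to the point masses 1/2 at
  n = 0 and -1/2 at n = 1, the coefficients of (1 - x)/2.\<close>

lemma lambert_jump_eq: "lambert_jump n = lambert_coeff q n + lambert_coeff q (n - 1) + ((if n = 0 then 1/2 else 0) + (if n = 1 then -1/2 else 0))"
proof -
  have "lambert_jump n = alt_sign n * lambert_weight n + alt_sign (n - 1) * lambert_weight (n - 1)"
    by (simp add: lambert_jump_def alt_sign_pred algebra_simps)
  also have "\<dots> = lambert_coeff q n + lambert_coeff q (n - 1) + ((if n = 0 then 1/2 else 0) + (if n = 1 then -1/2 else 0))"
    unfolding alt_sign_lambert_weight by (cases "n = 0"; cases "n = 1") (auto simp: alt_sign_pred alt_sign_def)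
  finally show ?thesis .
qed

lemma decays_lambert_coeff_pred: "decays (\<lambda>n. lambert_coeff q (n - 1))"
  using decays_shift[OF decays_lambert_coeff, of "-1"] by simp

lemma decays_points: "decays (\<lambda>n. (if n = 0 then a else 0))" "decays (\<lambda>n. (if n = 1 then a else 0))"
  by (rule decays_finite_support, rule finite_subset[of _ "{0, 1}"], auto)+

lemma decays_lambert_jump: "decays lambert_jump"
proof -
  have "decays (\<lambda>n. lambert_coeff q n + lambert_coeff q (n - 1) + ((if n = 0 then 1/2 else 0) + (if n = 1 then -1/2 else 0)))"
    by (intro decays_add decays_lambert_coeff decays_lambert_coeff_pred decays_points)
  thus ?thesis by (simp add: lambert_jump_eq[symmetric])
qed

lemma exp_sum_lambert_jump: "exp_sum lambert_jump of_int = (1 + fps_exp 1) * lambert_fps q"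
proof -
  have "exp_sum lambert_jump of_int = exp_sum (lambert_coeff q) of_int + exp_sum (\<lambda>n. lambert_coeff q (n - 1)) of_int
     + (exp_sum (\<lambda>n. if n = 0 then 1/2 else 0) of_int + exp_sum (\<lambda>n. if n = 1 then -1/2 else 0) of_int)"
    unfolding lambert_jump_eq[abs_def]
    by (subst exp_sum_add; (intro moments_int decays_add decays_lambert_coeff decays_lambert_coeff_pred decays_points)?)+ simp
  also have "\<dots> = (1 + fps_exp 1) * exp_sum (lambert_coeff q) of_int + (fps_const (1/2) - fps_const (1/2) * fps_exp 1)"
    unfolding exp_sum_int_shift exp_sum_shift[OF moments_int[OF decays_lambert_coeff]] exp_sum_point
    by (simp add: algebra_simps flip: fps_const_neg)
  also have "\<dots> = (1 + fps_exp 1) * lambert_fps q"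
    unfolding half_tanh_mult[symmetric] lambert_fps_def by (simp add: algebra_simps)
  finally show ?thesis .
qed

text \<open>The value of (1 + x) F at x = -1. The decaying part telescopes to 0 and the two point
  masses contribute 1/2 each.\<close>

lemma infsum_alt_sign_lambert_jump: "(\<Sum>\<^sub>\<infinity>n. alt_sign n * lambert_jump n) = 1"
proof -
  have g: "decays (\<lambda>n. alt_sign n * lambert_coeff q n)" "decays (\<lambda>n. alt_sign (n - 1) * lambert_coeff q (n - 1))"
    using decays_shift[OF decays_alt_sign[OF decays_lambert_coeff], of "-1"] by (simp_all add: decays_alt_sign decays_lambert_coeff)
  have "(\<Sum>\<^sub>\<infinity>n. alt_sign n * lambert_jump n) = (\<Sum>\<^sub>\<infinity>n. (alt_sign n * lambert_coeff q n + - (alt_sign (n - 1) * lambert_coeff q (n - 1)))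
      + ((if n = 0 then 1/2 else 0) + (if n = 1 then 1/2 else 0)))"
    by (intro infsum_cong) (auto simp: lambert_jump_eq alt_sign_pred algebra_simps, auto simp: alt_sign_def)
  also have "\<dots> = (\<Sum>\<^sub>\<infinity>n. alt_sign n * lambert_coeff q n) + - (\<Sum>\<^sub>\<infinity>n. alt_sign (n - 1) * lambert_coeff q (n - 1))
      + ((\<Sum>\<^sub>\<infinity>n::int. if n = 0 then 1/2 else 0) + (\<Sum>\<^sub>\<infinity>n::int. if n = 1 then 1/2 else 0))"
    unfolding infsum_uminus[symmetric]
    by (subst infsum_add; (intro decays_summable decays_add g decays_uminus decays_points)?)+ simp
  also have "(\<Sum>\<^sub>\<infinity>n. alt_sign (n - 1) * lambert_coeff q (n - 1)) = (\<Sum>\<^sub>\<infinity>n. alt_sign n * lambert_coeff q n)"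
    using infsum_int_shift[of "\<lambda>n. alt_sign n * lambert_coeff q n" "-1"] by simp
  also have "(\<Sum>\<^sub>\<infinity>n::int. if n = 0 then 1/2 else 0) = (\<Sum>\<^sub>\<infinity>n\<in>{0::int}. 1/2 :: complex)"
    by (rule infsum_cong_neutral) auto
  also have "(\<Sum>\<^sub>\<infinity>n::int. if n = 1 then 1/2 else 0) = (\<Sum>\<^sub>\<infinity>n\<in>{1::int}. 1/2 :: complex)"
    by (rule infsum_cong_neutral) auto
  finally show ?thesis by simp
qed

text \<open>Formally the coefficient of x^N in F times the integral-exponent theta series. The
  unregularised coefficients of F can be used here, since the quadratic exponent makes the sum
  converge.\<close>

definition theta_conv :: "int \<Rightarrow> complex" where
  "theta_conv N = (\<Sum>\<^sub>\<infinity>n. alt_sign n * lambert_weight n * q powi triang (N - n))"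

lemma theta_conv_summable: "(\<lambda>n. alt_sign n * lambert_weight n * q powi triang (N - n)) summable_on UNIV"
proof (rule decays_summable, rule decays_mult_bounded)
  show "decays (\<lambda>n. q powi triang (N - n))" by (rule decays_reflect[OF decays_triang[OF q]])
  show "norm (alt_sign n * lambert_weight n) \<le> inverse (1 - norm q)" for n
    using norm_one_plus_powi_ge[of n] q
    by (simp add: norm_mult lambert_weight_def norm_inverse le_imp_inverse_le)
qed

text \<open>From triang (N + 1 - n) + n = N + triang (N - n), adding q^N times the N-th sum to the
  next one produces the factor 1 + q^n, which cancels the denominator. What remains is a theta
  series at its zero.\<close>

lemma theta_conv_step: "theta_conv (N + 1) = - (q powi N * theta_conv N)"
proof -
  have q0: "q \<noteq> 0" using q by auto
  have summand: "q powi N * (alt_sign n * lambert_weight n * q powi triang (N - n)) + alt_sign n * lambert_weight n * q powi triang (N + 1 - n)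
       = alt_sign n * q powi triang (N + 1 - n)" for n
  proof -
    have "triang (N + 1 - n) = triang (N - n) + (N - n)"
      using triang_double[of "N + 1 - n"] triang_double[of "N - n"] by (simp add: algebra_simps)
    hence "q powi triang (N + 1 - n) * q powi n = q powi N * q powi triang (N - n)"
      using q0 by (simp add: add.commute flip: power_int_add)
    hence "q powi N * (alt_sign n * lambert_weight n * q powi triang (N - n)) + alt_sign n * lambert_weight n * q powi triang (N + 1 - n)
       = alt_sign n * q powi triang (N + 1 - n) * (lambert_weight n * (1 + q powi n))"
      by (simp add: algebra_simps)
    also have "lambert_weight n * (1 + q powi n) = 1" using one_plus_powi_nonzero[of n] by (simp add: lambert_weight_def)
    finally show ?thesis by simp
  qed
  have "q powi N * theta_conv N + theta_conv (N + 1) = (\<Sum>\<^sub>\<infinity>n. alt_sign n * q powi triang (N + 1 - n))"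
    unfolding theta_conv_def infsum_cmult_right'[symmetric] summand[symmetric]
    by (rule infsum_add[symmetric]) (intro theta_conv_summable summable_on_cmult_right)+
  also have "\<dots> = 0"
  proof (rule infsum_int_antisymmetric[where c = "2 * N + 1"])
    fix k
    have "N + 1 - (2 * N + 1 - k) = 1 - (N + 1 - k)" by simp
    thus "alt_sign (2 * N + 1 - k) * q powi triang (N + 1 - (2 * N + 1 - k)) = - (alt_sign k * q powi triang (N + 1 - k))"
      by (simp only: triang_reflect) (auto simp: alt_sign_def)
  qed
  finally show ?thesis by (simp add: add_eq_0_iff)
qed

lemma theta_conv_eq: "theta_conv N = theta_conv 0 * (alt_sign N * q powi triang N)"
proof -
  have q0: "q \<noteq> 0" using q by auto
  have t: "q powi triang (N + 1) = q powi N * q powi triang N" for N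
  proof -
    have "triang (N + 1) = N + triang N"
      using triang_double[of "N + 1"] triang_double[of N] by (simp add: algebra_simps)
    thus ?thesis using q0 by (simp add: power_int_add)
  qed
  have s: "alt_sign (N + 1) = - alt_sign N" for N by (auto simp: alt_sign_def)
  show ?thesis
  proof (induction N rule: int_induct[of _ 0])
    case base show ?case by (simp add: alt_sign_def)
  next
    case (step1 i)
    show ?case unfolding theta_conv_step t s step1(2) by simp
  next
    case (step2 i)
    have "- (q powi (i - 1) * theta_conv (i - 1)) = theta_conv 0 * (alt_sign i * q powi triang i)"
      using theta_conv_step[of "i - 1"] step2(2) by simp
    also have "\<dots> = - (q powi (i - 1) * (theta_conv 0 * (alt_sign (i - 1) * q powi triang (i - 1))))"
      using t[of "i - 1"] s[of "i - 1"] by simp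
    finally show ?case using q0 by simp
  qed
qed

text \<open>The jumps are differences of unregularised weights, so the sum is
  \<open>theta_conv N + theta_conv (N - 1)\<close>.\<close>

lemma lambert_jump_convolution:
  "(\<Sum>\<^sub>\<infinity>n. lambert_jump n * q powi triang (N - n)) =
     theta_conv 0 * (alt_sign N * q powi triang N + alt_sign (N - 1) * q powi triang (N - 1))"
proof -
  have "(\<Sum>\<^sub>\<infinity>n. lambert_jump n * q powi triang (N - n)) = (\<Sum>\<^sub>\<infinity>n. alt_sign n * lambert_weight n * q powi triang (N - n)
     + alt_sign (n + - 1) * lambert_weight (n + - 1) * q powi triang (N - 1 - (n + - 1)))"
    by (intro infsum_cong) (auto simp: lambert_jump_def alt_sign_pred algebra_simps)
  also have "\<dots> = theta_conv N + (\<Sum>\<^sub>\<infinity>n. alt_sign (n + - 1) * lambert_weight (n + - 1) * q powi triang (N - 1 - (n + - 1)))"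
    unfolding theta_conv_def
  proof (rule infsum_add)
    have "bij_betw (\<lambda>n::int. n + - 1) UNIV UNIV"
      by (rule bij_betw_byWitness[where f' = "\<lambda>j. j + 1"]) auto
    from summable_on_reindex_bij_betw[OF this, of "\<lambda>n. alt_sign n * lambert_weight n * q powi triang (N - 1 - n)"]
    show "(\<lambda>n. alt_sign (n + - 1) * lambert_weight (n + - 1) * q powi triang (N - 1 - (n + - 1))) summable_on UNIV"
      using theta_conv_summable by simp
  qed (rule theta_conv_summable)
  also have "(\<Sum>\<^sub>\<infinity>n. alt_sign (n + - 1) * lambert_weight (n + - 1) * q powi triang (N - 1 - (n + - 1))) = theta_conv (N - 1)"
    unfolding theta_conv_def by (rule infsum_int_shift)
  finally show ?thesis unfolding theta_conv_eq[of N] theta_conv_eq[of "N - 1"] by (simp add: algebra_simps)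
qed

lemma th_odd_int: "th_odd q = fps_exp (-1/2) * exp_sum (\<lambda>j. alt_sign j * q powi triang j) of_int"
  and th_even_int: "th_even q = fps_exp (-1/2) * exp_sum (\<lambda>j. q powi triang j) of_int"
  using exp_sum_shift[OF moments_int, of "\<lambda>j. alt_sign j * q powi triang j" "-1/2"] exp_sum_shift[OF moments_int, of "\<lambda>j. q powi triang j" "-1/2"]
  by (simp_all add: th_odd_def th_even_def decays_q[OF q])

text \<open>The identity is proved after multiplication by 1 + e^t, where all coefficients decay and
  convolution is legitimate; that factor has constant term 2 and cancels. The prefactor e^(-t/2) is
  common to both theta series.\<close>

lemma lambert_fps_th: "lambert_fps q * th_even q = fps_const (theta_conv 0) * th_odd q"
proof -
  define P where "P = exp_sum (\<lambda>j. alt_sign j * q powi triang j) of_int"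
  define T where "T = exp_sum (\<lambda>j. q powi triang j) of_int"
  note g = decays_q[OF q]
  have gp: "decays (\<lambda>j. alt_sign (j - 1) * q powi triang (j - 1))"
    using decays_shift[OF g(6), of "-1"] by simp
  have "exp_sum lambert_jump of_int * T = exp_sum (\<lambda>N. theta_conv 0 * (alt_sign N * q powi triang N + alt_sign (N - 1) * q powi triang (N - 1))) of_int"
    unfolding T_def by (simp add: exp_sum_convolution moments_int decays_lambert_jump g lambert_jump_convolution)
  also have "\<dots> = fps_const (theta_conv 0) * (P + fps_exp 1 * P)"
    unfolding exp_sum_cmult P_def
    by (simp add: exp_sum_add moments_int g gp exp_sum_int_shift[of "\<lambda>j. alt_sign j * q powi triang j"] exp_sum_shift)
  finally have "(1 + fps_exp 1) * (lambert_fps q * T) = (1 + fps_exp 1) * (fps_const (theta_conv 0) * P)"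
    unfolding exp_sum_lambert_jump by (simp add: algebra_simps)
  moreover have "fps_nth (1 + fps_exp (1::complex)) 0 \<noteq> fps_nth 0 0" by simp
  hence "1 + fps_exp (1::complex) \<noteq> 0" by metis
  ultimately have "lambert_fps q * T = fps_const (theta_conv 0) * P" by simp
  thus ?thesis unfolding th_odd_int th_even_int P_def[symmetric] T_def[symmetric]
    by (metis mult.left_commute)
qed

text \<open>Compare first order terms at $x = -1$, where $(1 + x) F$ equals $1$.\<close>

lemma theta_conv_0_eq: "theta_conv 0 = - th_odd_slope q / th_even_value q"
proof -
  define P where "P = exp_sum (\<lambda>j. alt_sign j * q powi triang j) of_int"
  define T where "T = exp_sum (\<lambda>j. q powi triang j) of_int"
  \<comment> \<open>The signs substitute -x for x, so that t = 0 now stands for x = -1; at the same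
    time they exchange the two theta series.\<close>
  define A where "A = exp_sum (\<lambda>n. alt_sign n * lambert_jump n) of_int"
  note g = decays_q[OF q]
  have gp: "decays (\<lambda>j. q powi triang (j - 1))"
    using decays_shift[OF g(3), of "-1"] by simp
  have conv: "(\<Sum>\<^sub>\<infinity>n. (alt_sign n * lambert_jump n) * (alt_sign (N - n) * q powi triang (N - n))) = theta_conv 0 * (q powi triang N + - (q powi triang (N - 1)))" for N
  proof -
    have "(\<Sum>\<^sub>\<infinity>n. (alt_sign n * lambert_jump n) * (alt_sign (N - n) * q powi triang (N - n))) = (\<Sum>\<^sub>\<infinity>n. alt_sign N * (lambert_jump n * q powi triang (N - n)))"
      by (intro infsum_cong) (auto simp: alt_sign_def)
    thus ?thesis unfolding infsum_cmult_right' lambert_jump_convolution by (simp add: alt_sign_pred algebra_simps)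
  qed
  have "A * P = exp_sum (\<lambda>N. theta_conv 0 * (q powi triang N + - (q powi triang (N - 1)))) of_int"
    unfolding A_def P_def by (simp add: exp_sum_convolution moments_int decays_alt_sign decays_lambert_jump g conv del: alt_sign_squared)
  also have "\<dots> = fps_const (theta_conv 0) * (T - fps_exp 1 * T)"
    unfolding exp_sum_cmult T_def
    by (subst exp_sum_add) (simp_all add: exp_sum_uminus moments_uminus moments_int g gp exp_sum_int_shift[of "\<lambda>j. q powi triang j"] exp_sum_shift)
  finally have "A * th_odd q = fps_const (theta_conv 0) * ((1 - fps_exp 1) * th_even q)"
    unfolding th_odd_int th_even_int P_def[symmetric] T_def[symmetric]
    by (simp only: mult.left_commute[of A] mult.left_commute[of _ "fps_exp (-1/2)"] left_diff_distrib right_diff_distrib mult_1_left)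
  \<comment> \<open>Both \<open>th_odd q\<close> and 1 - e^t vanish at t = 0, so the first order
    terms are A(0) times the slope, and minus the value of \<open>th_even q\<close>.\<close>
  from arg_cong[OF this, of "\<lambda>f. fps_nth f 1"]
  have "fps_nth A 0 * th_odd_slope q = - (theta_conv 0 * th_even_value q)"
    by (simp add: fps_mult_nth)
  moreover have "fps_nth A 0 = 1" by (simp add: A_def exp_sum_def infsum_alt_sign_lambert_jump)
  ultimately show ?thesis using th_even_value_nonzero[OF q] by (simp add: field_simps)
qed

lemma theta_conv_0: "theta_conv 0 = sum_sq alt_sign q ^ 2 / 2"
  unfolding theta_conv_0_eq th_odd_slope_eq[OF q] using th_even_value_nonzero[OF q] by simp

section \<open>Initial values and the differential equation of F\<close>

lemma lambert_fps_nth0: "fps_nth (lambert_fps q) 0 = 0"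
  using arg_cong[OF lambert_fps_th, of "\<lambda>f. fps_nth f 0"] th_even_value_nonzero[OF q] by simp

lemma lambert_fps_nth1: "fps_nth (lambert_fps q) 1 = - (sum_sq alt_sign q ^ 4 / 4)"
proof -
  have "fps_nth (lambert_fps q) 1 * th_even_value q = sum_sq alt_sign q ^ 2 / 2 * th_odd_slope q"
    using arg_cong[OF lambert_fps_th, of "\<lambda>f. fps_nth f 1"] lambert_fps_nth0
    by (simp add: fps_mult_nth theta_conv_0)
  also have "\<dots> = - (sum_sq alt_sign q ^ 4 / 4) * th_even_value q"
    unfolding th_odd_slope_eq[OF q] by (simp add: power4_eq_xxxx power2_eq_square)
  finally show ?thesis by (simp only: mult_right_cancel[OF th_even_value_nonzero[OF q]])
qed

text \<open>With p = P^2/T^2, the duplication formulas make X and Y multiples of T^2 (1 + p) and T^2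
  (1 - p), and the Wronskian makes F' T^2 a multiple of Z. Jacobi's quadratic relation between X, Y,
  Z then turns (F')^2 into a quadratic polynomial in p = F^2/C^2.\<close>

lemma lambert_fps_ode:
  "\<exists>\<delta> \<alpha>. fps_deriv (lambert_fps q) ^ 2 = fps_const \<delta> + fps_const \<alpha> * lambert_fps q ^ 2 + lambert_fps q ^ 4"
proof -
  define F where "F = lambert_fps q"
  define C where "C = theta_conv 0"
  define S where "S = sum_sq (\<lambda>_. 1) q"
  define Pi where "Pi = sum_pron (\<lambda>_. 1) q"
  define ph where "ph = sum_sq alt_sign q"
  define T where "T = th_even q"
  define P where "P = th_odd q"
  define X where "X = th_pron (\<lambda>_. 1) q"
  define Y where "Y = th_sq (\<lambda>_. 1) q"
  define Z where "Z = th_sq alt_sign q"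
  have nz: "ph \<noteq> 0" "S \<noteq> 0" "Pi \<noteq> 0" "C \<noteq> 0"
    unfolding ph_def S_def Pi_def C_def theta_conv_0 sum_pron_one
    using sum_sq_alt_sign_nonzero[OF q] sum_sq_one_nonzero[OF q] th_even_value_nonzero[OF norm_q2[OF q]] by auto
  have Tnz: "T \<noteq> 0"
    using th_even_value_nonzero[OF q] th_nth0(3)[of q] unfolding T_def by (metis fps_zero_nth)
  have FT: "F * T = fps_const C * P" unfolding F_def T_def C_def P_def by (rule lambert_fps_th)
  have TT: "T * T = X * fps_const S + Y * fps_const Pi"
    unfolding T_def X_def Y_def S_def Pi_def by (rule th_even_square[OF q])
  have PP: "P * P = X * fps_const S - Y * fps_const Pi"
    unfolding P_def X_def Y_def S_def Pi_def by (rule th_odd_square[OF q])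
  define p where "p = fps_const (1 / C ^ 2) * F ^ 2"
  have cc: "fps_const (1 / C ^ 2) * fps_const C ^ 2 = 1"
    using nz by (simp add: fps_const_power)
  have pT: "p * (T * T) = P * P"
  proof -
    have "p * (T * T) = fps_const (1 / C ^ 2) * (F * T) ^ 2" by (simp add: p_def power2_eq_square mult_ac)
    also have "\<dots> = (fps_const (1 / C ^ 2) * fps_const C ^ 2) * (P * P)"
      unfolding FT by (simp add: power2_eq_square mult_ac)
    finally show ?thesis by (simp only: cc mult_1_left)
  qed
  have eX: "2 * (X * fps_const S) = T * T * (1 + p)" and eY: "2 * (Y * fps_const Pi) = T * T * (1 - p)"
    using pT TT PP by (simp_all add: algebra_simps)
  have W: "fps_deriv F * (T * T) = - (fps_const (C * kappa q) * Z)"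
  proof -
    have "fps_deriv (F * T) = fps_deriv (fps_const C * P)" using FT by simp
    hence "fps_deriv F * T + F * fps_deriv T = fps_const C * fps_deriv P" by (simp add: algebra_simps)
    hence "(fps_deriv F * T + F * fps_deriv T) * T = fps_const C * fps_deriv P * T" by simp
    hence "fps_deriv F * (T * T) = fps_const C * fps_deriv P * T - (F * T) * fps_deriv T"
      by (simp add: algebra_simps)
    also have "\<dots> = fps_const C * (fps_deriv P * T - P * fps_deriv T)"
      unfolding FT by (simp add: algebra_simps)
    also have "fps_deriv P * T - P * fps_deriv T = - (fps_const (kappa q) * Z)"
      unfolding P_def T_def Z_def by (rule th_wronskian[OF q])
    finally show ?thesis by (simp add: mult.assoc flip: fps_const_mult)
  qed
  have Q: "fps_const (ph ^ 2) * Z ^ 2 = fps_const (S ^ 2) * Y ^ 2 - fps_const (q * Pi ^ 2) * X ^ 2"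
    unfolding ph_def Z_def S_def Y_def Pi_def X_def by (rule th_sq_alt_sign_quadratic[OF q])
  define k where "k = 4 * S ^ 2 * Pi ^ 2 * ph ^ 2"
  define l where "l = C ^ 2 * kappa q ^ 2"
  define cS where "cS = fps_const S"
  define cP where "cP = fps_const Pi"
  define cp where "cp = fps_const ph"
  define cq where "cq = fps_const q"
  define cl where "cl = fps_const (C * kappa q)"
  have k: "fps_const k = 4 * cS ^ 2 * cP ^ 2 * cp ^ 2" and l: "fps_const l = cl ^ 2"
    by (simp_all add: k_def l_def cS_def cP_def cp_def cl_def power_mult_distrib fps_numeral_fps_const flip: fps_const_power fps_const_mult)
  have Q': "cp ^ 2 * Z ^ 2 = cS ^ 2 * Y ^ 2 - cq * cP ^ 2 * X ^ 2"
    using Q by (simp add: cS_def cP_def cp_def cq_def fps_const_power flip: fps_const_mult)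
  have "(T * T) ^ 2 * (fps_const k * fps_deriv F ^ 2) = 4 * cS ^ 2 * cP ^ 2 * cp ^ 2 * (fps_deriv F * (T * T)) ^ 2"
    unfolding k by (simp add: power_mult_distrib mult_ac)
  also have "\<dots> = 4 * cS ^ 2 * cP ^ 2 * cl ^ 2 * (cp ^ 2 * Z ^ 2)"
    unfolding W cl_def[symmetric] by (simp add: power_mult_distrib mult_ac)
  also have "\<dots> = cl ^ 2 * (cS ^ 4 * (2 * (Y * cP)) ^ 2 - cq * cP ^ 4 * (2 * (X * cS)) ^ 2)"
    unfolding Q' by (simp add: power_mult_distrib algebra_simps power4_eq_xxxx power2_eq_square)
  also have "\<dots> = (T * T) ^ 2 * (cl ^ 2 * (cS ^ 4 * (1 - p) ^ 2 - cq * cP ^ 4 * (1 + p) ^ 2))"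
    unfolding eX[folded cS_def] eY[folded cP_def] power_mult_distrib by (simp add: algebra_simps)
  finally have main: "fps_const k * fps_deriv F ^ 2 = fps_const l * (cS ^ 4 * (1 - p) ^ 2 - cq * cP ^ 4 * (1 + p) ^ 2)"
    using Tnz unfolding l by simp
  \<comment> \<open>The powers 1 and p^2 carry the same coefficient \<open>d\<close>, because X and
    Y enter through (1 + p)^2 and (1 - p)^2.\<close>
  define d where "d = l / k * (S ^ 4 - q * Pi ^ 4)"
  define e where "e = - 2 * l / k * (S ^ 4 + q * Pi ^ 4)"
  have knz: "k \<noteq> 0" using nz by (simp add: k_def)
  have "fps_deriv F ^ 2 = fps_const (1 / k) * (fps_const k * fps_deriv F ^ 2)"
    using knz by (simp add: mult.assoc[symmetric] fps_const_mult)
  also have "\<dots> = fps_const (l / k) * (cS ^ 4 * (1 - p) ^ 2 - cq * cP ^ 4 * (1 + p) ^ 2)"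
    unfolding main by (simp add: mult.assoc[symmetric])
  also have "cS ^ 4 * (1 - p) ^ 2 - cq * cP ^ 4 * (1 + p) ^ 2 =
      (cS ^ 4 - cq * cP ^ 4) * (1 + p ^ 2) - 2 * (cS ^ 4 + cq * cP ^ 4) * p"
    by (simp add: power2_eq_square algebra_simps)
  finally have DF: "fps_deriv F ^ 2 = fps_const (l / k) * ((cS ^ 4 - cq * cP ^ 4) * (1 + p ^ 2) - 2 * (cS ^ 4 + cq * cP ^ 4) * p)" .
  have dc: "fps_const d = fps_const (l / k) * (cS ^ 4 - cq * cP ^ 4)"
    by (simp add: d_def cS_def cq_def cP_def fps_const_power)
  have ec: "fps_const e = fps_const (l / k) * (- 2 * (cS ^ 4 + cq * cP ^ 4))"
    by (simp add: e_def cS_def cq_def cP_def fps_const_power fps_numeral_fps_const algebra_simps)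
  have ode: "fps_deriv F ^ 2 = fps_const d * (1 + p ^ 2) + fps_const e * p"
    unfolding DF dc ec by (simp add: algebra_simps)
  have F0: "fps_nth F 0 = 0" unfolding F_def by (rule lambert_fps_nth0)
  \<comment> \<open>Since p vanishes at t = 0, \<open>d\<close> is F'(0)^2 = C^4; this makes the
    coefficient of F^4, which is d/C^4, equal to 1.\<close>
  have "fps_nth (fps_deriv F ^ 2) 0 = d"
    unfolding ode by (simp add: p_def F0 power2_eq_square)
  moreover have "fps_nth F 1 = - (C ^ 2)"
    using lambert_fps_nth1 unfolding F_def C_def theta_conv_0 by (simp add: power_divide)
  ultimately have d: "d = C ^ 4" by (simp add: power2_eq_square power4_eq_xxxx mult.assoc)
  have dp: "fps_const d * p ^ 2 = F ^ 4"
    using nz by (simp add: p_def d power_mult_distrib fps_const_power power_divide mult.assoc[symmetric]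
        flip: power_mult)
  have ep: "fps_const e * p = fps_const (e / C ^ 2) * F ^ 2"
    by (simp add: p_def mult.assoc[symmetric])
  have "fps_deriv F ^ 2 = fps_const d + fps_const (e / C ^ 2) * F ^ 2 + F ^ 4"
    unfolding ode distrib_left dp ep by simp
  thus ?thesis unfolding F_def C_def by blast
qed

end

section \<open>Hankel determinants from a quartic differential equation\<close>

lemma fact_mult_fps_deriv_funpow_nth:
  fixes F :: "'a :: field_char_0 fps"
  shows "fact k * fps_nth ((fps_deriv ^^ n) F) k = fact (k + n) * fps_nth F (k + n)"
proof (induction n arbitrary: k)
  case (Suc n)
  have "fact k * fps_nth ((fps_deriv ^^ Suc n) F) k = fact (Suc k) * fps_nth ((fps_deriv ^^ n) F) (Suc k)"
    by (simp add: mult_ac del: of_nat_Suc)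
  also have "\<dots> = fact (k + Suc n) * fps_nth F (k + Suc n)"
    unfolding Suc by simp
  finally show ?case .
qed simp

lemma fps_deriv_power_Suc:
  "fps_deriv (F ^ Suc k) = fps_const (of_nat (Suc k)) * (F ^ k * fps_deriv (F :: 'a :: comm_ring_1 fps))"
  unfolding fps_deriv_power by (simp only: diff_Suc_1 mult_ac)

lemma fps_deriv2_power_Suc_Suc:
  fixes F :: "'a :: comm_ring_1 fps"
  shows "fps_deriv (fps_deriv (F ^ Suc (Suc k))) = fps_const (of_nat (Suc (Suc k))) *
     (F ^ Suc k * fps_deriv (fps_deriv F) + fps_const (of_nat (Suc k)) * (F ^ k * fps_deriv F ^ 2))"
proof -
  have "fps_deriv (fps_deriv (F ^ Suc (Suc k))) = fps_const (of_nat (Suc (Suc k))) *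
     (F ^ Suc k * fps_deriv (fps_deriv F) + fps_deriv (F ^ Suc k) * fps_deriv F)"
    unfolding fps_deriv_power_Suc[of F "Suc k"] fps_deriv_mult fps_deriv_const by simp
  thus ?thesis unfolding fps_deriv_power_Suc by (simp only: power2_eq_square mult_ac)
qed

text \<open>Here \<open>j\<close> is only a degree bound: \<open>c\<close> is the coefficient of
  F^(2j+1) and may be 0, which makes the notion additive with prescribed top coefficients.\<close>

definition odd_poly_in :: "'a :: comm_ring_1 fps \<Rightarrow> nat \<Rightarrow> 'a fps \<Rightarrow> 'a \<Rightarrow> bool" where
  "odd_poly_in F j f c \<longleftrightarrow> (\<exists>\<kappa>. f = (\<Sum>m\<le>j. fps_const (\<kappa> m) * F ^ (2 * m + 1)) \<and> \<kappa> j = c)"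

lemma odd_poly_in_add:
  "odd_poly_in F j f c \<Longrightarrow> odd_poly_in F j g d \<Longrightarrow> odd_poly_in F j (f + g) (c + d)"
  unfolding odd_poly_in_def
proof (elim exE conjE)
  fix \<kappa> \<mu> assume "f = (\<Sum>m\<le>j. fps_const (\<kappa> m) * F ^ (2 * m + 1))" "\<kappa> j = c"
    "g = (\<Sum>m\<le>j. fps_const (\<mu> m) * F ^ (2 * m + 1))" "\<mu> j = d"
  thus "\<exists>\<kappa>. f + g = (\<Sum>m\<le>j. fps_const (\<kappa> m) * F ^ (2 * m + 1)) \<and> \<kappa> j = c + d"
    by (intro exI[of _ "\<lambda>m. \<kappa> m + \<mu> m"]) (simp add: sum.distrib distrib_right flip: fps_const_add)
qed

lemma odd_poly_in_cmult:
  "odd_poly_in F j f c \<Longrightarrow> odd_poly_in F j (fps_const a * f) (a * c)"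
  unfolding odd_poly_in_def
proof (elim exE conjE)
  fix \<kappa> assume "f = (\<Sum>m\<le>j. fps_const (\<kappa> m) * F ^ (2 * m + 1))" "\<kappa> j = c"
  thus "\<exists>\<kappa>. fps_const a * f = (\<Sum>m\<le>j. fps_const (\<kappa> m) * F ^ (2 * m + 1)) \<and> \<kappa> j = a * c"
    by (intro exI[of _ "\<lambda>m. a * \<kappa> m"]) (simp add: sum_distrib_left mult.assoc flip: fps_const_mult)
qed

lemma odd_poly_in_power:
  "m \<le> j \<Longrightarrow> odd_poly_in F j (F ^ (2 * m + 1)) (if m = j then 1 else 0)"
proof -
  assume m: "m \<le> j"
  have "(\<Sum>i\<le>j. fps_const (if i = m then 1 else 0) * F ^ (2 * i + 1)) = (\<Sum>i\<in>{m}. F ^ (2 * i + 1))"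
    using m by (intro sum.mono_neutral_cong_right) auto
  thus ?thesis unfolding odd_poly_in_def
    by (intro exI[of _ "\<lambda>i. if i = m then 1 else 0"]) auto
qed

lemma odd_poly_in_sum:
  assumes "finite A" "\<And>x. x \<in> A \<Longrightarrow> odd_poly_in F j (f x) (c x)"
  shows "odd_poly_in F j (sum f A) (sum c A)"
  using assms
proof (induction A rule: finite_induct)
  case empty
  show ?case unfolding odd_poly_in_def by (intro exI[of _ "\<lambda>_. 0"]) simp
qed (auto intro!: odd_poly_in_add)

context
  fixes F :: "complex fps" and \<delta> \<alpha> :: complex
  assumes F0: "fps_nth F 0 = 0" and F1: "fps_nth F 1 \<noteq> 0"
    and ode: "fps_deriv F ^ 2 = fps_const \<delta> + fps_const \<alpha> * F ^ 2 + F ^ 4"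
begin

text \<open>Differentiate the quartic equation and cancel 2 F', which is nonzero as F'(0)
  is.\<close>

lemma ode_second_order: "fps_deriv (fps_deriv F) = fps_const \<alpha> * F + 2 * F ^ 3"
proof -
  have nz: "fps_deriv F \<noteq> 0"
  proof
    assume "fps_deriv F = 0"
    from arg_cong[OF this, of "\<lambda>f. fps_nth f 0"] show False using F1 by simp
  qed
  have "fps_deriv (fps_deriv F ^ 2) = fps_deriv (fps_const \<delta> + fps_const \<alpha> * F ^ 2 + F ^ 4)"
    by (simp add: ode)
  hence "(2 * fps_deriv F) * fps_deriv (fps_deriv F) = (2 * fps_deriv F) * (fps_const \<alpha> * F + 2 * F ^ 3)"
    by (simp add: fps_deriv_power power2_eq_square power4_eq_xxxx power3_eq_cube algebra_simps)
  thus ?thesis using nz by simp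
qed

text \<open>For k = 2m + 1, the second derivative is k F^(k-1) F'' + k (k-1) F^(k-2) (F')^2. The top
  terms 2 F^3 of F'' and F^4 of (F')^2 combine to 2 k + k (k-1) = k (k+1).\<close>

lemma odd_poly_in_deriv2_power:
  assumes "m \<le> j"
  shows "odd_poly_in F (Suc j) (fps_deriv (fps_deriv (F ^ (2 * m + 1))))
    (if m = j then of_nat (2 * j + 1) * of_nat (2 * j + 2) else 0)"
proof (cases m)
  \<comment> \<open>Here F^(k-2) would be F^(-1), so the second order equation is used
    directly.\<close>
  case 0
  have "odd_poly_in F (Suc j) (fps_const \<alpha> * F ^ (2 * 0 + 1) + fps_const 2 * F ^ (2 * 1 + 1))
     (\<alpha> * (if 0 = Suc j then 1 else 0) + 2 * (if 1 = Suc j then 1 else 0))"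
    using assms by (intro odd_poly_in_add odd_poly_in_cmult odd_poly_in_power) auto
  thus ?thesis using 0 assms by (cases j) (simp_all add: ode_second_order fps_numeral_fps_const power3_eq_cube eval_nat_numeral)
next
  case (Suc l)
  define k :: complex where "k = of_nat (2 * m + 1)"
  have ks: "k = of_nat (Suc (Suc (2 * l + 1)))" "k - 1 = of_nat (Suc (2 * l + 1))"
    by (simp_all add: k_def Suc)
  have Fs: "F ^ (2 * m + 1) = F ^ Suc (Suc (2 * l + 1))" "F ^ (2 * m) = F ^ Suc (2 * l + 1)"
    by (simp_all add: Suc)
  have "fps_deriv (fps_deriv (F ^ (2 * m + 1))) = fps_const k *
     (F ^ (2 * m) * fps_deriv (fps_deriv F) + fps_const (k - 1) * F ^ (2 * l + 1) * fps_deriv F ^ 2)"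
    unfolding Fs ks(2) unfolding ks(1) fps_deriv2_power_Suc_Suc by (simp only: mult.assoc)
  also have "F ^ (2 * m) * fps_deriv (fps_deriv F) = fps_const \<alpha> * F ^ (2 * m + 1) + 2 * F ^ (2 * Suc m + 1)"
    unfolding ode_second_order by (simp add: algebra_simps power_add power3_eq_cube)
  also have "fps_const (k - 1) * F ^ (2 * l + 1) * fps_deriv F ^ 2 =
     fps_const (k - 1) * (fps_const \<delta> * F ^ (2 * l + 1) + fps_const \<alpha> * F ^ (2 * m + 1) + F ^ (2 * Suc m + 1))"
    unfolding ode by (simp add: algebra_simps power_add power3_eq_cube power2_eq_square power4_eq_xxxx Suc)
  finally have eq: "fps_deriv (fps_deriv (F ^ (2 * m + 1))) = fps_const k *
    (fps_const \<alpha> * F ^ (2 * m + 1) + fps_const 2 * F ^ (2 * Suc m + 1) +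
     fps_const (k - 1) * (fps_const \<delta> * F ^ (2 * l + 1) + fps_const \<alpha> * F ^ (2 * m + 1) + F ^ (2 * Suc m + 1)))"
    by (simp add: fps_numeral_fps_const)
  have "odd_poly_in F (Suc j) (fps_deriv (fps_deriv (F ^ (2 * m + 1))))
    (k * (\<alpha> * (if m = Suc j then 1 else 0) + 2 * (if Suc m = Suc j then 1 else 0) +
     (k - 1) * (\<delta> * (if l = Suc j then 1 else 0) + \<alpha> * (if m = Suc j then 1 else 0) + (if Suc m = Suc j then 1 else 0))))"
    unfolding eq using assms Suc by (intro odd_poly_in_add odd_poly_in_cmult odd_poly_in_power) auto
  thus ?thesis using assms Suc by (auto simp: k_def algebra_simps split: if_splits)
qed

text \<open>Only the top power F^(2j+1) reaches degree 2j + 3, so the leading coefficient is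
  multiplied by (2j+1)(2j+2) at each step.\<close>

lemma odd_poly_in_deriv_even: "odd_poly_in F j ((fps_deriv ^^ (2 * j)) F) (fact (2 * j))"
proof (induction j)
  case 0
  show ?case using odd_poly_in_power[of 0 0 F] by simp
next
  case (Suc j)
  then obtain \<kappa> where k: "(fps_deriv ^^ (2 * j)) F = (\<Sum>m\<le>j. fps_const (\<kappa> m) * F ^ (2 * m + 1))" "\<kappa> j = fact (2 * j)"
    unfolding odd_poly_in_def by blast
  have "(fps_deriv ^^ (2 * Suc j)) F = fps_deriv (fps_deriv ((fps_deriv ^^ (2 * j)) F))"
    by simp
  also have "\<dots> = (\<Sum>m\<le>j. fps_const (\<kappa> m) * fps_deriv (fps_deriv (F ^ (2 * m + 1))))"
    unfolding k(1) by (simp add: fps_deriv_sum)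
  finally have "odd_poly_in F (Suc j) ((fps_deriv ^^ (2 * Suc j)) F)
     (\<Sum>m\<le>j. \<kappa> m * (if m = j then of_nat (2 * j + 1) * of_nat (2 * j + 2) else 0))"
    by (simp only:) (intro odd_poly_in_sum odd_poly_in_cmult odd_poly_in_deriv2_power; simp)
  also have "(\<Sum>m\<le>j. \<kappa> m * (if m = j then of_nat (2 * j + 1) * of_nat (2 * j + 2) else 0)) =
     (\<Sum>m\<in>{j}. \<kappa> m * (of_nat (2 * j + 1) * of_nat (2 * j + 2)))"
    by (intro sum.mono_neutral_cong_right) auto
  also have "\<dots> = fact (2 * Suc j)" by (simp add: k(2) algebra_simps)
  finally show ?case .
qed

text \<open>The factorials of odd and even arguments interleave, and the first n odd numbers sum to
  n^2.\<close>

lemma prod_fact_even_odd: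
  "(\<Prod>i<n. fact (2 * i + 1) * x ^ (2 * i + 1)) * (\<Prod>i<n. fact (2 * i)) =
     (\<Prod>r=1..2*n-1. fact r) * (x :: complex) ^ (n\<^sup>2)"
proof (induction n)
  case (Suc n)
  have e: "{1..2 * Suc n - 1} = {1..2*n-1} \<union> (if n = 0 then {1} else {2*n, 2*n+1})"
    by auto
  have "(\<Prod>r=1..2 * Suc n-1. fact r) = (\<Prod>r=1..2*n-1. fact r) * (fact (2 * n) * fact (2 * n + 1) :: complex)"
    unfolding e by (subst prod.union_disjoint) (auto simp del: fact_Suc)
  moreover have "x ^ ((Suc n)\<^sup>2) = x ^ (n\<^sup>2) * x ^ (2 * n + 1)"
  proof -
    have "(Suc n)\<^sup>2 = n\<^sup>2 + (2 * n + 1)" by (simp add: power2_eq_square)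
    thus ?thesis by (simp only: power_add)
  qed
  ultimately show ?case using Suc by (simp add: mult_ac del: fact_Suc power_Suc)
qed simp

text \<open>The (i, j) entry is the derivative of order 2i + 1 of F^(2j) at 0. Expanding F^(2j) in
  the powers F^(2m+1) factors the matrix as L U: \<open>U\<close> is triangular by degree in F, and
  \<open>L\<close> is triangular because F^(2m+1) has order 2m + 1 in t.\<close>

lemma hankel_det_of_ode:
  "det (mat n n (\<lambda>(i, j). fact (2 * i + 2 * j + 1) * fps_nth F (2 * i + 2 * j + 1))) =
     (\<Prod>r=1..2*n-1. fact r) * fps_nth F 1 ^ (n\<^sup>2)"
proof -
  have "\<forall>j. \<exists>\<kappa>. (fps_deriv ^^ (2 * j)) F = (\<Sum>m\<le>j. fps_const (\<kappa> m) * F ^ (2 * m + 1)) \<and> \<kappa> j = fact (2 * j)"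
    using odd_poly_in_deriv_even unfolding odd_poly_in_def by blast
  then obtain \<kappa> where k: "\<And>j. (fps_deriv ^^ (2 * j)) F = (\<Sum>m\<le>j. fps_const (\<kappa> j m) * F ^ (2 * m + 1))"
    "\<And>j. \<kappa> j j = fact (2 * j)" by metis
  define L where "L = mat n n (\<lambda>(i, m). fact (2 * i + 1) * fps_nth (F ^ (2 * m + 1)) (2 * i + 1))"
  define U where "U = mat n n (\<lambda>(m, j). if m \<le> j then \<kappa> j m else 0)"
  have L: "L \<in> carrier_mat n n" and U: "U \<in> carrier_mat n n" by (auto simp: L_def U_def)
  have "mat n n (\<lambda>(i, j). fact (2 * i + 2 * j + 1) * fps_nth F (2 * i + 2 * j + 1)) = L * U"
  proof (rule eq_matI)
    fix i j assume "i < dim_row (L * U)" "j < dim_col (L * U)"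
    hence ij: "i < n" "j < n" by (auto simp: L_def U_def)
    have "fact (2 * i + 2 * j + 1) * fps_nth F (2 * i + 2 * j + 1) = fact (2 * i + 1) * fps_nth ((fps_deriv ^^ (2 * j)) F) (2 * i + 1)"
      by (subst fact_mult_fps_deriv_funpow_nth) (simp add: add_ac)
    also have "\<dots> = (\<Sum>m\<le>j. fact (2 * i + 1) * fps_nth (F ^ (2 * m + 1)) (2 * i + 1) * \<kappa> j m)"
      unfolding k(1) fps_sum_nth fps_mult_left_const_nth sum_distrib_left by (simp only: mult_ac)
    also have "\<dots> = (\<Sum>m<n. fact (2 * i + 1) * fps_nth (F ^ (2 * m + 1)) (2 * i + 1) * (if m \<le> j then \<kappa> j m else 0))"
      using ij by (intro sum.mono_neutral_cong_left) auto
    also have "\<dots> = (L * U) $$ (i, j)"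
      using ij by (simp add: L_def U_def scalar_prod_def atLeast0LessThan)
    finally show "mat n n (\<lambda>(i, j). fact (2 * i + 2 * j + 1) * fps_nth F (2 * i + 2 * j + 1)) $$ (i, j) = (L * U) $$ (i, j)"
      using ij by simp
  qed (auto simp: L_def U_def)
  moreover have "det L = (\<Prod>i<n. fact (2 * i + 1) * fps_nth F 1 ^ (2 * i + 1))"
  proof -
    have "det L = prod_list (diag_mat L)"
    proof (rule det_lower_triangular[OF _ L])
      fix i j assume "i < j" "j < n"
      thus "L $$ (i, j) = 0"
        using startsby_zero_power_prefix[OF F0, of "2 * j + 1"] by (simp add: L_def del: power_Suc)
    qed
    also have "\<dots> = (\<Prod>i<n. L $$ (i, i))" unfolding prod_list_diag_prod by (simp add: L_def atLeast0LessThan)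
    also have "\<dots> = (\<Prod>i<n. fact (2 * i + 1) * fps_nth F 1 ^ (2 * i + 1))"
      using startsby_zero_power_nth_same[OF F0] by (intro prod.cong) (auto simp: L_def simp del: power_Suc)
    finally show ?thesis .
  qed
  moreover have "det U = (\<Prod>i<n. fact (2 * i))"
  proof -
    have "det U = prod_list (diag_mat U)"
      by (rule det_upper_triangular[OF _ U]) (auto simp: U_def)
    also have "\<dots> = (\<Prod>i<n. fact (2 * i))"
      unfolding prod_list_diag_prod by (auto simp add: U_def atLeast0LessThan k(2))
    finally show ?thesis .
  qed
  ultimately show ?thesis
    by (simp only: det_mult[OF L U] prod_fact_even_odd)
qed

end

section \<open>Taylor coefficients of the Lambert series\<close>

definition lambert_sum :: "complex \<Rightarrow> nat \<Rightarrow> complex" where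
  "lambert_sum q k = (\<Sum>\<^sub>\<infinity>(y, m)\<in>{1..} \<times> {1..}. (-1) ^ y * (-1) ^ m * q ^ (m * y) * of_nat m ^ k)"

lemma of_nat_power_summable:
  fixes r :: complex
  assumes "norm r < 1"
  shows "(\<lambda>m::nat. r ^ m * of_nat m ^ k) summable_on UNIV"
proof (cases "r = 0")
  case True
  have "(\<lambda>m::nat. r ^ m * of_nat m ^ k) summable_on UNIV \<longleftrightarrow> (\<lambda>m::nat. r ^ m * of_nat m ^ k) summable_on {0}"
    by (rule summable_on_cong_neutral) (auto simp: True)
  thus ?thesis by simp
next
  case False
  have "decays (\<lambda>j. r ^ nat \<bar>j\<bar>)"
    unfolding decays_def using assms False
    by (intro exI[of _ 1] exI[of _ "norm r"]) (auto simp: norm_power)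
  hence "(\<lambda>j::int. r ^ nat \<bar>j\<bar> * of_int j ^ k) summable_on UNIV"
    using moments_int unfolding moments_def by blast
  hence "(\<lambda>j::int. r ^ nat \<bar>j\<bar> * of_int j ^ k) summable_on (int ` UNIV)"
    by (rule summable_on_subset_banach) auto
  thus ?thesis by (subst (asm) summable_on_reindex) (auto simp: o_def)
qed

context
  fixes q :: complex
  assumes q: "0 < norm q" "norm q < 1"
begin

text \<open>From (m-1)(y-1) >= 0 follows m + y <= 1 + m y, so the term is dominated by a product of
  a series in y and a series in m, at the cost of a factor 1/|q|.\<close>

lemma lambert_sum_summable:
  "(\<lambda>(y, m). (-1) ^ y * (-1) ^ m * q ^ (m * y) * of_nat m ^ k) summable_on {1..} \<times> {1..}"
proof -
  define r :: complex where "r = of_real (norm q)"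
  have r: "norm r < 1" using q by (simp add: r_def)
  have "(\<lambda>(y, m). r ^ y * (r ^ m * of_nat m ^ k)) summable_on {1..} \<times> {1..}"
    using of_nat_power_summable[OF r, of 0] of_nat_power_summable[OF r, of k]
    by (intro has_sum_imp_summable[OF has_sum_product]) (auto intro: summable_on_subset_banach)
  hence "(\<lambda>x. inverse r * (case x of (y, m) \<Rightarrow> r ^ y * (r ^ m * of_nat m ^ k))) abs_summable_on {1..} \<times> {1..}"
    unfolding summable_on_iff_abs_summable_on_complex[symmetric] by (rule summable_on_cmult_right)
  hence "(\<lambda>(y, m). (-1) ^ y * (-1) ^ m * q ^ (m * y) * of_nat m ^ k) abs_summable_on {1..} \<times> {1..}"
  proof (rule abs_summable_on_comparison_test)
    fix x :: "nat \<times> nat" assume "x \<in> {1..} \<times> {1..}"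
    then obtain y m where x: "x = (y, m)" and "y \<ge> 1" "m \<ge> 1" by auto
    then obtain y' m' where ym: "y = Suc y'" "m = Suc m'" by (metis Suc_le_D One_nat_def)
    have "norm q * norm q ^ (m * y) \<le> norm q ^ y * norm q ^ m"
    proof -
      have "y + m \<le> 1 + m * y" by (simp add: ym)
      hence "norm q ^ (1 + m * y) \<le> norm q ^ (y + m)" using q by (intro power_decreasing) auto
      thus ?thesis by (simp add: power_add)
    qed
    hence "norm q ^ (m * y) \<le> inverse (norm q) * (norm q ^ y * norm q ^ m)"
      using q by (simp add: field_simps)
    from mult_right_mono[OF this, of "of_nat m ^ k"]
    show "norm (case x of (y, m) \<Rightarrow> (-1) ^ y * (-1) ^ m * q ^ (m * y) * of_nat m ^ k)
       \<le> norm (inverse r * (case x of (y, m) \<Rightarrow> r ^ y * (r ^ m * of_nat m ^ k)))"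
      by (simp add: x norm_mult norm_power norm_inverse r_def mult_ac)
  qed
  thus ?thesis by (rule abs_summable_summable)
qed

lemma lambert_coeff_geometric:
  assumes "m \<ge> 1"
  shows "(\<Sum>\<^sub>\<infinity>y\<in>{1..}. (-1) ^ y * (-1) ^ m * q ^ (m * y)) = lambert_coeff q (int m)"
proof -
  have n: "norm (- (q ^ m)) < 1" using q assms by (simp add: norm_power power_less_one_iff)
  have "(\<Sum>\<^sub>\<infinity>y\<in>{1..}. (-1) ^ y * (-1) ^ m * q ^ (m * y)) = (-1) ^ m * (\<Sum>\<^sub>\<infinity>y\<in>{1..}. (- (q ^ m)) ^ y)"
    unfolding infsum_cmult_right'[symmetric] power_mult power_minus[of "q ^ m"]
    by (simp only: mult_ac)
  also have "(\<Sum>\<^sub>\<infinity>y\<in>{1..}. (- (q ^ m)) ^ y) = - (q ^ m) / (1 - (- (q ^ m)))"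
    by (rule infsumI, rule has_sum_geometric_from_1[OF n])
  finally show ?thesis using assms by (simp add: lambert_coeff_def alt_sign_def)
qed

text \<open>The coefficients are odd in n; times n^k with k odd they are even, and the two
  half-lines contribute equally. On the positive one each coefficient is a geometric series in
  -q^m.\<close>

lemma fps_nth_lambert_coeff:
  assumes "odd k"
  shows "fact k * fps_nth (exp_sum (lambert_coeff q) of_int) k = 2 * lambert_sum q k"
proof -
  define f where "f = (\<lambda>j::int. lambert_coeff q j * of_int j ^ k)"
  have s: "f summable_on UNIV"
    using moments_int[OF decays_lambert_coeff[OF q]] by (simp add: moments_def f_def)
  have sym: "f (- j) = f j" for j
    using assms by (auto simp: f_def lambert_coeff_def alt_sign_def)
  have "infsum f UNIV = infsum f ({1..} \<union> {..-1})"
  proof (rule infsum_cong_neutral)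
    fix x assume "x \<in> UNIV - ({1..} \<union> {..- 1 :: int})"
    hence "x = 0" by auto
    thus "f x = 0" by (simp add: f_def lambert_coeff_def)
  qed auto
  also have "\<dots> = infsum f {1..} + infsum f {..-1}"
    by (rule infsum_Un_disjoint) (auto intro: summable_on_subset_banach[OF s])
  also have "infsum f {..-1} = infsum f {1..}"
  proof -
    have "bij_betw uminus {1..} {..-1::int}"
      by (rule bij_betw_byWitness[where f' = uminus]) auto
    from infsum_reindex_bij_betw[OF this, of f] show ?thesis by (simp add: sym)
  qed
  also have "infsum f {1..} = (\<Sum>\<^sub>\<infinity>m\<in>{1..}. f (int m))"
  proof -
    have "bij_betw int {1..} {1..}"
      by (rule bij_betw_byWitness[where f' = nat]) auto
    from infsum_reindex_bij_betw[OF this, of f] show ?thesis by simp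
  qed
  also have "\<dots> = (\<Sum>\<^sub>\<infinity>m\<in>{1..}. \<Sum>\<^sub>\<infinity>y\<in>{1..}. (-1) ^ y * (-1) ^ m * q ^ (m * y) * of_nat m ^ k)"
  proof (rule infsum_cong)
    fix m :: nat assume "m \<in> {1..}"
    hence "m \<ge> 1" by simp
    from lambert_coeff_geometric[OF this]
    show "f (int m) = (\<Sum>\<^sub>\<infinity>y\<in>{1..}. (-1) ^ y * (-1) ^ m * q ^ (m * y) * of_nat m ^ k)"
      unfolding infsum_cmult_left' f_def of_int_of_nat_eq by (simp only:)
  qed
  also have "\<dots> = lambert_sum q k"
    unfolding lambert_sum_def
    using infsum_swap_banach[of "\<lambda>y m. (-1) ^ y * (-1) ^ m * q ^ (m * y) * of_nat m ^ k" "{1..}" "{1..}"]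
      lambert_sum_summable[of k] infsum_Sigma'_banach[of "\<lambda>y m. (-1) ^ y * (-1) ^ m * q ^ (m * y) * of_nat m ^ k" "{1..}" "\<lambda>_. {1..}"]
    by simp
  finally show ?thesis by (simp add: exp_sum_def f_def)
qed

end

section \<open>The Bernoulli part: \<open>tanh_real\<close> is tanh(t/2)/2, kept real so that its
  coefficients have signs\<close>

definition tanh_real :: "real fps" where
  "tanh_real = fps_const (1/2) - inverse (1 + fps_exp 1)"

lemma tanh_real_ode: "fps_deriv tanh_real = fps_const (1/4) - tanh_real ^ 2"
proof -
  define g where "g = inverse (1 + fps_exp (1::real))"
  define E where "E = fps_exp (1::real)"
  have g: "g * (1 + E) = 1" unfolding g_def E_def by (rule inverse_mult_eq_1) simp
  have "fps_deriv (g * (1 + E)) = 0" unfolding g by simp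
  hence "fps_deriv g * (1 + E) + g * E = 0" by (simp add: E_def algebra_simps)
  hence "(fps_deriv g * (1 + E) + g * E) * g = 0" by simp
  hence "fps_deriv g * (g * (1 + E)) + g * (g * (1 + E) - g) = 0" by (simp add: algebra_simps)
  hence "fps_deriv g + g - g * g = 0" unfolding g by (simp add: algebra_simps)
  hence "fps_deriv g = g * g - g" by (simp add: algebra_simps)
  moreover have hg: "fps_const (1/2) * g + fps_const (1/2) * g = g"
    by (simp flip: distrib_right)
  moreover have sq: "(h - g)\<^sup>2 = h * h - (h * g + h * g) + g * g" for h
    by (simp add: power2_eq_square algebra_simps)
  ultimately show ?thesis
    unfolding tanh_real_def g_def[symmetric] sq hg by simp
qed

text \<open>The Riccati equation gives a recursion under which the odd coefficients alternate in
  sign. Through \<open>tanh_real_nth\<close> this determines the sign of the even-index Bernoulli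
  numbers.\<close>

lemma tanh_real_sign:
  "(even n \<longrightarrow> fps_nth tanh_real n = 0) \<and> (odd n \<longrightarrow> (-1) ^ (n div 2) * fps_nth tanh_real n \<ge> 0)"
proof (induction n rule: less_induct)
  case (less n)
  show ?case
  proof (cases n)
    case 0
    thus ?thesis by (simp add: tanh_real_def)
  next
    case (Suc k)
    define t where "t = fps_nth tanh_real"
    have rec: "of_nat (Suc k) * t (Suc k) = (if k = 0 then 1/4 else 0) - (\<Sum>i=0..k. t i * t (k - i))"
      using arg_cong[OF tanh_real_ode, of "\<lambda>f. fps_nth f k"]
      by (simp add: t_def power2_eq_square fps_mult_nth)
    have IH: "even i \<Longrightarrow> t i = 0" "odd i \<Longrightarrow> (-1) ^ (i div 2) * t i \<ge> 0" if "i \<le> k" for i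
      using less.IH[of i] that Suc by (auto simp: t_def)
    show ?thesis
    proof (cases "even k")
      case False
      have "(\<Sum>i=0..k. t i * t (k - i)) = 0"
      proof (rule sum.neutral, rule ballI)
        fix i assume i: "i \<in> {0..k}"
        hence "even i \<or> even (k - i)" using False by auto
        thus "t i * t (k - i) = 0" using IH(1)[of i] IH(1)[of "k - i"] i by auto
      qed
      moreover have "k \<noteq> 0" using False by (cases k) auto
      ultimately have "of_nat (Suc k) * t (Suc k) = 0" using rec by simp
      hence "t (Suc k) = 0" by (simp del: of_nat_Suc)
      thus ?thesis using False Suc by (simp add: t_def)
    next
      case True
      have le: "(-1) ^ (k div 2) * (t i * t (k - i)) \<le> 0" if i: "i \<in> {0..k}" for i
      proof (cases "even i")
        case False
        have "odd (k - i)" using i False True by auto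
        \<comment> \<open>Two odd indices lose one unit when halved separately; the resulting extra
          sign cancels the minus sign of the Riccati equation.\<close>
        have "k div 2 = Suc (i div 2 + (k - i) div 2)"
        proof -
          obtain a where a: "i = 2 * a + 1" using False by (elim oddE)
          obtain b where b: "k - i = 2 * b + 1" using \<open>odd (k - i)\<close> by (elim oddE)
          have "k = i + (k - i)" using i by simp
          also have "\<dots> = 2 * (a + b + 1)" using a b by simp
          finally show ?thesis using a b by simp
        qed
        hence "(-1) ^ (k div 2) * (t i * t (k - i)) =
           - (((-1) ^ (i div 2) * t i) * ((-1) ^ ((k - i) div 2) * t (k - i)))"
          by (simp add: power_add mult_ac)
        moreover have "((-1) ^ (i div 2) * t i) * ((-1) ^ ((k - i) div 2) * t (k - i)) \<ge> 0"
          using i False \<open>odd (k - i)\<close> by (intro mult_nonneg_nonneg[OF IH(2) IH(2)]) auto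
        ultimately show ?thesis by linarith
      qed (use IH(1)[of i] i in auto)
      have "of_nat (Suc k) * ((-1) ^ (k div 2) * t (Suc k)) =
         (-1) ^ (k div 2) * (if k = 0 then 1/4 else 0) - (\<Sum>i=0..k. (-1) ^ (k div 2) * (t i * t (k - i)))"
        using arg_cong[OF rec, of "\<lambda>x. (-1) ^ (k div 2) * x"]
        by (simp only: right_diff_distrib sum_distrib_left mult.left_commute)
      moreover have "(\<Sum>i=0..k. (-1) ^ (k div 2) * (t i * t (k - i))) \<le> 0"
        by (rule sum_nonpos) (rule le)
      moreover have "(-1) ^ (k div 2) * (if k = 0 then 1/4 else 0) \<ge> (0::real)" by simp
      ultimately have "of_nat (Suc k) * ((-1) ^ (k div 2) * t (Suc k)) \<ge> 0" by linarith
      hence "(-1) ^ (k div 2) * t (Suc k) \<ge> 0"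
        by (simp only: zero_le_mult_iff) (auto simp del: of_nat_Suc)
      thus ?thesis using True Suc by (simp add: t_def)
    qed
  qed
qed

text \<open>This is t/(e^t - 1) - 2t/(e^(2t) - 1) = t/(e^t + 1) compared coefficientwise; division
  by t accounts for the index shift.\<close>

lemma tanh_real_nth:
  assumes "n \<ge> 1"
  shows "fps_nth tanh_real n = (2 ^ (n + 1) - 1) * bernoulli_number (n + 1) / fact (n + 1)"
proof -
  define E where "E = fps_exp (1::real)"
  define b where "b = Abs_fps (\<lambda>n. bernoulli_number n / fact n)"
  \<comment> \<open>The series \<open>b\<close> evaluated at 2t.\<close>
  define b2 where "b2 = Abs_fps (\<lambda>n. 2 ^ n * (bernoulli_number n / fact n))"
  have b: "b * (E - 1) = fps_X" unfolding b_def E_def by (rule bernoulli_number_egf)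
  have b2: "b2 * (E * E - 1) = 2 * fps_X"
  proof (rule fps_ext)
    fix n
    have EE: "E * E = fps_exp 2" by (simp add: E_def flip: fps_exp_add_mult)
    have "fps_nth (b2 * (E * E - 1)) n = 2 ^ n * fps_nth (b * (E - 1)) n"
      unfolding fps_mult_nth sum_distrib_left EE
    proof (rule sum.cong)
      fix i assume "i \<in> {0..n}"
      hence "2 ^ n = 2 ^ i * (2 ^ (n - i) :: real)" by (simp flip: power_add)
      thus "fps_nth b2 i * fps_nth (fps_exp 2 - 1) (n - i) = 2 ^ n * (fps_nth b i * fps_nth (E - 1) (n - i))"
        by (simp add: b2_def b_def E_def field_simps)
    qed simp
    also have "\<dots> = fps_nth (2 * fps_X) n"
      unfolding b by (cases "n = 1") (auto simp: fps_numeral_fps_const)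
    finally show "fps_nth (b2 * (E * E - 1)) n = fps_nth (2 * fps_X) n" .
  qed
  have nz: "E - 1 \<noteq> 0"
    using b by auto
  have "(b - b2) * (E + 1) * (E - 1) = (b * (E - 1)) * (E + 1) - b2 * (E * E - 1)"
    by (simp add: algebra_simps)
  also have "\<dots> = fps_X * (E - 1)" unfolding b b2 by (simp add: algebra_simps)
  finally have key: "(b - b2) * (E + 1) = fps_X" using nz by simp
  have g: "inverse (1 + E) * (1 + E) = 1" unfolding E_def by (rule inverse_mult_eq_1) simp
  have "b - b2 = (b - b2) * (inverse (1 + E) * (1 + E))" unfolding g by simp
  also have "\<dots> = ((b - b2) * (E + 1)) * inverse (1 + E)" by (simp add: algebra_simps)
  finally have "b - b2 = fps_X * inverse (1 + E)" unfolding key .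
  from arg_cong[OF this, of "\<lambda>f. fps_nth f (Suc n)"]
  have "fps_nth (inverse (1 + E)) n = fps_nth b (Suc n) - fps_nth b2 (Suc n)" by simp
  thus ?thesis using assms by (simp add: tanh_real_def E_def b_def b2_def field_simps del: fact_Suc)
qed

lemma half_tanh_nth: "fps_nth half_tanh n = - of_real (fps_nth tanh_real n)"
proof -
  define G where "G = Abs_fps (\<lambda>n. - of_real (fps_nth tanh_real n) :: complex)"
  have tr: "(1 + fps_exp 1) * tanh_real = fps_const (1/2) * fps_exp 1 - fps_const (1/2)"
  proof -
    have "(1 + fps_exp 1) * tanh_real = fps_const (1/2) * (1 + fps_exp 1) - inverse (1 + fps_exp 1) * (1 + fps_exp (1::real))"
      by (simp add: tanh_real_def algebra_simps)
    also have "inverse (1 + fps_exp 1) * (1 + fps_exp (1::real)) = 1"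
      by (rule inverse_mult_eq_1) simp
    also have "fps_const (1/2) * (1 + fps_exp 1) - 1 = fps_const (1/2) * fps_exp 1 - fps_const (1/2 :: real)"
      by (rule fps_ext) (simp add: algebra_simps)
    finally show ?thesis .
  qed
  have "(1 + fps_exp 1) * G = fps_const (1/2) - fps_const (1/2) * fps_exp 1"
  proof (rule fps_ext)
    fix n
    have "fps_nth ((1 + fps_exp 1) * G) n = - of_real (fps_nth ((1 + fps_exp 1) * tanh_real) n)"
      unfolding fps_mult_nth of_real_sum sum_negf[symmetric]
      by (rule sum.cong) (simp_all add: G_def)
    also have "\<dots> = fps_nth (fps_const (1/2) - fps_const (1/2) * fps_exp 1) n"
      unfolding tr by simp
    finally show "fps_nth ((1 + fps_exp 1) * G) n = fps_nth (fps_const (1/2) - fps_const (1/2) * fps_exp 1) n" .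
  qed
  hence "(1 + fps_exp 1) * G = (1 + fps_exp 1) * half_tanh" unfolding half_tanh_mult .
  moreover have "fps_nth (1 + fps_exp (1::complex)) 0 \<noteq> fps_nth 0 0" by simp
  hence "1 + fps_exp (1::complex) \<noteq> 0" by metis
  ultimately have "G = half_tanh" by simp
  from arg_cong[OF this, of "\<lambda>f. fps_nth f n"] show ?thesis by (simp add: G_def)
qed

text \<open>The sign in \<open>c_coeff\<close> combines with the absolute value to give back the
  Bernoulli number itself, by \<open>tanh_real_sign\<close>.\<close>

lemma c_coeff_eq:
  "fact (2 * i + 1) * fps_nth half_tanh (2 * i + 1) = - 2 * of_real (c_coeff (i + 1))"
proof -
  define B where "B = bernoulli_number (2 * (i + 1))"
  have t: "fps_nth tanh_real (2 * i + 1) = (2 ^ (2 * (i + 1)) - 1) * B / fact (2 * (i + 1))"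
    by (subst tanh_real_nth) (auto simp: B_def)
  have "(-1) ^ i * fps_nth tanh_real (2 * i + 1) \<ge> 0"
    using tanh_real_sign[of "2 * i + 1"] by simp
  hence "(2 ^ (2 * (i + 1)) - 1) / fact (2 * (i + 1)) * ((-1) ^ i * B) \<ge> 0"
    unfolding t by (simp add: mult_ac)
  moreover have pos: "(2 ^ (2 * (i + 1)) - 1) / fact (2 * (i + 1)) > (0::real)"
    using one_less_power[of "2::real" "2 * (i + 1)"] by (intro divide_pos_pos) auto
  ultimately have "(-1) ^ i * B \<ge> 0"
    by (simp only: zero_le_mult_iff) linarith
  moreover have "\<bar>B\<bar> = \<bar>(-1) ^ i * B\<bar>" by (simp add: abs_mult)
  ultimately have "\<bar>B\<bar> = (-1) ^ i * B" by simp
  hence B: "(-1) ^ i * \<bar>B\<bar> = B" by simp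
  define Z where "Z = (2 ^ (2 * (i + 1)) - 1) * B / (2 * real (i + 1))"
  have "c_coeff (i + 1) = ((2 ^ (2 * (i + 1)) - 1) / (4 * real (i + 1))) * ((-1) ^ i * \<bar>B\<bar>)"
    unfolding c_coeff_def B_def[symmetric] by (simp only: mult_ac add_diff_cancel_right')
  also have "\<dots> = Z / 2" unfolding B Z_def by simp
  finally have "Z = 2 * c_coeff (i + 1)" by simp
  moreover have "fact (2 * i + 1) * fps_nth tanh_real (2 * i + 1) = Z"
  proof -
    have "fact (2 * (i + 1)) = 2 * real (i + 1) * fact (2 * i + 1)" by (simp add: algebra_simps)
    thus ?thesis unfolding t Z_def by simp
  qed
  ultimately have "fact (2 * i + 1) * fps_nth tanh_real (2 * i + 1) = 2 * c_coeff (i + 1)"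
    by (rule trans[rotated])
  from arg_cong[OF this, of complex_of_real] show ?thesis
    unfolding half_tanh_nth by simp
qed

section \<open>Minors of a sum of two matrices\<close>

definition minor :: "(nat \<Rightarrow> nat \<Rightarrow> 'a :: comm_ring_1) \<Rightarrow> nat set \<Rightarrow> nat set \<Rightarrow> 'a" where
  "minor A S T = det (mat (card S) (card S) (\<lambda>(i, j). A (nth_elem S (i + 1)) (nth_elem T (j + 1))))"

definition rank_in :: "nat set \<Rightarrow> nat \<Rightarrow> nat" where
  "rank_in T t = card {x \<in> T. x < t}"

text \<open>The exponent of the Laplace sign, taken relative to S0 instead of as the sum of S, so
  that it can be followed when elements are deleted from S0. For S0 = {1..n} it is the sum of S
  minus the cardinality of S.\<close>

definition rank_sum :: "nat set \<Rightarrow> nat set \<Rightarrow> nat" where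
  "rank_sum S S0 = (\<Sum>s\<in>S. rank_in S0 s)"

lemma nth_elem_bij:
  assumes "finite T"
  shows "bij_betw (\<lambda>j. nth_elem T (j + 1)) {..<card T} T"
  unfolding nth_elem_def using bij_betw_nth[of "sorted_list_of_set T" "{..<card T}" T] assms by simp

lemma nth_elem_in: "finite T \<Longrightarrow> j < card T \<Longrightarrow> nth_elem T (j + 1) \<in> T"
  using nth_elem_bij by (fastforce simp: bij_betw_def)

lemma nth_elem_strict_mono:
  assumes "finite T" "i < j" "j < card T"
  shows "nth_elem T (i + 1) < nth_elem T (j + 1)"
  using assms strict_sorted_list_of_set[of T] unfolding nth_elem_def
  by (simp add: sorted_wrt_iff_nth_less)

lemma rank_in_nth_elem:
  assumes "finite T" "j < card T"
  shows "rank_in T (nth_elem T (j + 1)) = j"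
proof -
  have "{x \<in> T. x < nth_elem T (j + 1)} = (\<lambda>j. nth_elem T (j + 1)) ` {..<j}"
  proof (intro equalityI subsetI)
    fix x assume x: "x \<in> {x \<in> T. x < nth_elem T (j + 1)}"
    then obtain i where i: "i < card T" "x = nth_elem T (i + 1)"
      using nth_elem_bij[OF assms(1)] by (force simp: bij_betw_def)
    have "i < j"
    proof (rule ccontr)
      assume "\<not> i < j"
      hence "i = j \<or> j < i" by auto
      thus False using x i nth_elem_strict_mono[OF assms(1), of j i] by auto
    qed
    thus "x \<in> (\<lambda>j. nth_elem T (j + 1)) ` {..<j}" using i by blast
  next
    fix x assume "x \<in> (\<lambda>j. nth_elem T (j + 1)) ` {..<j}"
    thus "x \<in> {x \<in> T. x < nth_elem T (j + 1)}"
      using nth_elem_in[OF assms(1)] nth_elem_strict_mono[OF assms(1)] assms(2) by auto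
  qed
  moreover have "inj_on (\<lambda>j. nth_elem T (j + 1)) {..<j}"
    using nth_elem_bij[OF assms(1)] assms(2) by (auto simp: bij_betw_def intro: inj_on_subset)
  ultimately show ?thesis unfolding rank_in_def by (simp add: card_image)
qed

lemma nth_elem_remove:
  assumes "finite T" "j < card T" "i < card T - 1"
  shows "nth_elem (T - {nth_elem T (j + 1)}) (i + 1) = nth_elem T ((if i < j then i else Suc i) + 1)"
proof -
  define xs where "xs = sorted_list_of_set T"
  have xs: "distinct xs" "length xs = card T" using assms by (auto simp: xs_def)
  have "sorted_list_of_set (T - {xs ! j}) = remove1 (xs ! j) xs"
    unfolding xs_def by (rule sorted_list_of_set_remove[OF assms(1)])
  also have "\<dots> = take j xs @ drop (Suc j) xs"
  proof -
    have "xs = take j xs @ xs ! j # drop (Suc j) xs" using assms xs by (simp add: id_take_nth_drop)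
    moreover have "xs ! j \<notin> set (take j xs)"
      using xs assms by (auto simp: in_set_conv_nth nth_eq_iff_index_eq)
    ultimately show ?thesis by (metis remove1_append remove1.simps(2))
  qed
  finally show ?thesis
    using assms xs unfolding nth_elem_def xs_def[symmetric] by (auto simp: nth_append)
qed

text \<open>Expansion along the first row; the rank of t in T is its column index counted from 0,
  which gives the cofactor sign.\<close>

lemma minor_laplace:
  assumes S: "finite S" "S \<noteq> {}" and T: "finite T" "card T = card S"
  shows "minor A S T = (\<Sum>t\<in>T. (-1) ^ rank_in T t * A (Min S) t * minor A (S - {Min S}) (T - {t}))"
proof -
  define p where "p = card S"
  define M where "M = mat p p (\<lambda>(i, j). A (nth_elem S (i + 1)) (nth_elem T (j + 1)))"
  have p: "p > 0" using S by (auto simp: p_def card_gt_0_iff)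
  have M: "M \<in> carrier_mat p p" by (simp add: M_def)
  have min: "nth_elem S (0 + 1) = Min S"
  proof -
    have "sorted_list_of_set S = Min S # sorted_list_of_set (S - {Min S})"
      using S by (rule sorted_list_of_set_nonempty)
    thus ?thesis by (simp add: nth_elem_def)
  qed
  have del: "det (mat_delete M 0 j) = minor A (S - {Min S}) (T - {nth_elem T (j + 1)})" if j: "j < p" for j
  proof -
    have c: "card (S - {Min S}) = p - 1" using S by (simp add: p_def)
    have "mat_delete M 0 j = mat (p - 1) (p - 1) (\<lambda>(i, k). A (nth_elem (S - {Min S}) (i + 1)) (nth_elem (T - {nth_elem T (j + 1)}) (k + 1)))"
    proof (rule eq_matI, goal_cases)
      case (1 i k)
      hence ik: "i < p - 1" "k < p - 1" by auto
      have "nth_elem (S - {Min S}) (i + 1) = nth_elem S (Suc i + 1)"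
        using nth_elem_remove[of S 0 i] S ik p unfolding min by (simp add: p_def)
      moreover have "nth_elem (T - {nth_elem T (j + 1)}) (k + 1) = nth_elem T ((if k < j then k else Suc k) + 1)"
        using nth_elem_remove[of T j k] T ik j by (simp add: p_def)
      ultimately show ?case using ik by (auto simp: mat_delete_def M_def)
    qed (auto simp: mat_delete_def M_def)
    thus ?thesis unfolding minor_def c by simp
  qed
  have "minor A S T = (\<Sum>j<p. M $$ (0, j) * cofactor M 0 j)"
    unfolding minor_def p_def[symmetric] M_def[symmetric] by (rule laplace_expansion_row[OF M p])
  also have "\<dots> = (\<Sum>j<p. (-1) ^ rank_in T (nth_elem T (j + 1)) * A (Min S) (nth_elem T (j + 1)) * minor A (S - {Min S}) (T - {nth_elem T (j + 1)}))"
  proof (rule sum.cong)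
    fix j assume "j \<in> {..<p}"
    hence j: "j < p" by simp
    have "M $$ (0, j) = A (Min S) (nth_elem T (j + 1))" using j p min by (simp add: M_def)
    moreover have "rank_in T (nth_elem T (j + 1)) = j"
      by (rule rank_in_nth_elem) (use T j in \<open>auto simp: p_def\<close>)
    ultimately show "M $$ (0, j) * cofactor M 0 j = (-1) ^ rank_in T (nth_elem T (j + 1)) * A (Min S) (nth_elem T (j + 1)) * minor A (S - {Min S}) (T - {nth_elem T (j + 1)})"
      unfolding cofactor_def del[OF j] by (simp add: mult_ac)
  qed simp
  also have "\<dots> = (\<Sum>t\<in>T. (-1) ^ rank_in T t * A (Min S) t * minor A (S - {Min S}) (T - {t}))"
    using sum.reindex_bij_betw[OF nth_elem_bij[OF T(1)], of "\<lambda>t. (-1) ^ rank_in T t * A (Min S) t * minor A (S - {Min S}) (T - {t})"] T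
    by (simp add: p_def)
  finally show ?thesis .
qed

lemma sum_subsets_outside:
  assumes "finite T0"
  shows "(\<Sum>T | T \<subseteq> T0 \<and> card T = k. \<Sum>t\<in>T0 - T. g T t) =
         (\<Sum>t\<in>T0. \<Sum>T | T \<subseteq> T0 - {t} \<and> card T = k. g T t)"
proof -
  have "(\<Sum>T | T \<subseteq> T0 \<and> card T = k. \<Sum>t\<in>T0 - T. g T t) =
     (\<Sum>T\<in>{T. T \<subseteq> T0 \<and> card T = k}. \<Sum>t | t \<in> T0 \<and> t \<notin> T. g T t)"
    by (intro sum.cong) auto
  also have "\<dots> = (\<Sum>t\<in>T0. \<Sum>T | T \<in> {T. T \<subseteq> T0 \<and> card T = k} \<and> t \<notin> T. g T t)"
    using assms by (intro sum.swap_restrict) (auto intro: finite_subset[of _ "Pow T0"])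
  also have "\<dots> = (\<Sum>t\<in>T0. \<Sum>T | T \<subseteq> T0 - {t} \<and> card T = k. g T t)"
    by (intro sum.cong) auto
  finally show ?thesis .
qed

lemma sum_subsets_inside:
  assumes "finite T0"
  shows "(\<Sum>T | T \<subseteq> T0 \<and> card T = Suc k. \<Sum>t\<in>T. g T t) =
         (\<Sum>t\<in>T0. \<Sum>T | T \<subseteq> T0 - {t} \<and> card T = k. g (insert t T) t)"
proof -
  have "(\<Sum>T | T \<subseteq> T0 \<and> card T = Suc k. \<Sum>t\<in>T. g T t) =
     (\<Sum>T\<in>{T. T \<subseteq> T0 \<and> card T = Suc k}. \<Sum>t | t \<in> T0 \<and> t \<in> T. g T t)"
    by (intro sum.cong) auto
  also have "\<dots> = (\<Sum>t\<in>T0. \<Sum>T | T \<in> {T. T \<subseteq> T0 \<and> card T = Suc k} \<and> t \<in> T. g T t)"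
    using assms by (intro sum.swap_restrict) (auto intro: finite_subset[of _ "Pow T0"])
  also have "\<dots> = (\<Sum>t\<in>T0. \<Sum>T | T \<subseteq> T0 - {t} \<and> card T = k. g (insert t T) t)"
  proof (rule sum.cong)
    fix t assume t: "t \<in> T0"
    show "(\<Sum>T | T \<in> {T. T \<subseteq> T0 \<and> card T = Suc k} \<and> t \<in> T. g T t) =
        (\<Sum>T | T \<subseteq> T0 - {t} \<and> card T = k. g (insert t T) t)"
    proof (rule sum.reindex_bij_witness[where i = "insert t" and j = "\<lambda>T. T - {t}"])
      fix T assume T: "T \<in> {T. T \<subseteq> T0 - {t} \<and> card T = k}"
      hence "finite T" "t \<notin> T" using assms finite_subset[of T "T0 - {t}"] by auto
      thus "insert t T \<in> {T \<in> {T. T \<subseteq> T0 \<and> card T = Suc k}. t \<in> T}" using T t by auto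
    next
      fix T assume T: "T \<in> {T \<in> {T. T \<subseteq> T0 \<and> card T = Suc k}. t \<in> T}"
      hence "finite T" using assms finite_subset by blast
      thus "T - {t} \<in> {T. T \<subseteq> T0 - {t} \<and> card T = k}" using T by auto
    qed (auto simp: insert_absorb)
  qed simp
  finally show ?thesis .
qed

lemma rank_sum_remove_min:
  assumes "finite S0" "S0 \<noteq> {}" "S \<subseteq> S0 - {Min S0}"
  shows "rank_sum S S0 = rank_sum S (S0 - {Min S0}) + card S"
    and "rank_sum (insert (Min S0) S) S0 = rank_sum S S0"
proof -
  have fin: "finite S" using assms finite_subset by blast
  have m: "Min S0 \<in> S0" using assms by simp
  have "rank_in S0 x = rank_in (S0 - {Min S0}) x + 1" if "x \<in> S" for x
  proof -
    have x: "x \<in> S0" "x \<noteq> Min S0" using that assms by auto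
    hence "Min S0 < x" using assms Min_le[of S0 x] by linarith
    hence "{y \<in> S0. y < x} = insert (Min S0) {y \<in> S0 - {Min S0}. y < x}"
      using m by blast
    thus ?thesis unfolding rank_in_def using assms by simp
  qed
  thus "rank_sum S S0 = rank_sum S (S0 - {Min S0}) + card S"
    unfolding rank_sum_def by (simp add: sum.distrib[symmetric] flip: Suc_eq_plus1)
       (metis (no_types, lifting) Suc_eq_plus1 sum.cong sum_Suc)
  have "{y \<in> S0. y < Min S0} = {}" using assms Min_le[of S0] by fastforce
  hence "rank_in S0 (Min S0) = 0" by (simp add: rank_in_def)
  moreover have "Min S0 \<notin> S" using assms by auto
  ultimately show "rank_sum (insert (Min S0) S) S0 = rank_sum S S0"
    unfolding rank_sum_def using fin by simp
qed

lemma rank_in_diff: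
  assumes "finite T0" "T \<subseteq> T0"
  shows "rank_in T0 t = rank_in (T0 - T) t + rank_in T t"
proof -
  have "{x \<in> T0. x < t} = {x \<in> T0 - T. x < t} \<union> {x \<in> T. x < t}" using assms by auto
  thus ?thesis unfolding rank_in_def
    using assms finite_subset[of T T0] by (subst card_Un_disjoint[symmetric]) auto
qed

text \<open>Deleting t lowers the rank of exactly the elements of T above t, while
  \<open>rank_in T t\<close> counts those below; together they exhaust T.\<close>

lemma rank_sum_remove:
  assumes "finite T0" "t \<in> T0" "T \<subseteq> T0 - {t}"
  shows "rank_sum T T0 + rank_in T t = rank_sum T (T0 - {t}) + card T"
proof -
  have fin: "finite T" using assms finite_subset by blast
  have eq: "rank_in T0 x = rank_in (T0 - {t}) x + (if t < x then 1 else 0)" for x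
  proof -
    have "{y \<in> T0. y < x} = (if t < x then insert t {y \<in> T0 - {t}. y < x} else {y \<in> T0 - {t}. y < x})"
      using assms by auto
    thus ?thesis unfolding rank_in_def using assms by simp
  qed
  have "rank_sum T T0 = rank_sum T (T0 - {t}) + card {x \<in> T. t < x}"
    unfolding rank_sum_def eq sum.distrib using fin by (simp add: sum.If_cases Int_def)
  moreover have "card T = card {x \<in> T. t < x} + card {x \<in> T. x < t}"
  proof -
    have "card T = card ({x \<in> T. t < x} \<union> {x \<in> T. x < t})"
      using assms by (intro arg_cong[where f = card]) auto
    also have "\<dots> = card {x \<in> T. t < x} + card {x \<in> T. x < t}"
      using fin by (intro card_Un_disjoint) auto
    finally show ?thesis .
  qed
  ultimately show ?thesis by (simp add: rank_in_def)
qed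

lemma minus_one_power_eq_iff_even: "even (a + b) \<Longrightarrow> (-1 :: 'a :: ring_1) ^ a = (-1) ^ b"
  by (simp add: minus_one_power_iff)

lemma mult_swap_signs:
  fixes a :: "'a :: comm_semiring_1"
  assumes "a * b = c * d"
  shows "a * x * (b * y * z) = c * y * (d * x * z)" "a * (b * y * x) * z = c * y * (d * x * z)"
proof -
  have "a * x * (b * y * z) = (a * b) * (x * y * z)" by (simp only: mult_ac)
  also have "\<dots> = c * y * (d * x * z)" unfolding assms by (simp only: mult_ac)
  finally show "a * x * (b * y * z) = c * y * (d * x * z)" .
  thus "a * (b * y * x) * z = c * y * (d * x * z)" by (simp only: mult_ac)
qed

text \<open>Induction on the number of rows. The first row of A + B splits: its A-part belongs to
  the complementary minor of A, its B-part to the minor of B, so these give the index sets S without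
  and with the least row. Interchanging the choice of T with that of the expansion column reduces
  the rest to parities of ranks.\<close>

lemma minor_add:
  assumes "finite S0" "finite T0" "card T0 = card S0"
  shows "minor (\<lambda>i j. A i j + B i j) S0 T0 =
    (\<Sum>S\<in>Pow S0. \<Sum>T | T \<subseteq> T0 \<and> card T = card S.
       (-1) ^ (rank_sum S S0 + rank_sum T T0) * minor B S T * minor A (S0 - S) (T0 - T))"
  using assms
proof (induction "card S0" arbitrary: S0 T0)
  case 0
  hence [simp]: "S0 = {}" "T0 = {}" by auto
  have "{T. T = {} \<and> card T = 0} = {{}::nat set}" by auto
  thus ?case by (simp add: minor_def rank_sum_def)
next
  case (Suc n)
  define s where "s = Min S0"
  define S1 where "S1 = S0 - {s}"
  have ne: "S0 \<noteq> {}" using Suc by auto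
  have s: "s \<in> S0" unfolding s_def using Suc ne by auto
  have fin: "finite S0" "finite T0" "finite S1" using Suc by (auto simp: S1_def)
  have c1: "card S1 = n" using Suc s fin by (simp add: S1_def)
  define h where "h = (\<lambda>S T. (-1) ^ (rank_sum S S0 + rank_sum T T0) * minor B S T * minor A (S0 - S) (T0 - T))"
  define gA where "gA = (\<lambda>S T t. (-1) ^ (rank_sum S S0 + rank_sum T T0) * minor B S T * ((-1) ^ rank_in (T0 - T) t * A s t * minor A (S1 - S) (T0 - T - {t})))"
  define gB where "gB = (\<lambda>S T t. (-1) ^ (rank_sum (insert s S) S0 + rank_sum T T0) * ((-1) ^ rank_in T t * B s t * minor B S (T - {t})) * minor A (S1 - S) (T0 - T))"
  define E where "E = (\<lambda>t. (-1 :: 'a) ^ rank_in T0 t)"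
  define X where "X = (\<lambda>t S T. (-1) ^ (rank_sum S S1 + rank_sum T (T0 - {t})) * minor B S T * minor A (S1 - S) (T0 - {t} - T))"
  have IH: "minor (\<lambda>i j. A i j + B i j) S1 (T0 - {t}) =
      (\<Sum>S\<in>Pow S1. \<Sum>T | T \<subseteq> T0 - {t} \<and> card T = card S. X t S T)" if "t \<in> T0" for t
    unfolding X_def by (rule Suc.hyps(1)) (use that Suc.prems Suc.hyps(2) fin c1 in auto)
  have "minor (\<lambda>i j. A i j + B i j) S0 T0 =
     (\<Sum>t\<in>T0. E t * (A s t + B s t) * (\<Sum>S\<in>Pow S1. \<Sum>T | T \<subseteq> T0 - {t} \<and> card T = card S. X t S T))"
    unfolding minor_laplace[OF fin(1) ne fin(2) Suc.prems(3)] s_def[symmetric] S1_def[symmetric]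
    by (intro sum.cong) (auto simp: IH E_def)
  also have "\<dots> = (\<Sum>S\<in>Pow S1. \<Sum>t\<in>T0. \<Sum>T | T \<subseteq> T0 - {t} \<and> card T = card S. E t * (A s t + B s t) * X t S T)"
    unfolding sum_distrib_left by (subst sum.swap) (rule refl)
  also have "\<dots> = (\<Sum>S\<in>Pow S1. \<Sum>t\<in>T0. \<Sum>T | T \<subseteq> T0 - {t} \<and> card T = card S. E t * A s t * X t S T)
      + (\<Sum>S\<in>Pow S1. \<Sum>t\<in>T0. \<Sum>T | T \<subseteq> T0 - {t} \<and> card T = card S. E t * B s t * X t S T)"
    by (simp add: sum.distrib[symmetric] algebra_simps)
  \<comment> \<open>The A-part: the least row stays outside S, so here the minor of A is
    expanded.\<close>
  also have "(\<Sum>S\<in>Pow S1. \<Sum>t\<in>T0. \<Sum>T | T \<subseteq> T0 - {t} \<and> card T = card S. E t * A s t * X t S T) =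
     (\<Sum>S\<in>Pow S1. \<Sum>T | T \<subseteq> T0 \<and> card T = card S. h S T)"
  proof (rule sum.cong)
    fix S assume "S \<in> Pow S1"
    hence S: "S \<subseteq> S0 - {s}" by (auto simp: S1_def)
    have rS: "rank_sum S S0 = rank_sum S S1 + card S"
      using rank_sum_remove_min(1)[OF fin(1) ne] S unfolding S1_def s_def by auto
    have minS: "Min (S0 - S) = s" unfolding s_def
      by (rule Min_eqI) (use fin s S in \<open>auto simp: s_def\<close>)
    have "(\<Sum>T | T \<subseteq> T0 \<and> card T = card S. h S T) =
      (\<Sum>T | T \<subseteq> T0 \<and> card T = card S. \<Sum>t\<in>T0 - T. gA S T t)"
    proof (rule sum.cong)
      fix T assume T: "T \<in> {T. T \<subseteq> T0 \<and> card T = card S}"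
      hence fT: "finite T" using fin finite_subset by auto
      have fS: "finite S" using S fin finite_subset by blast
      have "minor A (S0 - S) (T0 - T) = (\<Sum>t\<in>T0 - T. (-1) ^ rank_in (T0 - T) t * A (Min (S0 - S)) t * minor A (S0 - S - {Min (S0 - S)}) (T0 - T - {t}))"
      proof (rule minor_laplace)
        show "card (T0 - T) = card (S0 - S)"
          using T S fT fS Suc.prems by (subst (1 2) card_Diff_subset) auto
        show "S0 - S \<noteq> {}" using s S by auto
      qed (use fin in auto)
      moreover have "S0 - S - {s} = S1 - S" by (auto simp: S1_def)
      ultimately show "h S T =
        (\<Sum>t\<in>T0 - T. gA S T t)"
        unfolding minS h_def gA_def by (simp add: sum_distrib_left)
    qed simp
    also have "\<dots> = (\<Sum>t\<in>T0. \<Sum>T | T \<subseteq> T0 - {t} \<and> card T = card S. gA S T t)"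
      by (rule sum_subsets_outside[OF fin(2)])
    also have "\<dots> = (\<Sum>t\<in>T0. \<Sum>T | T \<subseteq> T0 - {t} \<and> card T = card S. E t * A s t * X t S T)"
    proof (intro sum.cong refl)
      fix t T assume t: "t \<in> T0" and T: "T \<in> {T. T \<subseteq> T0 - {t} \<and> card T = card S}"
      have r1: "rank_in T0 t = rank_in (T0 - T) t + rank_in T t"
        by (rule rank_in_diff[OF fin(2)]) (use T in auto)
      have r2: "rank_sum T T0 + rank_in T t = rank_sum T (T0 - {t}) + card T"
        by (rule rank_sum_remove[OF fin(2) t]) (use T in auto)
      have "even (rank_sum S S0 + rank_sum T T0 + rank_in (T0 - T) t + (rank_in T0 t + rank_sum S S1 + rank_sum T (T0 - {t})))"
      proof -
        have "rank_sum S S0 + rank_sum T T0 + rank_in (T0 - T) t + (rank_in T0 t + rank_sum S S1 + rank_sum T (T0 - {t})) =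
          2 * (rank_sum S S1 + rank_in (T0 - T) t + rank_sum T (T0 - {t}) + card S)"
          using r1 r2 rS T by simp
        thus ?thesis by (metis dvd_triv_left)
      qed
      hence "(-1 :: 'a) ^ (rank_sum S S0 + rank_sum T T0 + rank_in (T0 - T) t) = (-1) ^ (rank_in T0 t + rank_sum S S1 + rank_sum T (T0 - {t}))"
        by (rule minus_one_power_eq_iff_even)
      hence sgn: "(-1 :: 'a) ^ (rank_sum S S0 + rank_sum T T0) * (-1) ^ rank_in (T0 - T) t = (-1) ^ rank_in T0 t * (-1) ^ (rank_sum S S1 + rank_sum T (T0 - {t}))"
        by (simp only: power_add mult.assoc)
      have "T0 - T - {t} = T0 - {t} - T" by auto
      with mult_swap_signs(1)[OF sgn] show "gA S T t = E t * A s t * X t S T"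
        unfolding E_def X_def gA_def by simp
    qed
    finally show "(\<Sum>t\<in>T0. \<Sum>T | T \<subseteq> T0 - {t} \<and> card T = card S. E t * A s t * X t S T) =
      (\<Sum>T | T \<subseteq> T0 \<and> card T = card S. h S T)" ..
  qed simp
  \<comment> \<open>The B-part: the least row joins S, so here the minor of B is expanded.\<close>
  also have "(\<Sum>S\<in>Pow S1. \<Sum>t\<in>T0. \<Sum>T | T \<subseteq> T0 - {t} \<and> card T = card S. E t * B s t * X t S T) =
     (\<Sum>S\<in>insert s ` Pow S1. \<Sum>T | T \<subseteq> T0 \<and> card T = card S. h S T)"
  proof -
    have "(\<Sum>S\<in>insert s ` Pow S1. \<Sum>T | T \<subseteq> T0 \<and> card T = card S. h S T) =
     (\<Sum>S\<in>Pow S1. \<Sum>T | T \<subseteq> T0 \<and> card T = card (insert s S). h (insert s S) T)"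
    proof (rule sum.reindex[unfolded o_def])
      show "inj_on (insert s) (Pow S1)"
        by (rule inj_onI) (auto simp: S1_def)
    qed
    also have "\<dots> = (\<Sum>S\<in>Pow S1. \<Sum>t\<in>T0. \<Sum>T | T \<subseteq> T0 - {t} \<and> card T = card S. E t * B s t * X t S T)"
    proof (rule sum.cong)
      fix S assume "S \<in> Pow S1"
      hence S: "S \<subseteq> S0 - {s}" by (auto simp: S1_def)
      hence fS: "finite S" "s \<notin> S" using fin finite_subset by auto
      have cS: "card (insert s S) = Suc (card S)" using fS by simp
      have rS: "rank_sum (insert s S) S0 = rank_sum S S1 + card S"
        using rank_sum_remove_min[OF fin(1) ne] S unfolding S1_def s_def by auto
      have minS: "Min (insert s S) = s" unfolding s_def
        by (rule Min_eqI) (use fin fS s S in \<open>auto simp: s_def\<close>)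
      have S0S: "S0 - insert s S = S1 - S" by (auto simp: S1_def)
      have "(\<Sum>T | T \<subseteq> T0 \<and> card T = Suc (card S). h (insert s S) T) =
        (\<Sum>T | T \<subseteq> T0 \<and> card T = Suc (card S). \<Sum>t\<in>T. gB S T t)"
      proof (rule sum.cong)
        fix T assume T: "T \<in> {T. T \<subseteq> T0 \<and> card T = Suc (card S)}"
        hence fT: "finite T" using fin finite_subset by auto
        have "minor B (insert s S) T = (\<Sum>t\<in>T. (-1) ^ rank_in T t * B (Min (insert s S)) t * minor B (insert s S - {Min (insert s S)}) (T - {t}))"
          by (rule minor_laplace) (use fT fS T in auto)
        moreover have "insert s S - {s} = S" using fS by auto
        ultimately show "h (insert s S) T =
          (\<Sum>t\<in>T. gB S T t)"
          unfolding minS S0S h_def gB_def by (simp add: sum_distrib_left sum_distrib_right)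
      qed simp
      also have "\<dots> = (\<Sum>t\<in>T0. \<Sum>T | T \<subseteq> T0 - {t} \<and> card T = card S. gB S (insert t T) t)"
        by (rule sum_subsets_inside[OF fin(2)])
      also have "\<dots> = (\<Sum>t\<in>T0. \<Sum>T | T \<subseteq> T0 - {t} \<and> card T = card S. E t * B s t * X t S T)"
      proof (intro sum.cong refl)
        fix t T assume t: "t \<in> T0" and T: "T \<in> {T. T \<subseteq> T0 - {t} \<and> card T = card S}"
        have fT: "finite T" "t \<notin> T" using T fin finite_subset[of T "T0 - {t}"] by auto
        have r0: "rank_in (insert t T) t = rank_in T t"
          unfolding rank_in_def by (rule arg_cong[where f = card]) auto
        have r1: "rank_sum (insert t T) T0 = rank_in T0 t + rank_sum T T0"
          unfolding rank_sum_def using fT by simp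
        have r2: "rank_sum T T0 + rank_in T t = rank_sum T (T0 - {t}) + card T"
          by (rule rank_sum_remove[OF fin(2) t]) (use T in auto)
        have "even (rank_sum (insert s S) S0 + rank_sum (insert t T) T0 + rank_in (insert t T) t + (rank_in T0 t + rank_sum S S1 + rank_sum T (T0 - {t})))"
        proof -
          have "rank_sum (insert s S) S0 + rank_sum (insert t T) T0 + rank_in (insert t T) t + (rank_in T0 t + rank_sum S S1 + rank_sum T (T0 - {t})) =
            2 * (rank_sum S S1 + rank_in T0 t + rank_sum T (T0 - {t}) + card S)"
            using r0 r1 r2 rS T by simp
          thus ?thesis by (metis dvd_triv_left)
        qed
        hence "(-1 :: 'a) ^ (rank_sum (insert s S) S0 + rank_sum (insert t T) T0 + rank_in (insert t T) t) = (-1) ^ (rank_in T0 t + rank_sum S S1 + rank_sum T (T0 - {t}))"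
          by (rule minus_one_power_eq_iff_even)
        hence sgn: "(-1 :: 'a) ^ (rank_sum (insert s S) S0 + rank_sum (insert t T) T0) * (-1) ^ rank_in (insert t T) t = (-1) ^ rank_in T0 t * (-1) ^ (rank_sum S S1 + rank_sum T (T0 - {t}))"
          by (simp only: power_add mult.assoc)
        have "insert t T - {t} = T" "T0 - insert t T = T0 - {t} - T" using fT by auto
        with mult_swap_signs(2)[OF sgn] show "gB S (insert t T) t = E t * B s t * X t S T"
          unfolding E_def X_def gB_def by simp
      qed
      finally show "(\<Sum>T | T \<subseteq> T0 \<and> card T = card (insert s S). h (insert s S) T) =
        (\<Sum>t\<in>T0. \<Sum>T | T \<subseteq> T0 - {t} \<and> card T = card S. E t * B s t * X t S T)"
        unfolding cS .
    qed simp
    finally show ?thesis ..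
  qed
  also have "(\<Sum>S\<in>Pow S1. \<Sum>T | T \<subseteq> T0 \<and> card T = card S. h S T) +
     (\<Sum>S\<in>insert s ` Pow S1. \<Sum>T | T \<subseteq> T0 \<and> card T = card S. h S T) =
     (\<Sum>S\<in>Pow S1 \<union> insert s ` Pow S1. \<Sum>T | T \<subseteq> T0 \<and> card T = card S. h S T)"
    by (rule sum.union_disjoint[symmetric]) (use fin in \<open>auto simp: S1_def\<close>)
  also have "Pow S1 \<union> insert s ` Pow S1 = Pow S0"
    using Pow_insert[of s S1] s by (simp add: S1_def insert_absorb)
  finally show ?case unfolding h_def .
qed

section \<open>A Cauchy--Binet formula for infinite sums\<close>

text \<open>A finite set of functions lies in a finite box, over which the sum of norms factors;
  this bounds all finite partial sums.\<close>

lemma summable_on_prod_PiE: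
  fixes f :: "'a \<Rightarrow> 'b \<Rightarrow> complex"
  assumes fin: "finite A" and s: "\<And>x. x \<in> A \<Longrightarrow> f x summable_on B x"
  shows "(\<lambda>g. \<Prod>x\<in>A. f x (g x)) summable_on (PiE A B)"
proof -
  have sa: "(\<lambda>k. norm (f x k)) summable_on B x" if "x \<in> A" for x
    using s[OF that] by (simp add: summable_on_iff_abs_summable_on_complex)
  have "(\<lambda>g. norm (\<Prod>x\<in>A. f x (g x))) summable_on (PiE A B)"
  proof (rule nonneg_bdd_above_summable_on)
    show "bdd_above (sum (\<lambda>g. norm (\<Prod>x\<in>A. f x (g x))) ` {F. F \<subseteq> PiE A B \<and> finite F})"
    proof (rule bdd_aboveI2)
      fix F assume "F \<in> {F. F \<subseteq> PiE A B \<and> finite F}"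
      hence F: "F \<subseteq> PiE A B" "finite F" by auto
      define C where "C = (\<lambda>x. (\<lambda>g. g x) ` F)"
      have C: "finite (C x)" "x \<in> A \<Longrightarrow> C x \<subseteq> B x" for x
        using F by (auto simp: C_def)
      have "F \<subseteq> PiE A C" using F by (fastforce simp: C_def PiE_def Pi_def)
      hence "(\<Sum>g\<in>F. norm (\<Prod>x\<in>A. f x (g x))) \<le> (\<Sum>g\<in>PiE A C. \<Prod>x\<in>A. norm (f x (g x)))"
        unfolding prod_norm[symmetric]
        by (intro sum_mono2 finite_PiE fin C prod_nonneg) auto
      also have "\<dots> = (\<Prod>x\<in>A. \<Sum>k\<in>C x. norm (f x k))"
        by (rule prod_sum_PiE[symmetric]) (use fin C in auto)
      also have "\<dots> \<le> (\<Prod>x\<in>A. \<Sum>\<^sub>\<infinity>k\<in>B x. norm (f x k))"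
        by (intro prod_mono conjI sum_nonneg finite_sum_le_infsum sa) (use C in auto)
      finally show "(\<Sum>g\<in>F. norm (\<Prod>x\<in>A. f x (g x))) \<le> (\<Prod>x\<in>A. \<Sum>\<^sub>\<infinity>k\<in>B x. norm (f x k))" .
    qed
  qed auto
  thus ?thesis by (rule abs_summable_summable)
qed

lemma has_sum_prod_PiE:
  fixes f :: "'a \<Rightarrow> 'b \<Rightarrow> complex"
  assumes fin: "finite A" and s: "\<And>x. x \<in> A \<Longrightarrow> f x summable_on B x"
  shows "((\<lambda>g. \<Prod>x\<in>A. f x (g x)) has_sum (\<Prod>x\<in>A. infsum (f x) (B x))) (PiE A B)"
proof -
  have "(\<lambda>g. \<Prod>x\<in>A. f x (g x)) summable_on (PiE A B)"
    by (rule summable_on_prod_PiE) (use assms in auto)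
  from has_sum_infsum[OF this] infsum_prod_PiE[OF fin s this] show ?thesis by simp
qed

section \<open>Sorting tuples, and the Cauchy--Binet formula over decreasing ones\<close>

lemma sorting_permutation_exists:
  fixes k :: "nat \<Rightarrow> nat"
  assumes "inj_on k {0..<p}"
  shows "\<exists>\<pi>. \<pi> permutes {0..<p} \<and> (\<forall>i j. i < j \<and> j < p \<longrightarrow> k (\<pi> j) < k (\<pi> i))"
proof -
  define l where "l = sort_key (\<lambda>i. - int (k i)) [0..<p]"
  have l: "length l = p" "distinct l" "set l = {0..<p}" by (simp_all add: l_def)
  define \<pi> where "\<pi> = (\<lambda>i. if i < p then l ! i else i)"
  have "bij_betw (\<lambda>i. l ! i) {0..<p} {0..<p}"
    using bij_betw_nth[OF l(2), of "{0..<p}" "{0..<p}"] l by (simp add: atLeast0LessThan)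
  hence "bij_betw \<pi> {0..<p} {0..<p}"
    by (rule bij_betw_cong[THEN iffD1, rotated]) (auto simp: \<pi>_def)
  hence perm: "\<pi> permutes {0..<p}"
    by (rule bij_imp_permutes) (auto simp: \<pi>_def)
  have srt: "sorted (map (\<lambda>i. - int (k i)) l)" unfolding l_def by simp
  have "k (\<pi> j) < k (\<pi> i)" if ij: "i < j" "j < p" for i j
  proof -
    have "- int (k (l ! i)) \<le> - int (k (l ! j))"
      using sorted_nth_mono[OF srt, of i j] ij l by simp
    moreover have "l ! i \<noteq> l ! j" using ij l by (simp add: nth_eq_iff_index_eq)
    moreover have "l ! i \<in> {0..<p}" "l ! j \<in> {0..<p}" using ij l nth_mem[of i l] nth_mem[of j l] by auto
    ultimately have "k (l ! j) \<noteq> k (l ! i)" using assms by (auto dest: inj_onD)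
    thus ?thesis using \<open>- int (k (l ! i)) \<le> - int (k (l ! j))\<close> ij by (simp add: \<pi>_def)
  qed
  thus ?thesis using perm by blast
qed

text \<open>Both arrangements list the same finite set of values in decreasing order, and
  \<open>k\<close> is injective on the indices because its values along \<pi> are strictly
  ordered.\<close>

lemma sorting_permutation_unique:
  fixes k :: "nat \<Rightarrow> nat"
  assumes "\<pi> permutes {0..<p}" "\<forall>i j. i < j \<and> j < p \<longrightarrow> k (\<pi> j) < k (\<pi> i)"
    and "\<rho> permutes {0..<p}" "\<forall>i j. i < j \<and> j < p \<longrightarrow> k (\<rho> j) < k (\<rho> i)"
  shows "\<pi> = \<rho>"
proof -
  have inj: "inj_on k {0..<p}"
  proof (rule inj_onI)
    fix a b assume ab: "a \<in> {0..<p}" "b \<in> {0..<p}" "k a = k b"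
    obtain i j where ij: "a = \<pi> i" "b = \<pi> j" "i \<in> {0..<p}" "j \<in> {0..<p}"
      using ab permutes_image[OF assms(1)] by (metis imageE)
    thus "a = b" using ab assms(2) by (cases i j rule: linorder_cases) fastforce+
  qed
  have eq: "rev (map (\<lambda>i. k (\<sigma> i)) [0..<p]) = sorted_list_of_set (k ` {0..<p})"
    if \<sigma>: "\<sigma> permutes {0..<p}" "\<forall>i j. i < j \<and> j < p \<longrightarrow> k (\<sigma> j) < k (\<sigma> i)" for \<sigma>
  proof (rule strict_sorted_equal, goal_cases)
    case 1 show ?case by simp
  next
    case 2 show ?case
      using \<sigma>(2) by (auto simp: sorted_wrt_rev sorted_wrt_iff_nth_less rev_nth)
  next
    case 3
    have "(\<lambda>i. k (\<sigma> i)) ` {0..<p} = k ` (\<sigma> ` {0..<p})" by (simp only: image_image)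
    hence im: "(\<lambda>i. k (\<sigma> i)) ` {0..<p} = k ` {0..<p}" by (simp only: permutes_image[OF \<sigma>(1)])
    show ?case by (simp add: im)
  qed
  have "map (\<lambda>i. k (\<pi> i)) [0..<p] = map (\<lambda>i. k (\<rho> i)) [0..<p]"
    using eq[OF assms(1,2)] eq[OF assms(3,4)] by (metis rev_rev_ident)
  hence eqk: "k (\<pi> i) = k (\<rho> i)" if "i < p" for i using that by (simp add: map_eq_conv)
  have "\<pi> i = \<rho> i" if "i < p" for i
    by (rule inj_onD[OF inj eqk[OF that]])
       (use that permutes_in_image[OF assms(1), of i] permutes_in_image[OF assms(3), of i] in auto)
  moreover have "\<pi> i = \<rho> i" if "\<not> i < p" for i
    using that permutes_not_in[OF assms(1), of i] permutes_not_in[OF assms(3), of i] by simp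
  ultimately show ?thesis by (intro ext) metis
qed

lemma det_mat_leibniz:
  "det (mat p p (\<lambda>(i, j). f i j)) = (\<Sum>\<pi> | \<pi> permutes {0..<p}. signof \<pi> * (\<Prod>i = 0..<p. f i (\<pi> i)))"
proof (subst det_def'[of _ p], simp, intro sum.cong refl, goal_cases)
  case (1 \<pi>)
  hence "\<pi> i < p" if "i < p" for i using that permutes_in_image[of \<pi> "{0..<p}" i] by auto
  thus ?case by (intro arg_cong2[of _ _ _ _ "(*)"] prod.cong refl) auto
qed

text \<open>Order is imposed on \<open>key\<close> alone. In the application the entries are pairs
  (y, m) with key m, so the y-components stay free.\<close>

definition decreasing_tuples :: "nat \<Rightarrow> 'k set \<Rightarrow> ('k \<Rightarrow> nat) \<Rightarrow> (nat \<Rightarrow> 'k) set" where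
  "decreasing_tuples p K key = {g \<in> {0..<p} \<rightarrow>\<^sub>E K. \<forall>i j. i < j \<and> j < p \<longrightarrow> key (g j) < key (g i)}"

text \<open>Multilinearity in the rows turns the determinant of sums into a sum over all tuples. A
  repeated key means a repeated node, hence two equal rows, so such tuples contribute 0; the others
  are grouped by the permutation sorting them.\<close>

lemma cauchy_binet_infinite:
  fixes w x :: "'k \<Rightarrow> complex" and key :: "'k \<Rightarrow> nat"
  assumes s: "\<And>a. (\<lambda>\<kappa>. w \<kappa> * x \<kappa> ^ a) summable_on K"
    and key: "\<And>\<kappa> \<mu>. \<kappa> \<in> K \<Longrightarrow> \<mu> \<in> K \<Longrightarrow> key \<kappa> = key \<mu> \<Longrightarrow> x \<kappa> = x \<mu>"
  shows "((\<lambda>g. (\<Prod>i = 0..<p. w (g i)) * det (mat p p (\<lambda>(i, j). x (g i) ^ e j)) * det (mat p p (\<lambda>(i, j). x (g i) ^ f j)))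
     has_sum det (mat p p (\<lambda>(i, j). \<Sum>\<^sub>\<infinity>\<kappa>\<in>K. w \<kappa> * x \<kappa> ^ e i * x \<kappa> ^ f j))) (decreasing_tuples p K key)"
proof -
  define P where "P = {0..<p} \<rightarrow>\<^sub>E K"
  define Dec where "Dec = decreasing_tuples p K key"
  define Perm where "Perm = {\<pi>. \<pi> permutes {0..<p}}"
  define V where "V = (\<lambda>g. det (mat p p (\<lambda>(i, j). x (g i) ^ f j)))"
  define h where "h = (\<lambda>g. (\<Prod>i = 0..<p. w (g i) * x (g i) ^ e i) * V g)"
  define I where "I = det (mat p p (\<lambda>(i, j). \<Sum>\<^sub>\<infinity>\<kappa>\<in>K. w \<kappa> * x \<kappa> ^ e i * x \<kappa> ^ f j))"
  have finP: "finite Perm" unfolding Perm_def by (rule finite_permutations) simp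
  have s': "(\<lambda>\<kappa>. w \<kappa> * x \<kappa> ^ a * x \<kappa> ^ b) summable_on K" for a b
    using s[of "a + b"] by (simp add: power_add mult.assoc)
  have "((\<lambda>g. \<Sum>\<pi>\<in>Perm. signof \<pi> * (\<Prod>i = 0..<p. w (g i) * x (g i) ^ e i * x (g i) ^ f (\<pi> i)))
     has_sum (\<Sum>\<pi>\<in>Perm. signof \<pi> * (\<Prod>i = 0..<p. \<Sum>\<^sub>\<infinity>\<kappa>\<in>K. w \<kappa> * x \<kappa> ^ e i * x \<kappa> ^ f (\<pi> i)))) P"
    unfolding P_def by (intro has_sum_sum_finite has_sum_cmult_right has_sum_prod_PiE s') simp
  moreover have "(\<Sum>\<pi>\<in>Perm. signof \<pi> * (\<Prod>i = 0..<p. w (g i) * x (g i) ^ e i * x (g i) ^ f (\<pi> i))) = h g" for g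
    unfolding h_def V_def det_mat_leibniz Perm_def sum_distrib_left prod.distrib by (simp add: mult_ac)
  moreover have "(\<Sum>\<pi>\<in>Perm. signof \<pi> * (\<Prod>i = 0..<p. \<Sum>\<^sub>\<infinity>\<kappa>\<in>K. w \<kappa> * x \<kappa> ^ e i * x \<kappa> ^ f (\<pi> i))) = I"
    unfolding I_def det_mat_leibniz Perm_def by simp
  ultimately have hP: "(h has_sum I) P" by simp
  \<comment> \<open>The tuples that \<pi> puts in decreasing order.\<close>
  define G where "G = (\<lambda>\<pi>. {g \<in> P. \<forall>i j. i < j \<and> j < p \<longrightarrow> key (g (\<pi> j)) < key (g (\<pi> i))})"
  have zero: "h g = 0" if g: "g \<in> P" "\<not> inj_on (\<lambda>i. key (g i)) {0..<p}" for g
  proof -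
    obtain i j where ij: "i < p" "j < p" "i \<noteq> j" "key (g i) = key (g j)"
      using g(2) by (auto simp: inj_on_def)
    hence xe: "x (g i) = x (g j)" using g(1) by (intro key) (auto simp: P_def)
    have "V g = 0" unfolding V_def
      by (rule det_identical_rows[OF _ ij(3,1,2)]) (use ij xe in \<open>auto intro!: eq_vecI\<close>)
    thus ?thesis by (simp add: h_def)
  qed
  have union: "(\<Union>\<pi>\<in>Perm. G \<pi>) = {g \<in> P. inj_on (\<lambda>i. key (g i)) {0..<p}}"
  proof (intro equalityI subsetI)
    fix g assume "g \<in> (\<Union>\<pi>\<in>Perm. G \<pi>)"
    then obtain \<pi> where \<pi>: "\<pi> permutes {0..<p}" "g \<in> P" "\<forall>i j. i < j \<and> j < p \<longrightarrow> key (g (\<pi> j)) < key (g (\<pi> i))"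
      by (auto simp: Perm_def G_def)
    have "inj_on (\<lambda>i. key (g i)) {0..<p}"
    proof (rule inj_onI)
      fix a b assume ab: "a \<in> {0..<p}" "b \<in> {0..<p}" "key (g a) = key (g b)"
      obtain i j where ij: "a = \<pi> i" "b = \<pi> j" "i \<in> {0..<p}" "j \<in> {0..<p}"
        using ab permutes_image[OF \<pi>(1)] by (metis imageE)
      thus "a = b" using ab \<pi>(3) by (cases i j rule: linorder_cases) fastforce+
    qed
    thus "g \<in> {g \<in> P. inj_on (\<lambda>i. key (g i)) {0..<p}}" using \<pi> by simp
  next
    fix g assume "g \<in> {g \<in> P. inj_on (\<lambda>i. key (g i)) {0..<p}}"
    thus "g \<in> (\<Union>\<pi>\<in>Perm. G \<pi>)"
      using sorting_permutation_exists[of "\<lambda>i. key (g i)" p] by (auto simp: Perm_def G_def)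
  qed
  have disj: "G \<pi> \<inter> G \<rho> = {}" if "\<pi> \<in> Perm" "\<rho> \<in> Perm" "\<pi> \<noteq> \<rho>" for \<pi> \<rho>
  proof (rule ccontr)
    assume "G \<pi> \<inter> G \<rho> \<noteq> {}"
    then obtain g where "g \<in> G \<pi>" "g \<in> G \<rho>" by blast
    hence "\<pi> = \<rho>" using that(1,2)
      by (intro sorting_permutation_unique[of \<pi> p "\<lambda>i. key (g i)" \<rho>]) (simp_all add: Perm_def G_def)
    thus False using that(3) by simp
  qed
  have sG: "h summable_on G \<pi>" for \<pi>
    using has_sum_imp_summable[OF hP] by (rule summable_on_subset_banach) (auto simp: G_def)
  have "I = infsum h P" using hP by (simp add: infsumI)
  also have "\<dots> = infsum h (\<Union>\<pi>\<in>Perm. G \<pi>)"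
    by (rule infsum_cong_neutral) (use zero union in auto)
  also have "\<dots> = (\<Sum>\<pi>\<in>Perm. infsum h (G \<pi>))"
    by (rule sum_infsum[symmetric]) (use finP sG disj in auto)
  finally have I: "I = (\<Sum>\<pi>\<in>Perm. infsum h (G \<pi>))" .
  \<comment> \<open>Transport to decreasing tuples permutes the rows of \<open>V\<close>, giving the
    sign, and moves the exponents to e (\<pi> i). Summation over \<pi> then assembles the alternant
    with exponents e.\<close>
  have hG: "((\<lambda>g. signof \<pi> * (\<Prod>i = 0..<p. w (g i) * x (g i) ^ e (\<pi> i)) * V g) has_sum infsum h (G \<pi>)) Dec"
    if "\<pi> \<in> Perm" for \<pi>
  proof -
    have \<pi>: "\<pi> permutes {0..<p}" using that by (simp add: Perm_def)
    have i\<pi>: "inv_into UNIV \<pi> permutes {0..<p}" by (rule permutes_inv[OF \<pi>])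
    define \<Phi> where "\<Phi> = (\<lambda>g :: nat \<Rightarrow> 'k. restrict (\<lambda>i. g (inv_into UNIV \<pi> i)) {0..<p})"
    have lt: "\<pi> i < p" "inv_into UNIV \<pi> i < p" if "i < p" for i
      using that permutes_in_image[OF \<pi>, of i] permutes_in_image[OF i\<pi>, of i] by auto
    note pinv = permutes_inverses[OF \<pi>]
    have bij: "bij_betw \<Phi> Dec (G \<pi>)"
    proof (rule bij_betw_byWitness[where f' = "\<lambda>g. restrict (\<lambda>i. g (\<pi> i)) {0..<p}"])
      show "\<forall>g\<in>Dec. restrict (\<lambda>i. \<Phi> g (\<pi> i)) {0..<p} = g"
        using lt pinv by (auto simp: Dec_def decreasing_tuples_def \<Phi>_def PiE_def extensional_def fun_eq_iff restrict_def)
      show "\<forall>g\<in>G \<pi>. \<Phi> (restrict (\<lambda>i. g (\<pi> i)) {0..<p}) = g"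
        using lt pinv by (auto simp: G_def P_def \<Phi>_def PiE_def extensional_def fun_eq_iff restrict_def)
      show "\<Phi> ` Dec \<subseteq> G \<pi>"
        using lt pinv by (auto simp: Dec_def decreasing_tuples_def G_def P_def \<Phi>_def PiE_def Pi_def)
      show "(\<lambda>g. restrict (\<lambda>i. g (\<pi> i)) {0..<p}) ` G \<pi> \<subseteq> Dec"
        using lt pinv by (auto simp: Dec_def decreasing_tuples_def G_def P_def PiE_def Pi_def)
    qed
    have val: "h (\<Phi> g) = signof \<pi> * (\<Prod>i = 0..<p. w (g i) * x (g i) ^ e (\<pi> i)) * V g" for g
    proof -
      have "V (\<Phi> g) = det (mat p p (\<lambda>(i, j). mat p p (\<lambda>(i, j). x (g i) ^ f j) $$ (inv_into UNIV \<pi> i, j)))"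
        unfolding V_def by (rule arg_cong[where f = det], rule eq_matI) (auto simp: \<Phi>_def lt)
      also have "\<dots> = signof (inv_into UNIV \<pi>) * V g"
        unfolding V_def by (rule det_permute_rows[OF _ i\<pi>]) simp
      also have "signof (inv_into UNIV \<pi>) = (signof \<pi> :: complex)"
        by (rule signof_inv[OF _ \<pi>]) simp
      finally have V: "V (\<Phi> g) = signof \<pi> * V g" .
      have "(\<Prod>i = 0..<p. w (\<Phi> g i) * x (\<Phi> g i) ^ e i) = (\<Prod>i = 0..<p. w (g (inv_into UNIV \<pi> i)) * x (g (inv_into UNIV \<pi> i)) ^ e i)"
        by (rule prod.cong) (auto simp: \<Phi>_def)
      also have "\<dots> = (\<Prod>i = 0..<p. (\<lambda>i. w (g (inv_into UNIV \<pi> i)) * x (g (inv_into UNIV \<pi> i)) ^ e i) (\<pi> i))"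
        using prod.permute[OF \<pi>, of "\<lambda>i. w (g (inv_into UNIV \<pi> i)) * x (g (inv_into UNIV \<pi> i)) ^ e i"] by (simp add: o_def)
      also have "\<dots> = (\<Prod>i = 0..<p. w (g i) * x (g i) ^ e (\<pi> i))" by (simp add: pinv)
      finally show ?thesis unfolding h_def V by (simp add: mult_ac)
    qed
    have "(h has_sum infsum h (G \<pi>)) (G \<pi>)" by (rule has_sum_infsum[OF sG])
    hence "((\<lambda>g. h (\<Phi> g)) has_sum infsum h (G \<pi>)) Dec"
      using has_sum_reindex_bij_betw[OF bij] by blast
    thus ?thesis unfolding val .
  qed
  have "((\<lambda>g. \<Sum>\<pi>\<in>Perm. signof \<pi> * (\<Prod>i = 0..<p. w (g i) * x (g i) ^ e (\<pi> i)) * V g) has_sum I) Dec"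
    unfolding I by (rule has_sum_sum_finite[OF hG])
  moreover have "(\<Sum>\<pi>\<in>Perm. signof \<pi> * (\<Prod>i = 0..<p. w (g i) * x (g i) ^ e (\<pi> i)) * V g) =
     (\<Prod>i = 0..<p. w (g i)) * det (mat p p (\<lambda>(i, j). x (g i) ^ e j)) * V g" for g
    unfolding det_mat_leibniz Perm_def prod.distrib sum_distrib_left sum_distrib_right by (simp add: mult_ac)
  ultimately show ?thesis unfolding I_def V_def Dec_def by simp
qed

section \<open>Schur functions and alternants\<close>

text \<open>Change from monomials to the Newton polynomials with nodes x 0, x 1, ...: the transition
  matrix is unitriangular, and the matrix of their values is triangular.\<close>

lemma vandermonde_det:
  fixes x :: "nat \<Rightarrow> complex"
  shows "det (mat p p (\<lambda>(i, j). x i ^ j)) = (\<Prod>i<p. \<Prod>k<i. x i - x k)"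
proof -
  define P where "P = (\<lambda>j. \<Prod>k<j. [:- x k, 1:])"
  have monic: "degree (P j) = j \<and> coeff (P j) j = 1" for j
  proof (induction j)
    case (Suc j)
    have "P (Suc j) = [:- x j, 1:] * P j" by (simp add: P_def)
    moreover have "P j \<noteq> 0" using Suc by auto
    hence "degree ([:- x j, 1:] * P j) = Suc j" using Suc by (subst degree_mult_eq) auto
    moreover have "lead_coeff ([:- x j, 1:] * P j) = 1"
      unfolding lead_coeff_mult using Suc by simp
    ultimately show ?case by metis
  qed (simp add: P_def)
  have ev: "poly (P j) y = (\<Prod>k<j. y - x k)" for j y
    by (simp add: P_def poly_prod)
  define A where "A = mat p p (\<lambda>(i, j). x i ^ j)"
  define B where "B = mat p p (\<lambda>(k, j). coeff (P j) k)"
  define C where "C = mat p p (\<lambda>(i, j). poly (P j) (x i))"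
  have carr: "A \<in> carrier_mat p p" "B \<in> carrier_mat p p" "C \<in> carrier_mat p p"
    by (simp_all add: A_def B_def C_def)
  have "C = A * B"
  proof (rule eq_matI)
    fix i j assume "i < dim_row (A * B)" "j < dim_col (A * B)"
    hence ij: "i < p" "j < p" by (auto simp: A_def B_def)
    have "poly (P j) (x i) = (\<Sum>k\<le>j. coeff (P j) k * x i ^ k)"
      using monic[of j] by (simp add: poly_altdef)
    also have "\<dots> = (\<Sum>k<p. coeff (P j) k * x i ^ k)"
      using ij monic[of j] by (intro sum.mono_neutral_left) (auto intro: coeff_eq_0)
    finally show "C $$ (i, j) = (A * B) $$ (i, j)"
      using ij by (simp add: A_def B_def C_def scalar_prod_def atLeast0LessThan mult.commute)
  qed (auto simp: A_def B_def C_def)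
  moreover have "det C = (\<Prod>i<p. \<Prod>k<i. x i - x k)"
  proof -
    have "det C = prod_list (diag_mat C)"
      by (rule det_lower_triangular[OF _ carr(3)]) (auto simp: C_def ev)
    thus ?thesis unfolding prod_list_diag_prod by (simp add: C_def ev atLeast0LessThan)
  qed
  moreover have "det B = 1"
  proof -
    have "det B = prod_list (diag_mat B)"
      using monic by (intro det_upper_triangular[OF _ carr(2)])
        (auto simp: upper_triangular_def B_def intro!: coeff_eq_0)
    thus ?thesis unfolding prod_list_diag_prod using monic by (simp add: B_def)
  qed
  ultimately show ?thesis unfolding A_def[symmetric] using det_mult[OF carr(1,2)] by simp
qed

text \<open>Schur determinants list their exponents in decreasing order, minors in increasing order;
  this permutation of columns mediates.\<close>

definition reversal :: "nat \<Rightarrow> nat \<Rightarrow> nat" where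
  "reversal p i = (if i < p then p - 1 - i else i)"

lemma reversal_permutes: "reversal p permutes {0..<p}"
proof (rule bij_imp_permutes)
  show "bij_betw (reversal p) {0..<p} {0..<p}"
    by (rule bij_betw_byWitness[where f' = "reversal p"]) (auto simp: reversal_def)
qed (simp add: reversal_def)

lemma det_reverse_columns:
  fixes f :: "nat \<Rightarrow> nat \<Rightarrow> complex"
  shows "det (mat p p (\<lambda>(i, j). f i (p - 1 - j))) = signof (reversal p) * det (mat p p (\<lambda>(i, j). f i j))"
proof -
  define A where "A = mat p p (\<lambda>(i, j). f i j)"
  have A: "A\<^sup>T \<in> carrier_mat p p" "A \<in> carrier_mat p p" by (simp_all add: A_def)
  have "mat p p (\<lambda>(i, j). f i (p - 1 - j)) = (mat p p (\<lambda>(i, j). A\<^sup>T $$ (reversal p i, j)))\<^sup>T"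
    by (rule eq_matI) (auto simp: A_def reversal_def)
  hence "det (mat p p (\<lambda>(i, j). f i (p - 1 - j))) = det (mat p p (\<lambda>(i, j). A\<^sup>T $$ (reversal p i, j)))"
    using det_transpose[of "mat p p (\<lambda>(i, j). A\<^sup>T $$ (reversal p i, j))" p] by simp
  also have "\<dots> = signof (reversal p) * det (A\<^sup>T)"
    by (rule det_permute_rows[OF A(1) reversal_permutes])
  also have "det (A\<^sup>T) = det A" by (rule det_transpose[OF A(2)])
  finally show ?thesis unfolding A_def .
qed

lemma signof_square: "signof p * signof p = (1 :: complex)"
  by (simp add: sign_def)

definition alternant :: "nat \<Rightarrow> nat set \<Rightarrow> (nat \<Rightarrow> complex) \<Rightarrow> complex" where
  "alternant p S x = det (mat p p (\<lambda>(i, j). x (i + 1) ^ (nth_elem S (j + 1) - 1)))"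

lemma nth_elem_gap:
  assumes "finite S" "i \<le> j" "j < card S"
  shows "nth_elem S (i + 1) + (j - i) \<le> nth_elem S (j + 1)"
  using assms(2,3)
proof (induction j rule: dec_induct)
  case (step j)
  have "nth_elem S (j + 1) < nth_elem S (Suc j + 1)"
    by (rule nth_elem_strict_mono[OF assms(1)]) (use step in auto)
  thus ?case using step by simp
qed simp

text \<open>The exponent in column j of the Schur numerator, raised by l_1 - 1, is l_(p-j+1) - 1. So
  the monomial prefactor, absorbed into the rows, produces the alternant with exponents l_r - 1 and
  reversed columns.\<close>

lemma schur_alternant:
  assumes S: "finite S" "card S = p" "0 \<notin> S" and p: "p \<ge> 1"
    and nz: "det (mat p p (\<lambda>(i, j). x (i + 1) ^ (p - (j + 1)))) \<noteq> 0"
  shows "det (mat p p (\<lambda>(i, j). x (i + 1) ^ (p - (j + 1)))) *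
    ((\<Prod>r=1..p. x r) ^ (nth_elem S 1 - 1) * schur p (subset_partition p S) x) =
    signof (reversal p) * alternant p S x"
proof -
  define l where "l = nth_elem S 1 - 1"
  have l1: "nth_elem S 1 \<ge> 1"
    using nth_elem_in[of S 0] S p by (cases "nth_elem S 1") auto
  \<comment> \<open>No subtraction truncates: elements of S are at least 1, and by
    \<open>nth_elem_gap\<close> they grow by at least one per position.\<close>
  have ex: "subset_partition p S (j + 1) + p - (j + 1) + l = nth_elem S (p - 1 - j + 1) - 1" if j: "j < p" for j
  proof -
    have "nth_elem S (0 + 1) + (p - 1 - j - 0) \<le> nth_elem S (p - 1 - j + 1)"
      by (rule nth_elem_gap) (use S j in auto)
    moreover have "p - (j + 1) + 1 = p - 1 - j + 1" by simp
    ultimately show ?thesis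
      unfolding subset_partition_def l_def using l1 j by simp
  qed
  have "(\<Prod>r=1..p. x r) ^ l * det (mat p p (\<lambda>(i, j). x (i + 1) ^ (subset_partition p S (j + 1) + p - (j + 1))))
     = det (mat p p (\<lambda>(i, j). x (i + 1) ^ l * x (i + 1) ^ (subset_partition p S (j + 1) + p - (j + 1))))"
  proof -
    have "(\<Prod>r=1..p. x r) = (\<Prod>i = 0..<p. x (i + 1))"
      by (rule prod.reindex_bij_witness[where i = "\<lambda>i. i + 1" and j = "\<lambda>r. r - 1"]) auto
    hence "(\<Prod>r=1..p. x r) ^ l = (\<Prod>i = 0..<p. x (i + 1) ^ l)"
      by (simp only: prod_power_distrib)
    thus ?thesis
      unfolding det_mat_leibniz prod.distrib by (simp add: sum_distrib_left mult_ac)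
  qed
  also have "mat p p (\<lambda>(i, j). x (i + 1) ^ l * x (i + 1) ^ (subset_partition p S (j + 1) + p - (j + 1))) =
     mat p p (\<lambda>(i, j). x (i + 1) ^ (nth_elem S (p - 1 - j + 1) - 1))"
  proof (rule eq_matI, goal_cases)
    case (1 i j)
    hence ij: "i < p" "j < p" by auto
    have "x (i + 1) ^ l * x (i + 1) ^ (subset_partition p S (j + 1) + p - (j + 1)) =
        x (i + 1) ^ (nth_elem S (p - 1 - j + 1) - 1)"
      unfolding ex[OF ij(2), symmetric] power_add by (rule mult.commute)
    thus ?case using ij by simp
  qed auto
  also have "det \<dots> = signof (reversal p) * alternant p S x"
    unfolding alternant_def by (rule det_reverse_columns[of p "\<lambda>i j. x (i + 1) ^ (nth_elem S (j + 1) - 1)"])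
  finally show ?thesis using nz unfolding schur_def l_def by (simp add: field_simps)
qed

text \<open>The squared differences are the product of the two Vandermonde denominators, and the
  reversal sign occurs twice.\<close>

lemma schur_product:
  fixes x :: "nat \<Rightarrow> complex"
  assumes S: "finite S" "card S = p" "0 \<notin> S" and T: "finite T" "card T = p" "0 \<notin> T" and p: "p \<ge> 1"
    and inj: "inj_on x {1..p}"
  shows "(\<Prod>(r, s) \<in> {(r, s). 1 \<le> r \<and> r < s \<and> s \<le> p}. (x r - x s) ^ 2) *
     ((\<Prod>r=1..p. x r) ^ (nth_elem S 1 - 1) * schur p (subset_partition p S) x) *
     ((\<Prod>r=1..p. x r) ^ (nth_elem T 1 - 1) * schur p (subset_partition p T) x) =
     alternant p S x * alternant p T x"
proof -
  define D where "D = det (mat p p (\<lambda>(i, j). x (i + 1) ^ (p - (j + 1))))"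
  define W where "W = (\<Prod>i<p. \<Prod>k<i. x (i + 1) - x (k + 1))"
  have "D = signof (reversal p) * det (mat p p (\<lambda>(i, j). x (i + 1) ^ j))"
    using det_reverse_columns[of p "\<lambda>i j. x (i + 1) ^ j"] unfolding D_def by simp
  hence D: "D = signof (reversal p) * W"
    unfolding W_def vandermonde_det[of p "\<lambda>i. x (i + 1)"] .
  have DD: "D * D = W * W"
    unfolding D using signof_square[of "reversal p"] by (metis mult.assoc mult.left_commute mult_1_left)
  have "W \<noteq> 0" unfolding W_def using inj_onD[OF inj] by fastforce
  hence nz: "D \<noteq> 0" using DD by auto
  have "(\<Prod>(r, s) \<in> {(r, s). 1 \<le> r \<and> r < s \<and> s \<le> p}. (x r - x s) ^ 2) =
     (\<Prod>(i, k) \<in> (SIGMA i:{..<p}. {..<i}). (x (i + 1) - x (k + 1)) ^ 2)"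
    by (rule prod.reindex_bij_witness[where i = "\<lambda>(i, k). (k + 1, i + 1)" and j = "\<lambda>(r, s). (s - 1, r - 1)"])
       (auto simp: power2_commute)
  also have "\<dots> = W ^ 2"
    unfolding W_def by (subst prod.Sigma[symmetric]) (auto simp: prod_power_distrib)
  finally have VD: "(\<Prod>(r, s) \<in> {(r, s). 1 \<le> r \<and> r < s \<and> s \<le> p}. (x r - x s) ^ 2) = D * D"
    unfolding DD by (simp add: power2_eq_square)
  have "D * D * ((\<Prod>r=1..p. x r) ^ (nth_elem S 1 - 1) * schur p (subset_partition p S) x) *
     ((\<Prod>r=1..p. x r) ^ (nth_elem T 1 - 1) * schur p (subset_partition p T) x) =
     (D * ((\<Prod>r=1..p. x r) ^ (nth_elem S 1 - 1) * schur p (subset_partition p S) x)) *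
     (D * ((\<Prod>r=1..p. x r) ^ (nth_elem T 1 - 1) * schur p (subset_partition p T) x))"
    by (simp only: mult_ac)
  also have "\<dots> = (signof (reversal p) * alternant p S x) * (signof (reversal p) * alternant p T x)"
    unfolding D_def schur_alternant[OF S p nz[unfolded D_def]] schur_alternant[OF T p nz[unfolded D_def]] ..
  also have "\<dots> = (signof (reversal p) * signof (reversal p)) * (alternant p S x * alternant p T x)"
    by (simp only: mult_ac)
  finally show ?thesis unfolding VD signof_square by simp
qed

section \<open>The Hankel determinant identity\<close>

definition hankel_entry :: "complex \<Rightarrow> nat \<Rightarrow> nat \<Rightarrow> complex" where
  "hankel_entry q i j = of_real (c_coeff (i + j + 1)) - lambert_sum q (2 * (i + j) + 1)"

lemma theta3_0_minus: "theta3_0 (- q) = sum_sq alt_sign q"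
  unfolding theta3_0_def sum_sq_def
proof (rule infsum_cong)
  fix j :: int
  have "even (nat (j\<^sup>2)) \<longleftrightarrow> even j"
    by (metis even_nat_iff even_power pos2 zero_le_power2)
  hence "(-1 :: complex) ^ nat (j\<^sup>2) = alt_sign j" by (simp add: alt_sign_def)
  moreover have "q ^ nat (j\<^sup>2) = q powi (j * j)"
    by (simp add: power_int_def power2_eq_square)
  ultimately show "(- q) ^ nat (j\<^sup>2) = alt_sign j * q powi (j * j)"
    by (simp add: power_minus[of q])
qed

lemma lambert_fps_nth_odd:
  assumes "0 < norm q" "norm q < 1"
  shows "fact (2 * i + 2 * j + 1) * fps_nth (lambert_fps q) (2 * i + 2 * j + 1) = - 2 * hankel_entry q i j"
proof -
  have odd: "odd (2 * (i + j) + 1)" by simp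
  have "fact (2 * (i + j) + 1) * fps_nth (lambert_fps q) (2 * (i + j) + 1) =
     fact (2 * (i + j) + 1) * fps_nth half_tanh (2 * (i + j) + 1)
     + fact (2 * (i + j) + 1) * fps_nth (exp_sum (lambert_coeff q) of_int) (2 * (i + j) + 1)"
    by (simp add: lambert_fps_def distrib_left)
  also have "\<dots> = - 2 * hankel_entry q i j"
    unfolding c_coeff_eq fps_nth_lambert_coeff[OF assms odd] by (simp add: hankel_entry_def algebra_simps)
  finally show ?thesis by (simp only: distrib_left)
qed

text \<open>The factor -2 in each row contributes 2^n, and F'(0) = -phi^4/4 contributes 4^(n^2) and
  phi^(4 n^2); the signs cancel as n and n^2 have the same parity.\<close>

lemma hankel_det:
  assumes q: "0 < norm q" "norm q < 1"
  shows "2 ^ (2 * n\<^sup>2 + n) * det (mat n n (\<lambda>(i, j). hankel_entry q i j)) =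
     (\<Prod>r=1..2*n-1. fact r) * sum_sq alt_sign q ^ (4 * n\<^sup>2)"
proof -
  define A where "A = mat n n (\<lambda>(i, j). hankel_entry q i j)"
  obtain \<delta> \<alpha> where ode: "fps_deriv (lambert_fps q) ^ 2 =
      fps_const \<delta> + fps_const \<alpha> * lambert_fps q ^ 2 + lambert_fps q ^ 4"
    using lambert_fps_ode[OF q] by blast
  have F1: "fps_nth (lambert_fps q) 1 \<noteq> 0"
    unfolding lambert_fps_nth1[OF q] using sum_sq_alt_sign_nonzero[OF q] by simp
  have "mat n n (\<lambda>(i, j). fact (2 * i + 2 * j + 1) * fps_nth (lambert_fps q) (2 * i + 2 * j + 1)) = (- 2) \<cdot>\<^sub>m A"
    unfolding lambert_fps_nth_odd[OF q] by (rule eq_matI) (simp_all add: A_def)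
  hence "(-2) ^ n * det A = (\<Prod>r=1..2*n-1. fact r) * (- (sum_sq alt_sign q ^ 4 / 4)) ^ (n\<^sup>2)"
    using hankel_det_of_ode[OF lambert_fps_nth0[OF q] F1 ode, of n]
    by (simp add: lambert_fps_nth1[OF q, simplified] A_def)
  also have "(-2 :: complex) ^ n = (-1) ^ n * 2 ^ n" by (rule power_minus)
  also have "(- (sum_sq alt_sign q ^ 4 / 4)) ^ (n\<^sup>2) = (-1) ^ n * (sum_sq alt_sign q ^ (4 * n\<^sup>2) / 4 ^ (n\<^sup>2))"
    unfolding power_minus[of "sum_sq alt_sign q ^ 4 / 4"] by (simp add: power_divide power_mult minus_one_power_iff)
  finally have "(-1) ^ n * (2 ^ n * det A) = (-1) ^ n * ((\<Prod>r=1..2*n-1. fact r) * (sum_sq alt_sign q ^ (4 * n\<^sup>2) / 4 ^ (n\<^sup>2)))"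
    by (simp only: mult.assoc mult.left_commute)
  hence "2 ^ n * det A = (\<Prod>r=1..2*n-1. fact r) * (sum_sq alt_sign q ^ (4 * n\<^sup>2) / 4 ^ (n\<^sup>2))"
    by (simp only: mult_cancel_left) simp
  moreover have "(2::complex) ^ (2 * n\<^sup>2 + n) = 4 ^ (n\<^sup>2) * 2 ^ n"
    by (simp add: power_add power_mult)
  ultimately show ?thesis unfolding A_def[symmetric] by (simp add: mult.assoc)
qed

lemma lambert_sum_tendsto:
  fixes q :: complex
  assumes q: "0 < norm q" "norm q < 1"
    and Q: "\<And>n. norm (Q n) \<le> norm q" "Q \<longlonglongrightarrow> 0"
  shows "(\<lambda>n. lambert_sum (Q n) k) \<longlonglongrightarrow> 0"
  unfolding lambert_sum_def
proof (rule infsum_tendsto_zero_scaled(2)[OF lambert_sum_summable[OF q, of k]])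
  show "(\<lambda>n. norm (Q n) / norm q) \<longlonglongrightarrow> 0"
    by (rule tendsto_divide_zero[OF tendsto_norm_zero[OF Q(2)]])
  fix n :: nat and x :: "nat \<times> nat" assume "x \<in> {1..} \<times> {1..}"
  then obtain y m where x: "x = (y, m)" "y \<ge> 1" "m \<ge> 1" by auto
  hence "m * y \<ge> 1" by simp
  hence "norm (Q n ^ (m * y)) \<le> norm (Q n) / norm q * norm (q ^ (m * y))"
    using q Q(1) by (intro power_le_scaled) auto
  from mult_right_mono[OF this, of "of_nat m ^ k"]
  show "norm (case x of (y, m) \<Rightarrow> (-1) ^ y * (-1) ^ m * Q n ^ (m * y) * of_nat m ^ k)
      \<le> norm (Q n) / norm q * norm (case x of (y, m) \<Rightarrow> (-1) ^ y * (-1) ^ m * q ^ (m * y) * of_nat m ^ k)"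
    by (simp add: x norm_mult norm_power mult_ac)
qed

text \<open>The limit $q \to 0$ of \<open>hankel_det\<close>.\<close>

lemma c_coeff_hankel_det:
  "2 ^ (2 * n\<^sup>2 + n) * det (mat n n (\<lambda>(i, j). complex_of_real (c_coeff (i + j + 1)))) =
     (\<Prod>r=1..2*n-1. fact r)"
proof -
  \<comment> \<open>An arbitrary starting point; only its iterated squares, which tend to 0,
    enter.\<close>
  define q :: complex where "q = 1/2"
  have q: "0 < norm q" "norm q < 1" by (auto simp: q_def)
  define Q where "Q = (\<lambda>k::nat. q ^ 2 ^ k)"
  have Qn: "0 < norm (Q k)" "norm (Q k) < 1" for k
    unfolding Q_def by (rule iterated_squares_norm[OF q])+
  have L: "(\<lambda>k. lambert_sum (Q k) i) \<longlonglongrightarrow> 0" for i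
    unfolding Q_def by (rule lambert_sum_tendsto[OF q iterated_squares_norm(3)[OF q] iterated_squares_tendsto[OF q]])
  have e: "(\<lambda>k. hankel_entry (Q k) i j) \<longlonglongrightarrow> of_real (c_coeff (i + j + 1))" for i j
    unfolding hankel_entry_def using tendsto_diff[OF tendsto_const L] by simp
  have "(\<lambda>k. 2 ^ (2 * n\<^sup>2 + n) * det (mat n n (\<lambda>(i, j). hankel_entry (Q k) i j))) \<longlonglongrightarrow>
     2 ^ (2 * n\<^sup>2 + n) * det (mat n n (\<lambda>(i, j). complex_of_real (c_coeff (i + j + 1))))"
    unfolding det_mat_leibniz by (intro tendsto_intros e)
  moreover have "(\<lambda>k. (\<Prod>r=1..2*n-1. fact r) * sum_sq alt_sign (Q k) ^ (4 * n\<^sup>2)) \<longlonglongrightarrow>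
      (\<Prod>r=1..2*n-1. fact r) * 1 ^ (4 * n\<^sup>2)"
    unfolding Q_def by (intro tendsto_intros theta_iterated_squares_tendsto[OF q])
  ultimately show ?thesis
    unfolding hankel_det[OF Qn] by (simp add: LIMSEQ_unique)
qed

section \<open>Expansion of the determinant\<close>

text \<open>The Lambert matrix is a weighted sum of rank-one matrices over the pairs (y, m), built
  from powers of the node m^2; \<open>pair_weight\<close> takes up the remaining single factor m.
  This is the form that \<open>cauchy_binet_infinite\<close> requires.\<close>

definition pair_weight :: "complex \<Rightarrow> nat \<times> nat \<Rightarrow> complex" where
  "pair_weight q \<kappa> = (case \<kappa> of (y, m) \<Rightarrow> (-1) ^ y * (-1) ^ m * q ^ (m * y) * of_nat m)"

definition pair_node :: "nat \<times> nat \<Rightarrow> complex" where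
  "pair_node \<kappa> = of_nat (snd \<kappa>) ^ 2"

definition lambert_entry :: "complex \<Rightarrow> nat \<Rightarrow> nat \<Rightarrow> complex" where
  "lambert_entry q r s = (\<Sum>\<^sub>\<infinity>\<kappa>\<in>{1..} \<times> {1..}. pair_weight q \<kappa> * pair_node \<kappa> ^ (r - 1) * pair_node \<kappa> ^ (s - 1))"

lemma lambert_entry_eq:
  "lambert_entry q (i + 1) (j + 1) = lambert_sum q (2 * (i + j) + 1)"
  unfolding lambert_entry_def lambert_sum_def
  by (intro infsum_cong) (auto simp: pair_weight_def pair_node_def power_add power_mult power_mult_distrib power2_eq_square mult_ac)

lemma pair_weight_summable:
  assumes "0 < norm q" "norm q < 1"
  shows "(\<lambda>\<kappa>. pair_weight q \<kappa> * pair_node \<kappa> ^ a) summable_on {1..} \<times> {1..}"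
proof -
  have "(\<lambda>(y, m). (-1) ^ y * (-1) ^ m * q ^ (m * y) * of_nat m ^ (2 * a + 1)) summable_on {1..} \<times> {1..}"
    by (rule lambert_sum_summable[OF assms])
  also have "(\<lambda>(y, m). (-1) ^ y * (-1) ^ m * q ^ (m * y) * of_nat m ^ (2 * a + 1)) =
      (\<lambda>\<kappa>. pair_weight q \<kappa> * pair_node \<kappa> ^ a)"
  proof (rule ext, goal_cases)
    case (1 \<kappa>)
    have e: "(of_nat m :: complex) ^ (2 * a + 1) = of_nat m * (of_nat m ^ 2) ^ a" for m
      by (simp add: power_mult)
    show ?case
      by (cases \<kappa>) (simp only: pair_weight_def pair_node_def prod.case snd_conv e mult.assoc)
  qed
  finally show ?thesis .
qed

definition tuple_of_pair :: "nat \<Rightarrow> (nat \<Rightarrow> nat) \<times> (nat \<Rightarrow> nat) \<Rightarrow> nat \<Rightarrow> nat \<times> nat" where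
  "tuple_of_pair p ym = restrict (\<lambda>i. (fst ym (i + 1), snd ym (i + 1))) {0..<p}"

definition pair_of_tuple :: "nat \<Rightarrow> (nat \<Rightarrow> nat \<times> nat) \<Rightarrow> (nat \<Rightarrow> nat) \<times> (nat \<Rightarrow> nat)" where
  "pair_of_tuple p g = (restrict (\<lambda>r. fst (g (r - 1))) {1..p}, restrict (\<lambda>r. snd (g (r - 1))) {1..p})"

lemma tuple_of_pair_bij:
  "bij_betw (tuple_of_pair p) (summation_range p) (decreasing_tuples p ({1..} \<times> {1..}) snd)"
proof (rule bij_betw_byWitness[where f' = "pair_of_tuple p"])
  show "\<forall>a\<in>summation_range p. pair_of_tuple p (tuple_of_pair p a) = a"
    by (auto simp: summation_range_def tuple_of_pair_def pair_of_tuple_def PiE_def extensional_def fun_eq_iff restrict_def)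
  show "\<forall>g\<in>decreasing_tuples p ({1..} \<times> {1..}) snd. tuple_of_pair p (pair_of_tuple p g) = g"
    by (auto simp: decreasing_tuples_def tuple_of_pair_def pair_of_tuple_def PiE_def extensional_def fun_eq_iff restrict_def)
  show "tuple_of_pair p ` summation_range p \<subseteq> decreasing_tuples p ({1..} \<times> {1..}) snd"
    by (auto simp: summation_range_def decreasing_tuples_def tuple_of_pair_def PiE_def Pi_def)
  show "pair_of_tuple p ` decreasing_tuples p ({1..} \<times> {1..}) snd \<subseteq> summation_range p"
  proof (rule image_subsetI)
    fix g assume g: "g \<in> decreasing_tuples p ({1..} \<times> {1..} :: (nat \<times> nat) set) snd"
    have in_K: "fst (g i) \<ge> 1" "snd (g i) \<ge> 1" if "i < p" for i
    proof -
      have "g i \<in> {1..} \<times> {1..}" using g that by (auto simp: decreasing_tuples_def PiE_def Pi_def)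
      thus "fst (g i) \<ge> 1" "snd (g i) \<ge> 1" by (auto simp: mem_Times_iff)
    qed
    have dec: "snd (g j) < snd (g i)" if "i < j" "j < p" for i j
      using g that by (auto simp: decreasing_tuples_def)
    show "pair_of_tuple p g \<in> summation_range p"
      unfolding summation_range_def pair_of_tuple_def
    proof (intro CollectI case_prodI conjI allI impI)
      show "restrict (\<lambda>r. fst (g (r - 1))) {1..p} \<in> {1..p} \<rightarrow>\<^sub>E {1..}"
        using in_K(1) by (intro PiE_I) (auto simp del: One_nat_def)
      show "restrict (\<lambda>r. snd (g (r - 1))) {1..p} \<in> {1..p} \<rightarrow>\<^sub>E {1..}"
        using in_K(2) by (intro PiE_I) (auto simp del: One_nat_def)
      fix r s :: nat assume "1 \<le> r \<and> r < s \<and> s \<le> p"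
      thus "restrict (\<lambda>r. snd (g (r - 1))) {1..p} s < restrict (\<lambda>r. snd (g (r - 1))) {1..p} r"
        using dec[of "r - 1" "s - 1"] by auto
    qed
  qed
qed

text \<open>Unlike the index set of \<open>subset_sum\<close> this admits p = 0, where the pair of
  empty sets gives the determinant of the c_i alone.\<close>

definition subset_pairs :: "nat \<Rightarrow> nat \<Rightarrow> (nat set \<times> nat set) set" where
  "subset_pairs n p = {(S, T). S \<subseteq> {1..n} \<and> T \<subseteq> {1..n} \<and> card S = p \<and> card T = p}"

definition subset_coeff :: "nat \<Rightarrow> nat \<Rightarrow> nat set \<Rightarrow> nat set \<Rightarrow> complex" where
  "subset_coeff n p S T = (-1) ^ (\<Sum>S + \<Sum>T) * of_real (det (D_matrix (n - p) ({1..n} - S) ({1..n} - T)))"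

lemma prod_shift:
  fixes f :: "nat \<Rightarrow> complex"
  shows "(\<Prod>i = 0..<p. f (i + 1)) = (\<Prod>r = 1..p. f r)"
  by (rule prod.reindex_bij_witness[where i = "\<lambda>r. r - 1" and j = "\<lambda>i. i + 1"]) auto

text \<open>For the nodes m_r^2 the squared Vandermonde product and the two Schur functions merge
  into two alternants, so the series term becomes a finite combination of Cauchy--Binet
  summands.\<close>

lemma series_term_eq:
  assumes ym: "(y, m) \<in> summation_range p" and p: "p \<ge> 1"
  shows "series_term q n p y m = (\<Sum>(S, T)\<in>subset_pairs n p. subset_coeff n p S T *
     ((\<Prod>i = 0..<p. pair_weight q (tuple_of_pair p (y, m) i)) *
      det (mat p p (\<lambda>(i, j). pair_node (tuple_of_pair p (y, m) i) ^ (nth_elem S (j + 1) - 1))) *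
      det (mat p p (\<lambda>(i, j). pair_node (tuple_of_pair p (y, m) i) ^ (nth_elem T (j + 1) - 1)))))"
proof -
  define x :: "nat \<Rightarrow> complex" where "x = (\<lambda>i. of_nat (m i) ^ 2)"
  define W where "W = (\<Prod>i = 0..<p. pair_weight q (tuple_of_pair p (y, m) i))"
  define V where "V = (\<Prod>(r, s) \<in> {(r, s). 1 \<le> r \<and> r < s \<and> s \<le> p}. (x r - x s) ^ 2)"
  have W: "W = (-1) ^ (\<Sum>r=1..p. y r) * (-1) ^ (\<Sum>r=1..p. m r) * q ^ (\<Sum>r=1..p. m r * y r) * (\<Prod>r=1..p. of_nat (m r))"
  proof -
    have "W = (\<Prod>i = 0..<p. pair_weight q (y (i + 1), m (i + 1)))"
      unfolding W_def by (rule prod.cong) (auto simp: tuple_of_pair_def)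
    also have "\<dots> = (\<Prod>r=1..p. pair_weight q (y r, m r))"
      by (rule prod_shift[of "\<lambda>r. pair_weight q (y r, m r)"])
    also have "\<dots> = (-1) ^ (\<Sum>r=1..p. y r) * (-1) ^ (\<Sum>r=1..p. m r) * q ^ (\<Sum>r=1..p. m r * y r) * (\<Prod>r=1..p. of_nat (m r))"
      by (simp add: pair_weight_def prod.distrib power_sum)
    finally show ?thesis .
  qed
  have dec: "m s < m r" if "1 \<le> r" "r < s" "s \<le> p" for r s
    using ym that by (auto simp: summation_range_def)
  have inj: "inj_on x {1..p}"
  proof (rule inj_onI)
    fix r s assume rs: "r \<in> {1..p}" "s \<in> {1..p}" "x r = x s"
    have "(of_nat ((m r)\<^sup>2) :: complex) = of_nat ((m s)\<^sup>2)" using rs(3) by (simp add: x_def)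
    hence "(m r)\<^sup>2 = (m s)\<^sup>2" by (simp only: of_nat_eq_iff)
    hence "m r = m s" by (simp add: power2_eq_iff_nonneg)
    thus "r = s" using dec[of r s] dec[of s r] rs by (cases r s rule: linorder_cases) auto
  qed
  have node: "det (mat p p (\<lambda>(i, j). pair_node (tuple_of_pair p (y, m) i) ^ (nth_elem S (j + 1) - 1))) = alternant p S x" for S
    unfolding alternant_def
    by (rule arg_cong[where f = det], rule eq_matI) (auto simp: tuple_of_pair_def pair_node_def x_def)
  have "series_term q n p y m = W * V * subset_sum n p m"
    unfolding series_term_def W V_def x_def by (simp only: mult_ac)
  also have "subset_sum n p m = (\<Sum>(S, T)\<in>subset_pairs n p. subset_coeff n p S T
       * (\<Prod>r=1..p. of_nat (m r)) ^ (2 * nth_elem S 1 + 2 * nth_elem T 1 - 4)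
        * schur p (subset_partition p S) x * schur p (subset_partition p T) x)"
    unfolding subset_sum_def subset_coeff_def x_def
  proof (rule sum.cong)
    show "{(S, T). {} \<subset> S \<and> S \<subseteq> {1..n} \<and> {} \<subset> T \<and> T \<subseteq> {1..n} \<and> card S = p \<and> card T = p} = subset_pairs n p"
      using p by (auto simp: subset_pairs_def)
  qed simp
  also have "W * V * \<dots> = (\<Sum>(S, T)\<in>subset_pairs n p. subset_coeff n p S T * (W * alternant p S x * alternant p T x))"
    unfolding sum_distrib_left
  proof (rule sum.cong)
    fix ST assume "ST \<in> subset_pairs n p"
    then obtain S T where ST: "ST = (S, T)" "S \<subseteq> {1..n}" "T \<subseteq> {1..n}" "card S = p" "card T = p"
      by (auto simp: subset_pairs_def)
    have fin: "finite S" "finite T" "0 \<notin> S" "0 \<notin> T"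
      using ST finite_subset[of _ "{1..n}"] by auto
    have "nth_elem S 1 \<ge> 1" "nth_elem T 1 \<ge> 1"
      using nth_elem_in[of S 0] nth_elem_in[of T 0] fin ST p by (auto simp: Suc_le_eq intro!: gr0I)
    then obtain a b where ab: "nth_elem S 1 = Suc a" "nth_elem T 1 = Suc b"
      by (metis Suc_le_D One_nat_def)
    \<comment> \<open>Since x = m^2, the exponent 2 l_1 + 2 j_1 - 4 of the product of the m_r halves
      to (l_1 - 1) + (j_1 - 1).\<close>
    have "(\<Prod>r=1..p. of_nat (m r)) ^ (2 * nth_elem S 1 + 2 * nth_elem T 1 - 4) =
       (\<Prod>r=1..p. x r) ^ (nth_elem S 1 - 1) * (\<Prod>r=1..p. x r) ^ (nth_elem T 1 - 1)"
      unfolding ab x_def by (simp add: prod_power_distrib[symmetric] power_mult[symmetric] power_add[symmetric] algebra_simps)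
    hence VS: "V * (\<Prod>r=1..p. of_nat (m r)) ^ (2 * nth_elem S 1 + 2 * nth_elem T 1 - 4)
        * schur p (subset_partition p S) x * schur p (subset_partition p T) x = alternant p S x * alternant p T x"
      using schur_product[OF fin(1) ST(4) fin(3) fin(2) ST(5) fin(4) p inj] unfolding V_def by (simp only: mult_ac)
    have swap: "W * V * (c * u * s * t) = c * (W * (V * u * s * t))" for c u s t
      by (simp only: mult_ac)
    have "W * V * (subset_coeff n p S T
       * (\<Prod>r=1..p. of_nat (m r)) ^ (2 * nth_elem S 1 + 2 * nth_elem T 1 - 4)
        * schur p (subset_partition p S) x * schur p (subset_partition p T) x) =
        subset_coeff n p S T * (W * (alternant p S x * alternant p T x))"
      unfolding swap VS ..
    thus "W * V * (case ST of (S, T) \<Rightarrow> subset_coeff n p S T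
       * (\<Prod>r=1..p. of_nat (m r)) ^ (2 * nth_elem S 1 + 2 * nth_elem T 1 - 4)
        * schur p (subset_partition p S) x * schur p (subset_partition p T) x) =
      (case ST of (S, T) \<Rightarrow> subset_coeff n p S T * (W * alternant p S x * alternant p T x))"
      by (simp only: ST(1) prod.case mult.assoc)
  qed simp
  finally show ?thesis unfolding W_def node .
qed

text \<open>For each pair (S, T), \<open>cauchy_binet_infinite\<close> sums the two alternants to a
  minor of the Lambert matrix; the combination over pairs is finite.\<close>

lemma series_has_sum:
  assumes q: "0 < norm q" "norm q < 1" and p: "p \<ge> 1"
  shows "((\<lambda>(y, m). series_term q n p y m) has_sum
     (\<Sum>(S, T)\<in>subset_pairs n p. subset_coeff n p S T * minor (lambert_entry q) S T)) (summation_range p)"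
proof -
  define D where "D = decreasing_tuples p ({1..} \<times> {1..} :: (nat \<times> nat) set) snd"
  define F where "F = (\<lambda>ST g. case ST of (S, T) \<Rightarrow> subset_coeff n p S T *
     ((\<Prod>i = 0..<p. pair_weight q (g i)) *
      det (mat p p (\<lambda>(i, j). pair_node (g i) ^ (nth_elem S (j + 1) - 1))) *
      det (mat p p (\<lambda>(i, j). pair_node (g i) ^ (nth_elem T (j + 1) - 1)))))"
  have "((\<lambda>g. \<Sum>ST\<in>subset_pairs n p. F ST g) has_sum
     (\<Sum>ST\<in>subset_pairs n p. case ST of (S, T) \<Rightarrow> subset_coeff n p S T * minor (lambert_entry q) S T)) D"
  proof (rule has_sum_sum_finite)
    fix ST assume "ST \<in> subset_pairs n p"
    then obtain S T where ST: "ST = (S, T)" "card S = p" "card T = p"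
      by (auto simp: subset_pairs_def)
    have "minor (lambert_entry q) S T = det (mat p p (\<lambda>(i, j). \<Sum>\<^sub>\<infinity>\<kappa>\<in>{1..} \<times> {1..}.
       pair_weight q \<kappa> * pair_node \<kappa> ^ (nth_elem S (i + 1) - 1) * pair_node \<kappa> ^ (nth_elem T (j + 1) - 1)))"
      unfolding minor_def ST lambert_entry_def ..
    thus "(F ST has_sum (case ST of (S, T) \<Rightarrow> subset_coeff n p S T * minor (lambert_entry q) S T)) D"
      unfolding F_def ST(1) prod.case D_def
      by (simp only:) (intro has_sum_cmult_right cauchy_binet_infinite pair_weight_summable[OF q], simp add: pair_node_def)
  qed
  hence "((\<lambda>ym. \<Sum>ST\<in>subset_pairs n p. F ST (tuple_of_pair p ym)) has_sum
     (\<Sum>ST\<in>subset_pairs n p. case ST of (S, T) \<Rightarrow> subset_coeff n p S T * minor (lambert_entry q) S T)) (summation_range p)"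
    unfolding D_def
    by (rule has_sum_reindex_bij_betw[OF tuple_of_pair_bij, of "\<lambda>g. \<Sum>ST\<in>subset_pairs n p. F ST g", THEN iffD2])
  moreover have "(\<Sum>ST\<in>subset_pairs n p. F ST (tuple_of_pair p ym)) = (case ym of (y, m) \<Rightarrow> series_term q n p y m)"
    if "ym \<in> summation_range p" for ym
    using that series_term_eq[of "fst ym" "snd ym" p q n] p by (simp add: F_def case_prod_unfold)
  ultimately show ?thesis by (simp cong: has_sum_cong)
qed

section \<open>The Hankel determinant sorted by the size p of the Lambert minors\<close>

lemma nth_elem_interval: "j < n \<Longrightarrow> nth_elem {1..n} (j + 1) = j + 1"
proof -
  assume "j < n"
  have "sorted_list_of_set {1..n} = [1..<Suc n]"
    by (simp only: atLeastLessThanSuc_atLeastAtMost[symmetric] sorted_list_of_set_range)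
  thus ?thesis using \<open>j < n\<close> by (simp add: nth_elem_def del: upt_Suc)
qed

lemma rank_sum_interval:
  assumes "S \<subseteq> {1..n}"
  shows "rank_sum S {1..n} + card S = \<Sum>S"
proof -
  have "finite S" using assms finite_subset by blast
  have "rank_in {1..n} s + 1 = s" if "s \<in> S" for s
  proof -
    have "{x \<in> {1..n}. x < s} = {1..<s}" using that assms by auto
    moreover have "s \<ge> 1" using that assms by auto
    ultimately show ?thesis by (simp add: rank_in_def)
  qed
  hence "\<Sum>S = (\<Sum>s\<in>S. rank_in {1..n} s + 1)" by (intro sum.cong) auto
  thus ?thesis by (simp only: sum.distrib rank_sum_def) simp
qed

lemma minor_uminus: "minor (\<lambda>i j. - A i j) S T = (-1) ^ card S * minor (A :: nat \<Rightarrow> nat \<Rightarrow> complex) S T"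
proof -
  have "mat (card S) (card S) (\<lambda>(i, j). - A (nth_elem S (i + 1)) (nth_elem T (j + 1))) =
    (-1) \<cdot>\<^sub>m mat (card S) (card S) (\<lambda>(i, j). A (nth_elem S (i + 1)) (nth_elem T (j + 1)))"
    by (rule eq_matI) auto
  thus ?thesis unfolding minor_def by simp
qed

lemma det_of_real: "det (mat k k (\<lambda>(i, j). complex_of_real (f i j))) = of_real (det (mat k k (\<lambda>(i, j). f i j)))"
  unfolding det_mat_leibniz by (simp add: of_real_sum of_real_prod of_real_mult)

text \<open>\<open>minor_add\<close> with the negated Lambert matrix as second summand, whence
  (-1)^p. Since S and T have equal size, the rank exponents and the plain sums of S and T differ by
  2p, so the signs agree.\<close>

lemma hankel_det_expansion:
  "det (mat n n (\<lambda>(i, j). hankel_entry q i j)) =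
     det (mat n n (\<lambda>(i, j). complex_of_real (c_coeff (i + j + 1)))) +
     (\<Sum>p=1..n. (-1) ^ p * (\<Sum>(S, T)\<in>subset_pairs n p. subset_coeff n p S T * minor (lambert_entry q) S T))"
proof -
  define I where "I = {1..n}"
  define A where "A = (\<lambda>r s. complex_of_real (c_coeff (r + s - 1)))"
  define f where "f = (\<lambda>(S, T). (-1) ^ card S * (subset_coeff n (card S) S T * minor (lambert_entry q) S T))"
  have A: "minor A U V = of_real (det (D_matrix k U V))" if "card U = k" for U V k
    unfolding minor_def A_def D_matrix_def that by (rule det_of_real)
  have "det (mat n n (\<lambda>(i, j). hankel_entry q i j)) = minor (\<lambda>r s. A r s + - lambert_entry q r s) I I"
  proof -
    have "mat n n (\<lambda>(i, j). hankel_entry q i j) = mat n n (\<lambda>(i, j). A (nth_elem I (i + 1)) (nth_elem I (j + 1)) + - lambert_entry q (nth_elem I (i + 1)) (nth_elem I (j + 1)))"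
    proof (rule eq_matI, goal_cases)
      case (1 i j)
      hence ij: "i < n" "j < n" by auto
      have "hankel_entry q i j = A (i + 1) (j + 1) + - lambert_entry q (i + 1) (j + 1)"
        unfolding lambert_entry_eq by (simp add: hankel_entry_def A_def)
      thus ?case using ij by (simp only: index_mat prod.case I_def nth_elem_interval)
    qed auto
    thus ?thesis unfolding minor_def by (simp add: I_def)
  qed
  also have "\<dots> = (\<Sum>S\<in>Pow I. \<Sum>T | T \<subseteq> I \<and> card T = card S.
      (-1) ^ (rank_sum S I + rank_sum T I) * minor (\<lambda>r s. - lambert_entry q r s) S T * minor A (I - S) (I - T))"
    by (rule minor_add) (auto simp: I_def)
  also have "\<dots> = (\<Sum>S\<in>Pow I. \<Sum>T | T \<subseteq> I \<and> card T = card S. f (S, T))"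
  proof (intro sum.cong refl)
    fix S T assume S: "S \<in> Pow I" and T: "T \<in> {T. T \<subseteq> I \<and> card T = card S}"
    have fin: "finite S" using S finite_subset by (auto simp: I_def)
    have "rank_sum S I + card S = \<Sum>S"
      unfolding I_def by (rule rank_sum_interval) (use S I_def in blast)
    moreover have "rank_sum T I + card T = \<Sum>T"
      unfolding I_def by (rule rank_sum_interval) (use T I_def in blast)
    ultimately have sums: "\<Sum>S + \<Sum>T = rank_sum S I + rank_sum T I + 2 * card S" using T by simp
    have "(-1 :: complex) ^ (\<Sum>S + \<Sum>T) = (-1) ^ (rank_sum S I + rank_sum T I)"
      unfolding sums power_add power_mult by simp
    moreover have "card (I - S) = n - card S"
      using S fin by (subst card_Diff_subset) (auto simp: I_def)
    ultimately show "(-1) ^ (rank_sum S I + rank_sum T I) * minor (\<lambda>r s. - lambert_entry q r s) S T * minor A (I - S) (I - T) = f (S, T)"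
      unfolding f_def prod.case subset_coeff_def minor_uminus by (simp add: A I_def mult_ac)
  qed
  also have "\<dots> = (\<Sum>x\<in>(SIGMA S:Pow I. {T. T \<subseteq> I \<and> card T = card S}). f x)"
    by (subst sum.Sigma) (auto simp: I_def intro: finite_subset[of _ "Pow {1..n}"])
  also have "\<dots> = (\<Sum>p\<in>{0..n}. \<Sum>x | x \<in> (SIGMA S:Pow I. {T. T \<subseteq> I \<and> card T = card S}) \<and> card (fst x) = p. f x)"
  proof (rule sum.group[symmetric])
    show "finite (SIGMA S:Pow I. {T. T \<subseteq> I \<and> card T = card S})"
      by (rule finite_subset[of _ "Pow I \<times> Pow I"]) (auto simp: I_def)
    show "(\<lambda>x. card (fst x)) ` (SIGMA S:Pow I. {T. T \<subseteq> I \<and> card T = card S}) \<subseteq> {0..n}"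
      using card_mono[of "{1..n}"] by (fastforce simp: I_def)
  qed simp
  also have "\<dots> = (\<Sum>p\<in>{0..n}. (-1) ^ p * (\<Sum>(S, T)\<in>subset_pairs n p. subset_coeff n p S T * minor (lambert_entry q) S T))"
  proof (rule sum.cong)
    fix p
    have set: "{x. x \<in> (SIGMA S:Pow I. {T. T \<subseteq> I \<and> card T = card S}) \<and> card (fst x) = p} = subset_pairs n p"
      by (auto simp: subset_pairs_def I_def)
    show "(\<Sum>x | x \<in> (SIGMA S:Pow I. {T. T \<subseteq> I \<and> card T = card S}) \<and> card (fst x) = p. f x) =
      (-1) ^ p * (\<Sum>(S, T)\<in>subset_pairs n p. subset_coeff n p S T * minor (lambert_entry q) S T)"
      unfolding set sum_distrib_left by (rule sum.cong) (auto simp: f_def subset_pairs_def)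
  qed simp
  also have "\<dots> = (\<Sum>(S, T)\<in>subset_pairs n 0. subset_coeff n 0 S T * minor (lambert_entry q) S T) +
     (\<Sum>p=1..n. (-1) ^ p * (\<Sum>(S, T)\<in>subset_pairs n p. subset_coeff n p S T * minor (lambert_entry q) S T))"
    by (subst sum.atLeast_Suc_atMost) auto
  also have "subset_pairs n 0 = {({}, {})}"
  proof -
    have "S = {}" if "S \<subseteq> {1..n}" "card S = 0" for S
      using that finite_subset[of S "{1..n}"] by simp
    thus ?thesis by (auto simp: subset_pairs_def)
  qed
  also have "(\<Sum>(S, T)\<in>{({}, {})}. subset_coeff n 0 S T * minor (lambert_entry q) S T) = of_real (det (D_matrix n I I))"
    by (simp add: subset_coeff_def minor_def I_def)
  also have "D_matrix n I I = mat n n (\<lambda>(i, j). c_coeff (i + j + 1))"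
    unfolding D_matrix_def by (rule eq_matI) (auto simp: I_def nth_elem_interval[simplified])
  finally show ?thesis by (simp only: det_of_real)
qed

text \<open>The first conjunct certifies that the multiple series converge, so that no
  \<open>infsum\<close> in the formula is a default value.\<close>

theorem theorem7p1:
  fixes q :: complex and n :: nat
  assumes "0 < norm q" and "norm q < 1" and "n \<ge> 1"
  shows "(\<forall>p\<in>{1..n}. (\<lambda>(y, m). series_term q n p y m) summable_on summation_range p) \<and>
    theta3_0 (-q) ^ (4 * n\<^sup>2) =
      1 + (\<Sum>p=1..n. (-1) ^ p * 2 ^ (2 * n\<^sup>2 + n) * (\<Prod>r=1..2*n-1. inverse (fact r))
             * (\<Sum>\<^sub>\<infinity>(y, m)\<in>summation_range p. series_term q n p y m))"
proof
  show "\<forall>p\<in>{1..n}. (\<lambda>(y, m). series_term q n p y m) summable_on summation_range p"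
    using has_sum_imp_summable[OF series_has_sum[OF assms(1,2)]] by auto
  define facts :: complex where "facts = (\<Prod>r=1..2*n-1. fact r)"
  define N :: complex where "N = 2 ^ (2 * n\<^sup>2 + n)"
  define Z where "Z = (\<lambda>p. \<Sum>(S, T)\<in>subset_pairs n p. subset_coeff n p S T * minor (lambert_entry q) S T)"
  have nz: "facts \<noteq> 0" unfolding facts_def by simp
  have inv: "(\<Prod>r=1..2*n-1. inverse (fact r)) = inverse facts"
    unfolding facts_def using prod_inversef[of "fact :: nat \<Rightarrow> complex" "{1..2*n-1}"] by (simp only: o_def)
  have "theta3_0 (- q) ^ (4 * n\<^sup>2) = inverse facts * (N * det (mat n n (\<lambda>(i, j). hankel_entry q i j)))"
    unfolding N_def hankel_det[OF assms(1,2)] theta3_0_minus facts_def[symmetric] using nz by simp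
  also have "\<dots> = inverse facts * (N * det (mat n n (\<lambda>(i, j). complex_of_real (c_coeff (i + j + 1))))) +
     inverse facts * N * (\<Sum>p=1..n. (-1) ^ p * Z p)"
    unfolding hankel_det_expansion Z_def by (simp add: algebra_simps)
  \<comment> \<open>The p = 0 contribution: the Hankel determinant of the c_i, multiplied by the
    prefactor, is exactly the leading 1.\<close>
  also have "\<dots> = 1 + inverse facts * N * (\<Sum>p=1..n. (-1) ^ p * Z p)"
    unfolding N_def c_coeff_hankel_det facts_def[symmetric] using nz by simp
  also have "\<dots> = 1 + (\<Sum>p=1..n. (-1) ^ p * N * inverse facts * Z p)"
    by (simp add: sum_distrib_left mult_ac)
  also have "\<dots> = 1 + (\<Sum>p=1..n. (-1) ^ p * N * inverse facts * (\<Sum>\<^sub>\<infinity>(y, m)\<in>summation_range p. series_term q n p y m))"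
    unfolding Z_def using infsumI[OF series_has_sum[OF assms(1,2), of _ n]] by simp
  finally show "theta3_0 (-q) ^ (4 * n\<^sup>2) =
      1 + (\<Sum>p=1..n. (-1) ^ p * 2 ^ (2 * n\<^sup>2 + n) * (\<Prod>r=1..2*n-1. inverse (fact r))
             * (\<Sum>\<^sub>\<infinity>(y, m)\<in>summation_range p. series_term q n p y m))"
    unfolding N_def inv .
qed

end
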